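(* If a finite pure-state ensemble $\mathcal{E}$ can be visibly compressed to $Q$ qubits per signal and $R$ classical bits per signal, then $Q\ge M(\mathcal{E},R)$. Equivalently, $Q^*(R)\ge M(\mathcal{E},R)$.
   Context: Let $d\ge 1$, let $\mathcal I$ be a finite set, and let $\mathcal{E}=\{|\varphi_i\rangle,p_i\}_{i\in\mathcal I}$ be an ensemble of pure states on $\mathbb{C}^d$; write $\varphi_i=|\varphi_i\rangle\langle\varphi_i|$. All logarithms are to base 2 and $S(\rho)=-\mathrm{Tr}\,\rho\log\rho$. For $I=i_1\dots i_n$ put $|\varphi_I\rangle=\bigotimes_k|\varphi_{i_k}\rangle$ and $p_I=\prod_k p_{i_k}$. A visible code of block length $n$ consists of finite-dimensional registers $\mathcal H_B$ (quantum) and $\mathcal H_C$ (classical, with orthonormal basis $\{|j\rangle\}$), an arbitrary encoding $I\mapsto E_n(I)=\sum_j p(j|I)\,\omega_{I,j}\otimes|j\rangle\langle j|$, and a CPTP decoding map $D_n$ into operators on $(\mathbb{C}^d)^{\otimes n}$. - Fidelity: $\sum_Ip_I\langle\varphi_I|D_n(E_n(I))|\varphi_I\rangle$. - Classical rate: $\frac1n\log\dim\mathcal H_C$. - Quantum rate: $\frac1n\log\dim\mathcal H_B$. $\mathcal{E}$ can be visibly compressed to $R$ classical bits plus $Q$ qubits per signal if for all $\epsilon,\delta>0$ there is $N$ such that for all $n>N$ there exists such a code with fidelity $\ge 1-\epsilon$, classical rate $\le R+\delta$ and quantum rate $\le Q+\delta$. $Q^*(R)$ is the infimum of such $Q$.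 For a finite set $\mathcal J$ and conditional distribution $p(j|i)$, let $\rho^{ABC}=\sum_ip_i|i\rangle\langle i|\otimes\varphi_i\otimes\sum_jp(j|i)|j\rangle\langle j|$. Define $S(A:C)=S(A)+S(C)-S(AC)$ and $S(A:B|C)=S(AC)+S(BC)-S(ABC)-S(C)$. Then $M(\mathcal{E},R)=\inf\{S(A:B|C):S(A:C)\le R\}$ over all finite $\mathcal J$ and conditional distributions. *)

theory Defs
  imports "Jordan_Normal_Form.Char_Poly" "HOL-Library.FuncSet"
begin

definition mtrace :: "complex mat \<Rightarrow> complex" where
  "mtrace A = (\<Sum>i<dim_row A. A $$ (i, i))"

definition qform :: "complex mat \<Rightarrow> complex vec \<Rightarrow> complex" where
  "qform A v = (\<Sum>r<dim_vec v. \<Sum>s<dim_vec v. cnj (v $ r) * A $$ (r, s) * v $ s)"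

definition psd :: "nat \<Rightarrow> complex mat \<Rightarrow> bool" where
  "psd n A \<longleftrightarrow> A \<in> carrier_mat n n \<and> (\<forall>v \<in> carrier_vec n. qform A v \<in> \<real> \<and> Re (qform A v) \<ge> 0)"

definition density :: "nat \<Rightarrow> complex mat \<Rightarrow> bool" where
  "density n A \<longleftrightarrow> psd n A \<and> mtrace A = 1"

text \<open>Kronecker (tensor) products; first factor is the most significant index\<close>
definition mkron :: "complex mat \<Rightarrow> complex mat \<Rightarrow> complex mat" where
  "mkron A B = mat (dim_row A * dim_row B) (dim_col A * dim_col B)
     (\<lambda>(r, s). A $$ (r div dim_row B, s div dim_col B) * B $$ (r mod dim_row B, s mod dim_col B))"

definition vkron :: "complex vec \<Rightarrow> complex vec \<Rightarrow> complex vec" where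
  "vkron u v = vec (dim_vec u * dim_vec v) (\<lambda>r. u $ (r div dim_vec v) * v $ (r mod dim_vec v))"

definition proj :: "complex vec \<Rightarrow> complex mat" where
  "proj v = mat (dim_vec v) (dim_vec v) (\<lambda>(r, s). v $ r * cnj (v $ s))"

definition ketbra :: "nat \<Rightarrow> nat \<Rightarrow> complex mat" where
  "ketbra m j = mat m m (\<lambda>(r, s). if r = j \<and> s = j then 1 else 0)"

definition msum :: "nat \<Rightarrow> nat \<Rightarrow> ('b \<Rightarrow> complex mat) \<Rightarrow> 'b set \<Rightarrow> complex mat" where
  "msum n n' f S = mat n n' (\<lambda>(r, s). \<Sum>x\<in>S. f x $$ (r, s))"

definition lin_map :: "nat \<Rightarrow> nat \<Rightarrow> (complex mat \<Rightarrow> complex mat) \<Rightarrow> bool" where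
  "lin_map din dout D \<longleftrightarrow>
     (\<forall>X \<in> carrier_mat din din. D X \<in> carrier_mat dout dout) \<and>
     (\<forall>X \<in> carrier_mat din din. \<forall>Y \<in> carrier_mat din din. \<forall>a b :: complex.
        D (a \<cdot>\<^sub>m X + b \<cdot>\<^sub>m Y) = a \<cdot>\<^sub>m D X + b \<cdot>\<^sub>m D Y)"

text \<open>(id_m \<otimes> D) applied to an (m*din) x (m*din) matrix Y, where the ancilla C^m is the
  first (most significant) tensor factor: D is applied blockwise.\<close>
definition id_tensor :: "nat \<Rightarrow> nat \<Rightarrow> nat \<Rightarrow> (complex mat \<Rightarrow> complex mat) \<Rightarrow> complex mat \<Rightarrow> complex mat" where
  "id_tensor m din dout D Y = mat (m * dout) (m * dout)
     (\<lambda>(r, s). D (mat din din (\<lambda>(u, v). Y $$ ((r div dout) * din + u, (s div dout) * din + v)))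
                  $$ (r mod dout, s mod dout))"

definition cptp :: "nat \<Rightarrow> nat \<Rightarrow> (complex mat \<Rightarrow> complex mat) \<Rightarrow> bool" where
  "cptp din dout D \<longleftrightarrow> lin_map din dout D \<and>
     (\<forall>X \<in> carrier_mat din din. mtrace (D X) = mtrace X) \<and>
     (\<forall>m \<ge> 1. \<forall>Y. psd (m * din) Y \<longrightarrow> psd (m * dout) (id_tensor m din dout D Y))"

definition eta :: "real \<Rightarrow> real" where
  "eta x = (if x \<le> 0 then 0 else - x * log 2 x)"

text \<open>S(rho) = - Tr rho log rho = sum over eigenvalues (with algebraic multiplicity, i.e. as
  roots of the characteristic polynomial) of - lambda log lambda.\<close>
definition vn_entropy :: "complex mat \<Rightarrow> real" where
  "vn_entropy \<rho> = (\<Sum>ev \<in> {x. poly (char_poly \<rho>) x = 0}.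
       real (order ev (char_poly \<rho>)) * eta (Re ev))"

text \<open>For a matrix on C^da \<otimes> C^db \<otimes> C^dc (index (a*db+b)*dc+c), keep the factors flagged
  True and trace out the others.\<close>
definition ptrace3 :: "nat \<Rightarrow> nat \<Rightarrow> nat \<Rightarrow> bool \<Rightarrow> bool \<Rightarrow> bool \<Rightarrow> complex mat \<Rightarrow> complex mat" where
  "ptrace3 da db dc kA kB kC M =
    (let da' = (if kA then da else 1); db' = (if kB then db else 1); dc' = (if kC then dc else 1);
         ta = (if kA then 1 else da); tb = (if kB then 1 else db); tc = (if kC then 1 else dc);
         enc = (\<lambda>a b c. (a * db + b) * dc + c)
     in mat (da' * db' * dc') (da' * db' * dc')
       (\<lambda>(r, s).
          let ra = r div (db' * dc'); rb = (r div dc') mod db'; rc = r mod dc';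
              sa = s div (db' * dc'); sb = (s div dc') mod db'; sc = s mod dc'
          in \<Sum>xa<ta. \<Sum>xb<tb. \<Sum>xc<tc.
               M $$ (enc (if kA then ra else xa) (if kB then rb else xb) (if kC then rc else xc),
                     enc (if kA then sa else xa) (if kB then sb else xb) (if kC then sc else xc))))"

definition ensemble :: "nat \<Rightarrow> nat \<Rightarrow> (nat \<Rightarrow> real) \<Rightarrow> (nat \<Rightarrow> complex vec) \<Rightarrow> bool" where
  "ensemble d k p \<phi> \<longleftrightarrow> d \<ge> 1 \<and> (\<forall>i<k. p i \<ge> 0) \<and> (\<Sum>i<k. p i) = 1 \<and>
     (\<forall>i<k. \<phi> i \<in> carrier_vec d \<and> (\<Sum>r<d. cmod (\<phi> i $ r) ^ 2) = 1)"

definition cond_dist :: "nat \<Rightarrow> nat \<Rightarrow> (nat \<Rightarrow> nat \<Rightarrow> real) \<Rightarrow> bool" where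
  "cond_dist k m q \<longleftrightarrow> (\<forall>i<k. \<forall>j<m. q i j \<ge> 0) \<and> (\<forall>i<k. (\<Sum>j<m. q i j) = 1)"

definition rhoABC :: "nat \<Rightarrow> nat \<Rightarrow> (nat \<Rightarrow> real) \<Rightarrow> (nat \<Rightarrow> complex vec) \<Rightarrow> nat \<Rightarrow> (nat \<Rightarrow> nat \<Rightarrow> real) \<Rightarrow> complex mat" where
  "rhoABC d k p \<phi> m q = msum (k * d * m) (k * d * m)
     (\<lambda>i. of_real (p i) \<cdot>\<^sub>m mkron (mkron (ketbra k i) (proj (\<phi> i)))
                              (msum m m (\<lambda>j. of_real (q i j) \<cdot>\<^sub>m ketbra m j) {..<m})) {..<k}"

definition mutual_AC :: "nat \<Rightarrow> nat \<Rightarrow> (nat \<Rightarrow> real) \<Rightarrow> (nat \<Rightarrow> complex vec) \<Rightarrow> nat \<Rightarrow> (nat \<Rightarrow> nat \<Rightarrow> real) \<Rightarrow> real" where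
  "mutual_AC d k p \<phi> m q = (let \<rho> = rhoABC d k p \<phi> m q in
      vn_entropy (ptrace3 k d m True False False \<rho>) + vn_entropy (ptrace3 k d m False False True \<rho>)
      - vn_entropy (ptrace3 k d m True False True \<rho>))"

definition cond_mutual_AB_C :: "nat \<Rightarrow> nat \<Rightarrow> (nat \<Rightarrow> real) \<Rightarrow> (nat \<Rightarrow> complex vec) \<Rightarrow> nat \<Rightarrow> (nat \<Rightarrow> nat \<Rightarrow> real) \<Rightarrow> real" where
  "cond_mutual_AB_C d k p \<phi> m q = (let \<rho> = rhoABC d k p \<phi> m q in
      vn_entropy (ptrace3 k d m True False True \<rho>) + vn_entropy (ptrace3 k d m False True True \<rho>)
      - vn_entropy \<rho> - vn_entropy (ptrace3 k d m False False True \<rho>))"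

definition M_fun :: "nat \<Rightarrow> nat \<Rightarrow> (nat \<Rightarrow> real) \<Rightarrow> (nat \<Rightarrow> complex vec) \<Rightarrow> real \<Rightarrow> real" where
  "M_fun d k p \<phi> R = Inf {cond_mutual_AB_C d k p \<phi> m q | m q.
      cond_dist k m q \<and> mutual_AC d k p \<phi> m q \<le> R}"

fun tens_state :: "(nat \<Rightarrow> complex vec) \<Rightarrow> (nat \<Rightarrow> nat) \<Rightarrow> nat \<Rightarrow> complex vec" where
  "tens_state \<phi> I 0 = vec 1 (\<lambda>_. 1)"
| "tens_state \<phi> I (Suc n) = vkron (tens_state \<phi> I n) (\<phi> (I n))"

abbreviation strings :: "nat \<Rightarrow> nat \<Rightarrow> (nat \<Rightarrow> nat) set" where
  "strings n k \<equiv> {..<n} \<rightarrow>\<^sub>E {..<k}"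

definition enc_state :: "nat \<Rightarrow> nat \<Rightarrow> (nat \<Rightarrow> real) \<Rightarrow> (nat \<Rightarrow> complex mat) \<Rightarrow> complex mat" where
  "enc_state dB dC pj \<omega> = msum (dB * dC) (dB * dC) (\<lambda>j. of_real (pj j) \<cdot>\<^sub>m mkron (\<omega> j) (ketbra dC j)) {..<dC}"

definition visible_code :: "nat \<Rightarrow> nat \<Rightarrow> nat \<Rightarrow> nat \<Rightarrow> nat \<Rightarrow>
    ((nat \<Rightarrow> nat) \<Rightarrow> nat \<Rightarrow> real) \<Rightarrow> ((nat \<Rightarrow> nat) \<Rightarrow> nat \<Rightarrow> complex mat) \<Rightarrow>
    (complex mat \<Rightarrow> complex mat) \<Rightarrow> bool" where
  "visible_code d k n dB dC pj \<omega> D \<longleftrightarrow> dB \<ge> 1 \<and> dC \<ge> 1 \<and>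
     (\<forall>I \<in> strings n k. (\<forall>j<dC. pj I j \<ge> 0 \<and> density dB (\<omega> I j)) \<and> (\<Sum>j<dC. pj I j) = 1) \<and>
     cptp (dB * dC) (d ^ n) D"

definition code_fidelity :: "nat \<Rightarrow> (nat \<Rightarrow> real) \<Rightarrow> (nat \<Rightarrow> complex vec) \<Rightarrow> nat \<Rightarrow> nat \<Rightarrow> nat \<Rightarrow>
    ((nat \<Rightarrow> nat) \<Rightarrow> nat \<Rightarrow> real) \<Rightarrow> ((nat \<Rightarrow> nat) \<Rightarrow> nat \<Rightarrow> complex mat) \<Rightarrow>
    (complex mat \<Rightarrow> complex mat) \<Rightarrow> real" where
  "code_fidelity k p \<phi> n dB dC pj \<omega> D =
     (\<Sum>I \<in> strings n k. (\<Prod>t<n. p (I t)) *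
        Re (qform (D (enc_state dB dC (pj I) (\<omega> I))) (tens_state \<phi> I n)))"

definition visibly_compressible :: "nat \<Rightarrow> nat \<Rightarrow> (nat \<Rightarrow> real) \<Rightarrow> (nat \<Rightarrow> complex vec) \<Rightarrow> real \<Rightarrow> real \<Rightarrow> bool" where
  "visibly_compressible d k p \<phi> R Q \<longleftrightarrow>
     (\<forall>\<epsilon>>0. \<forall>\<delta>>0. \<exists>N. \<forall>n>N. \<exists>dB dC pj \<omega> D.
        visible_code d k n dB dC pj \<omega> D \<and>
        code_fidelity k p \<phi> n dB dC pj \<omega> D \<ge> 1 - \<epsilon> \<and>
        log 2 (real dC) / real n \<le> R + \<delta> \<and>
        log 2 (real dB) / real n \<le> Q + \<delta>)"

end

theory Submission
  imports Defs "Jordan_Normal_Form.Schur_Decomposition"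
begin

text \<open>
  Fix a block code and condition on the classical message \<open>j\<close>. Revealing the letters of the source
  string one at a time splits the Holevo information of the quantum register, which is at most
  \<open>log dB\<close>, into increments, one for each position \<open>t\<close> and each prefix of length \<open>t\<close>. Decoding and
  tracing out all letters but the \<open>t\<close>-th is a channel, so each increment dominates the Holevo
  information of the decoded \<open>t\<close>-th letter, which by continuity is close to that of the pure states
  \<open>\<phi> i\<close>. Taking position, message and prefix together as the classical register of a single-letter
  strategy gives rate at most that of the code, because the letters are independent. Superadditivity
  is thus just the chain rule. The excess \<open>\<delta>\<close> in the classical rate is removed by time sharing.

  Monotonicity of relative entropy under channels rests on
  \<open>a ln (a / b) - a + b = \<integral> (1 - s) (a - b)\<^sup>2 / ((1 - s) b + s a) ds\<close>, the integral being over
  \<open>0 \<le> s \<le> 1\<close>: for matrices the integrand is a supremum of expressions linear in the two states, and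
  each of these is controlled by the Schwarz inequality for the adjoint of the channel.

  All distributions and states are kept unnormalized, so that no conditional probabilities occur.
\<close>

section \<open>Spectral decomposition and the entropy\<close>

text \<open>The continuity error is summed over exponentially many pairs of message and prefix, with
  arbitrary weights. A Fannes-type modulus would call for a concavity argument there; the bound used
  is linear instead, \<open>\<delta>\<close> times the weight plus \<open>K\<close> times the
  weighted loss of fidelity. Such errors simply add up, at every position, to
  \<open>\<delta>\<close> plus \<open>K\<close> times the infidelity of the whole code. The slope
  \<open>K\<close> depends on \<open>d\<close> and \<open>\<delta>\<close> alone, so the fidelity
  can be chosen after it. Without normalization an entropy contains an extra \<open>eta\<close> of
  the weight. These terms form a second telescoping sum, of classical entropies, and the same sum
  yields the classical rate. Time sharing costs at most \<open>\<delta>\<close> because S(A:B|C) +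
  S(A:C) is at least the entropy of the average state, which is data processing for the map from
  letters to their pure states.\<close>

type_synonym cvec = "nat \<Rightarrow> complex"
type_synonym cker = "nat \<Rightarrow> nat \<Rightarrow> complex"

abbreviation ent :: "complex mat \<Rightarrow> cker" where
  "ent A \<equiv> \<lambda>r s. A $$ (r, s)"

abbreviation nsq :: "complex \<Rightarrow> real" where
  "nsq z \<equiv> (cmod z)\<^sup>2"

definition ip :: "nat \<Rightarrow> cvec \<Rightarrow> cvec \<Rightarrow> complex" where
  "ip n u v = (\<Sum>r<n. cnj (u r) * v r)"

definition bil :: "nat \<Rightarrow> cker \<Rightarrow> cvec \<Rightarrow> cvec \<Rightarrow> complex" where
  "bil n A u v = (\<Sum>r<n. \<Sum>s<n. cnj (u r) * A r s * v s)"

abbreviation qf :: "nat \<Rightarrow> complex mat \<Rightarrow> cvec \<Rightarrow> complex" where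
  "qf n A v \<equiv> bil n (ent A) v v"

text \<open>The index set \<open>T\<close> is arbitrary, so that eigenvectors of block matrices can
  be indexed by pairs. Vectors are functions on all naturals, of which only the values below
  \<open>n\<close> matter.\<close>

definition onb :: "nat \<Rightarrow> 'i set \<Rightarrow> ('i \<Rightarrow> cvec) \<Rightarrow> bool" where
  "onb n T U \<longleftrightarrow> finite T \<and> card T = n \<and>
     (\<forall>i\<in>T. \<forall>j\<in>T. ip n (U i) (U j) = (if i = j then 1 else 0))"

definition spec :: "nat \<Rightarrow> complex mat \<Rightarrow> 'i set \<Rightarrow> ('i \<Rightarrow> cvec) \<Rightarrow> ('i \<Rightarrow> real) \<Rightarrow> bool" where
  "spec n A T U l \<longleftrightarrow> A \<in> carrier_mat n n \<and> onb n T U \<and>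
     (\<forall>r<n. \<forall>s<n. A $$ (r, s) = (\<Sum>i\<in>T. of_real (l i) * U i r * cnj (U i s)))"

lemma qform_eq_qf: "v \<in> carrier_vec n \<Longrightarrow> qform A v = qf n A (\<lambda>r. v $ r)"
  by (auto simp: qform_def bil_def)

lemma psd_iff_qf:
  "psd n A \<longleftrightarrow> A \<in> carrier_mat n n \<and> (\<forall>v. qf n A v \<in> \<real> \<and> Re (qf n A v) \<ge> 0)"
proof -
  have "qf n A v = qform A (vec n v)" for v
    by (auto simp: qform_def bil_def)
  then show ?thesis
    unfolding psd_def by (metis qform_eq_qf vec_carrier)
qed

lemma ip_cnj: "cnj (ip n u v) = ip n v u"
  by (simp add: ip_def mult.commute)

lemma ip_self: "ip n u u = of_real (\<Sum>r<n. nsq (u r))"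
  unfolding ip_def of_real_sum complex_norm_square by (simp add: mult.commute)

lemma sum_rotate: "(\<Sum>r\<in>A. \<Sum>s\<in>B. \<Sum>i\<in>C. f r s i) = (\<Sum>i\<in>C. \<Sum>r\<in>A. \<Sum>s\<in>B. f r s i)"
proof -
  have "(\<Sum>r\<in>A. \<Sum>s\<in>B. \<Sum>i\<in>C. f r s i) = (\<Sum>r\<in>A. \<Sum>i\<in>C. \<Sum>s\<in>B. f r s i)"
    by (rule sum.cong[OF refl], rule sum.swap)
  also have "\<dots> = (\<Sum>i\<in>C. \<Sum>r\<in>A. \<Sum>s\<in>B. f r s i)" by (rule sum.swap)
  finally show ?thesis .
qed

lemma ip_sum_right: "ip n u (\<lambda>r. \<Sum>i\<in>I. c i * w i r) = (\<Sum>i\<in>I. c i * ip n u (w i))"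
  unfolding ip_def sum_distrib_left
  by (subst sum.swap) (simp add: mult_ac)

lemma ip_sum_left: "ip n (\<lambda>r. \<Sum>i\<in>I. c i * w i r) v = (\<Sum>i\<in>I. cnj (c i) * ip n (w i) v)"
  unfolding ip_def sum_distrib_left sum_distrib_right cnj_sum
  by (subst sum.swap) (simp add: mult_ac)

lemma ip_cong: "(\<And>r. r < n \<Longrightarrow> u r = u' r) \<Longrightarrow> (\<And>r. r < n \<Longrightarrow> v r = v' r) \<Longrightarrow> ip n u v = ip n u' v'"
  unfolding ip_def by (intro sum.cong) auto

lemma onbD:
  assumes "onb n T U"
  shows "finite T" "card T = n" "\<And>i j. i \<in> T \<Longrightarrow> j \<in> T \<Longrightarrow> ip n (U i) (U j) = (if i = j then 1 else 0)"
  using assms by (auto simp: onb_def)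

text \<open>For square matrices a left inverse is also a right inverse; this turns \<open>n\<close>
  orthonormal vectors in dimension \<open>n\<close> into a complete system.\<close>

lemma onb_matrices:
  assumes "onb n T U"
  obtains e P Q where "bij_betw e {..<n} T" "P = mat n n (\<lambda>(r, i). U (e i) r)"
    "Q = mat n n (\<lambda>(i, r). cnj (U (e i) r))" "P * Q = 1\<^sub>m n" "Q * P = 1\<^sub>m n"
proof -
  note T = onbD[OF assms]
  obtain e where e: "bij_betw e {..<n} T"
    using T ex_bij_betw_nat_finite[of T] by (auto simp: atLeast0LessThan)
  define P where "P = mat n n (\<lambda>(r, i). U (e i) r)"
  define Q where "Q = mat n n (\<lambda>(i, r). cnj (U (e i) r))"
  have PQ: "P \<in> carrier_mat n n" "Q \<in> carrier_mat n n" by (auto simp: P_def Q_def)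
  have QP: "Q * P = 1\<^sub>m n"
  proof (rule eq_matI)
    fix i j assume ij: "i < dim_row (1\<^sub>m n)" "j < dim_col (1\<^sub>m n)"
    then have "e i \<in> T" "e j \<in> T" "(e i = e j) = (i = j)"
      using e by (auto simp: bij_betw_def inj_on_def)
    then have "ip n (U (e i)) (U (e j)) = (if i = j then 1 else 0)"
      using T by auto
    then show "(Q * P) $$ (i, j) = 1\<^sub>m n $$ (i, j)"
      using ij by (simp add: P_def Q_def scalar_prod_def ip_def atLeast0LessThan)
  qed (use PQ in auto)
  then have "P * Q = 1\<^sub>m n"
    using mat_mult_left_right_inverse PQ by blast
  then show ?thesis using that[OF e P_def Q_def _ QP] by blast
qed

lemma onb_complete:
  assumes "onb n T U" "r < n" "s < n"
  shows "(\<Sum>i\<in>T. U i r * cnj (U i s)) = (if r = s then 1 else 0)"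
proof -
  obtain e P Q where e: "bij_betw e {..<n} T" and P: "P = mat n n (\<lambda>(r, i). U (e i) r)"
    and Q: "Q = mat n n (\<lambda>(i, r). cnj (U (e i) r))" and "P * Q = 1\<^sub>m n"
    by (rule onb_matrices[OF assms(1)])
  then have "(P * Q) $$ (r, s) = (if r = s then 1 else 0)"
    using assms by simp
  moreover have "(P * Q) $$ (r, s) = (\<Sum>i<n. U (e i) r * cnj (U (e i) s))"
    using assms by (simp add: P Q scalar_prod_def atLeast0LessThan)
  moreover have "\<dots> = (\<Sum>i\<in>T. U i r * cnj (U i s))"
    by (rule sum.reindex_bij_betw[OF e])
  ultimately show ?thesis by simp
qed

lemma sum_delta_lessThan: "r < n \<Longrightarrow> (\<Sum>s<n. (if r = s then 1 else 0) * f s) = (f r :: complex)" for r n :: nat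
  using sum.delta'[of "{..<n}" r f] by (simp add: if_distrib[of "\<lambda>x. x * _"] cong: if_cong)

lemma onb_expand:
  assumes "onb n T U" "r < n"
  shows "v r = (\<Sum>i\<in>T. ip n (U i) v * U i r)"
proof -
  have "(\<Sum>i\<in>T. ip n (U i) v * U i r) = (\<Sum>s<n. (\<Sum>i\<in>T. U i r * cnj (U i s)) * v s)"
    unfolding ip_def sum_distrib_right by (subst sum.swap) (simp add: mult_ac)
  also have "\<dots> = (\<Sum>s<n. (if r = s then 1 else 0) * v s)"
    using onb_complete[OF assms] by (intro sum.cong) auto
  finally show ?thesis using assms by (simp add: sum_delta_lessThan)
qed

lemma parseval:
  assumes "onb n T U"
  shows "(\<Sum>i\<in>T. cnj (ip n (U i) u) * ip n (U i) v) = ip n u v"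
proof -
  have "ip n u v = ip n u (\<lambda>r. \<Sum>i\<in>T. ip n (U i) v * U i r)"
    using onb_expand[OF assms] by (intro ip_cong) auto
  also have "\<dots> = (\<Sum>i\<in>T. ip n (U i) v * ip n u (U i))"
    by (rule ip_sum_right)
  finally show ?thesis by (simp add: ip_cnj mult.commute)
qed

lemma parseval_norm:
  assumes "onb n T U"
  shows "(\<Sum>i\<in>T. nsq (ip n (U i) v)) = (\<Sum>r<n. nsq (v r))"
proof -
  have "of_real (\<Sum>i\<in>T. nsq (ip n (U i) v)) = (\<Sum>i\<in>T. cnj (ip n (U i) v) * ip n (U i) v)"
    by (simp only: of_real_sum complex_norm_square) (simp add: mult.commute)
  also have "\<dots> = of_real (\<Sum>r<n. nsq (v r))"
    by (simp only: parseval[OF assms] ip_self)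
  finally have "complex_of_real (\<Sum>i\<in>T. nsq (ip n (U i) v)) = of_real (\<Sum>r<n. nsq (v r))" .
  then show ?thesis by (simp only: of_real_eq_iff)
qed

lemma onb_unit:
  assumes "onb n T U" "i \<in> T"
  shows "(\<Sum>r<n. nsq (U i r)) = 1"
proof -
  have "complex_of_real (\<Sum>r<n. nsq (U i r)) = of_real 1"
    using onbD(3)[OF assms(1), of i i] assms(2) unfolding ip_self[symmetric] by simp
  then show ?thesis by (simp only: of_real_eq_iff)
qed

text \<open>Parseval in either basis. The squared overlaps of two orthonormal bases are thus doubly
  stochastic, which collapses double sums over two eigenbases to traces and entropies.\<close>

lemma onb_overlap:
  assumes "onb n T U" "onb n S V"
  shows "j \<in> S \<Longrightarrow> (\<Sum>i\<in>T. nsq (ip n (U i) (V j))) = 1"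
    and "i \<in> T \<Longrightarrow> (\<Sum>j\<in>S. nsq (ip n (U i) (V j))) = 1"
proof -
  show "j \<in> S \<Longrightarrow> (\<Sum>i\<in>T. nsq (ip n (U i) (V j))) = 1"
    using parseval_norm[OF assms(1)] onb_unit[OF assms(2)] by simp
  have "cmod (ip n (U i) (V j)) = cmod (ip n (V j) (U i))" for j by (metis complex_mod_cnj ip_cnj)
  then show "i \<in> T \<Longrightarrow> (\<Sum>j\<in>S. nsq (ip n (U i) (V j))) = 1"
    using parseval_norm[OF assms(2)] onb_unit[OF assms(1)] by simp
qed

section \<open>Diagonalization of Hermitian matrices\<close>

lemma unit_eigenbasis_start:
  fixes A :: "complex mat"
  assumes A: "A \<in> carrier_mat n n" and n: "n > 0"
  shows "\<exists>e w. onb n {..<n} w \<and> (\<forall>r<n. (\<Sum>s<n. A $$ (r,s) * w 0 s) = e * w 0 r)"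
proof -
  obtain as where as: "char_poly A = (\<Prod>a\<leftarrow>as. [:- a, 1:])" "length as = n"
    using char_poly_factorized[OF A] by blast
  then obtain e es where "as = e # es"
    using n by (cases as) simp_all
  then have "poly (char_poly A) e = 0"
    by (simp add: as(1))
  then have "eigenvalue A e" using eigenvalue_root_char_poly[OF A] by simp
  then obtain v where v: "v \<in> carrier_vec n" "v \<noteq> 0\<^sub>v n" "A *\<^sub>v v = e \<cdot>\<^sub>v v"
    using A unfolding eigenvalue_def eigenvector_def by auto
  interpret cof_vec_space n "TYPE(complex)" .
  define b where "b = basis_completion v"
  \<comment> \<open>Gram-Schmidt keeps the first vector, so the eigenvector survives at index 0;
    dividing by the norms below does not affect its eigenequation.\<close>
  define ws where "ws = gram_schmidt n b"
  from basis_completion[OF v(1,2), folded b_def]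
  have b: "distinct b" "\<not> lin_dep (set b)" "set b \<subseteq> carrier_vec n" "hd b = v" "length b = n"
    by auto
  obtain vs where bv: "b = v # vs" using b n by (cases b) auto
  from gram_schmidt_result[OF b(3,1,2) refl, folded ws_def]
  have ws: "set ws \<subseteq> carrier_vec n" "corthogonal ws" "length ws = n"
    using b by auto
  have hdws: "hd ws = v" using gram_schmidt_hd[OF v(1), of vs, folded bv] unfolding ws_def .
  have ws0: "ws ! 0 = v" using hdws ws n by (metis hd_conv_nth list.size(3) not_less0)
  define f where "f i r = ws ! i $ r" for i r
  have car: "ws ! i \<in> carrier_vec n" if "i < n" for i using ws that by auto
  have ipf: "ip n (f i) (f j) = ws ! j \<bullet>c ws ! i" if "i < n" "j < n" for i j
    using car[OF that(1)] car[OF that(2)]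
    by (auto simp: ip_def f_def scalar_prod_def atLeast0LessThan mult.commute intro!: sum.cong)
  define N where "N i = (\<Sum>r<n. nsq (f i r))" for i
  have ipN: "ip n (f i) (f i) = of_real (N i)" for i unfolding N_def by (rule ip_self)
  have Npos: "N i > 0" if "i < n" for i
  proof -
    have "ip n (f i) (f i) \<noteq> 0" using ipf[OF that that] corthogonalD[OF ws(2), of i i] that ws by auto
    then have "N i \<noteq> 0" using ipN[of i] by auto
    moreover have "N i \<ge> 0" by (auto simp: N_def intro: sum_nonneg)
    ultimately show ?thesis by simp
  qed
  define w where "w i r = f i r / of_real (sqrt (N i))" for i r
  have ipw: "ip n (w i) (w j) = ip n (f i) (f j) / (of_real (sqrt (N i)) * of_real (sqrt (N j)))" for i j
    by (simp add: ip_def w_def sum_divide_distrib)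
  have "onb n {..<n} w"
    unfolding onb_def
  proof (intro conjI ballI)
    fix i j assume ij: "i \<in> {..<n}" "j \<in> {..<n}"
    show "ip n (w i) (w j) = (if i = j then 1 else 0)"
    proof (cases "i = j")
      case True
      then show ?thesis using Npos[of i] ij
        by (simp add: ipw ipN flip: of_real_mult)
    next
      case False
      then show ?thesis using ij corthogonalD[OF ws(2), of j i] ws by (simp add: ipw ipf)
    qed
  qed auto
  moreover have "(\<Sum>s<n. A $$ (r,s) * w 0 s) = e * w 0 r" if r: "r < n" for r
  proof -
    have "(A *\<^sub>v v) $ r = (\<Sum>s<n. A $$ (r,s) * v $ s)"
      using r A v(1) by (simp add: scalar_prod_def atLeast0LessThan )
    then have "(\<Sum>s<n. A $$ (r,s) * f 0 s) = e * f 0 r"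
      using v r by (simp add: f_def ws0)
    then show ?thesis
      by (simp add: w_def flip: sum_divide_distrib)
  qed
  ultimately show ?thesis by blast
qed

lemma bil_ip_right: "bil n A u v = ip n u (\<lambda>r. \<Sum>s<n. A r s * v s)"
  by (simp add: bil_def ip_def sum_distrib_left mult.assoc)

lemma bil_hermitian:
  assumes "\<And>r s. r < n \<Longrightarrow> s < n \<Longrightarrow> A s r = cnj (A r s)"
  shows "bil n A v u = cnj (bil n A u v)"
proof -
  have "cnj (bil n A u v) = (\<Sum>s<n. \<Sum>r<n. u r * cnj (A r s) * cnj (v s))"
    unfolding bil_def by (subst sum.swap) simp
  also have "\<dots> = bil n A v u"
    unfolding bil_def by (simp add: assms[symmetric] mult_ac)
  finally show ?thesis by simp
qed

lemma bil_expand: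
  assumes w: "onb n T w" and rs: "r < n" "s < n"
  shows "A r s = (\<Sum>i\<in>T. \<Sum>j\<in>T. w i r * bil n A (w i) (w j) * cnj (w j s))"
proof -
  have "A r s = (\<Sum>i\<in>T. ip n (w i) (\<lambda>r. A r s) * w i r)"
    by (rule onb_expand[OF w rs(1), of "\<lambda>r. A r s"])
  also have "\<dots> = (\<Sum>i\<in>T. (\<Sum>j\<in>T. bil n A (w i) (w j) * cnj (w j s)) * w i r)"
  proof (intro sum.cong refl arg_cong2[where f="(*)"])
    fix i assume "i \<in> T"
    define g where "g s = cnj (ip n (w i) (\<lambda>r. A r s))" for s
    have "g s = (\<Sum>j\<in>T. ip n (w j) g * w j s)"
      by (rule onb_expand[OF w rs(2)])
    then have "cnj (g s) = (\<Sum>j\<in>T. ip n g (w j) * cnj (w j s))"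
      by (simp add: ip_cnj)
    moreover have "ip n g (w j) = bil n A (w i) (w j)" for j
      unfolding bil_def ip_def g_def
      by (simp add: sum_distrib_right) (rule sum.swap)
    ultimately show "ip n (w i) (\<lambda>r. A r s) = (\<Sum>j\<in>T. bil n A (w i) (w j) * cnj (w j s))"
      by (simp add: g_def)
  qed
  finally show ?thesis
    by (simp add: sum_distrib_left sum_distrib_right mult_ac)
qed

text \<open>Deflation. In an orthonormal basis that starts with an eigenvector, the first column of
  the matrix vanishes off the diagonal, by hermiticity so does the first row, and the remaining
  block of size \<open>m\<close> is again Hermitian. Kernels instead of matrices let the induction
  pass to the block by shifting indices.\<close>

lemma hermitian_diagonalizable:
  fixes A :: cker
  assumes "\<And>r s. r < n \<Longrightarrow> s < n \<Longrightarrow> A s r = cnj (A r s)"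
  shows "\<exists>U l. onb n {..<n} U \<and> (\<forall>r<n. \<forall>s<n. A r s = (\<Sum>i<n. of_real (l i) * U i r * cnj (U i s)))"
  using assms
proof (induction n arbitrary: A)
  case 0
  then show ?case by (auto simp: onb_def)
next
  case (Suc m)
  define n where "n = Suc m"
  have herm: "A s r = cnj (A r s)" if "r < n" "s < n" for r s using Suc.prems[folded n_def] that by blast
  obtain e w where w: "onb n {..<n} w"
    and ev: "\<And>r. r < n \<Longrightarrow> (\<Sum>s<n. mat n n (\<lambda>(r,s). A r s) $$ (r,s) * w 0 s) = e * w 0 r"
    using unit_eigenbasis_start[of "mat n n (\<lambda>(r,s). A r s)" n] n_def by auto
  note wD = onbD(3)[OF w]
  define B where "B i j = bil n A (w i) (w j)" for i j
  have B0: "B i 0 = (if i = 0 then e else 0)" if "i < n" for i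
  proof -
    have "B i 0 = ip n (w i) (\<lambda>r. e * w 0 r)"
      unfolding B_def bil_ip_right using ev by (intro ip_cong) auto
    also have "\<dots> = e * ip n (w i) (w 0)"
      by (simp add: ip_def sum_distrib_left mult_ac)
    finally show ?thesis using wD[of i 0] that n_def by auto
  qed
  have Bh: "B j i = cnj (B i j)" for i j
    unfolding B_def using herm by (rule bil_hermitian)
  have e: "e = of_real (Re e)"
  proof -
    have "e = cnj e" using Bh[of 0 0] B0[of 0] n_def by (metis zero_less_Suc)
    then show ?thesis by (metis Reals_cnj_iff of_real_Re)
  qed
  have B0': "B 0 (Suc j) = 0" if "j < m" for j
    using Bh[of "Suc j" 0] B0[of "Suc j"] that n_def by simp
  obtain V l where V: "onb m {..<m} V"
    and Vl: "\<And>i j. i < m \<Longrightarrow> j < m \<Longrightarrow> B (Suc i) (Suc j) = (\<Sum>x<m. of_real (l x) * V x i * cnj (V x j))"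
    using Suc.IH[of "\<lambda>i j. B (Suc i) (Suc j)"] Bh by blast
  \<comment> \<open>The eigenvectors of the block are coordinate vectors with respect to
    \<open>w 1\<close>, ..., \<open>w m\<close>; this translates them back.\<close>
  define U where "U = case_nat (w 0) (\<lambda>x r. \<Sum>i<m. V x i * w (Suc i) r)"
  define l' where "l' = case_nat (Re e) l"
  have n0: "0 < n" and nS: "\<And>x. Suc x < n \<longleftrightarrow> x < m" by (auto simp: n_def)
  have ip00: "ip n (w 0) (w 0) = 1" using wD n0 by auto
  have ip0S: "ip n (w 0) (U (Suc x)) = 0" for x
    unfolding U_def by (simp add: ip_sum_right wD n0 nS)
  have ipSS: "ip n (U (Suc x)) (U (Suc y)) = (if x = y then 1 else 0)" if "x < m" "y < m" for x y
  proof -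
    have inner: "(\<Sum>j<m. V y j * ip n (w (Suc i)) (w (Suc j))) = V y i" if "i < m" for i
    proof -
      have "(\<Sum>j<m. V y j * ip n (w (Suc i)) (w (Suc j))) = (\<Sum>j<m. if i = j then V y j else 0)"
        using that by (intro sum.cong) (auto simp: wD nS)
      then show ?thesis using that by simp
    qed
    have "ip n (U (Suc x)) (U (Suc y)) = (\<Sum>i<m. cnj (V x i) * (\<Sum>j<m. V y j * ip n (w (Suc i)) (w (Suc j))))"
      unfolding U_def nat.case by (simp only: ip_sum_left) (simp only: ip_sum_right)
    also have "\<dots> = ip m (V x) (V y)"
      unfolding ip_def[of m] by (simp add: inner)
    finally show ?thesis using onbD(3)[OF V] that by auto
  qed
  have U: "onb n {..<n} U"
    unfolding onb_def
  proof (intro conjI ballI)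
    fix i j assume ij: "i \<in> {..<n}" "j \<in> {..<n}"
    show "ip n (U i) (U j) = (if i = j then 1 else 0)"
    proof (cases i; cases j)
      fix x assume "i = Suc x" "j = 0"
      then show ?thesis using ip0S[of x] ip_cnj[of n "w 0" "U (Suc x)"] by (simp add: U_def)
    next
      fix x assume "i = 0" "j = Suc x"
      then show ?thesis using ip0S[of x] by (simp add: U_def)
    next
      fix x y assume "i = Suc x" "j = Suc y"
      then show ?thesis using ipSS[of x y] ij by (simp add: nS)
    next
      assume "i = 0" "j = 0"
      then show ?thesis using ip00 by (simp add: U_def)
    qed
  qed auto
  have "A r s = (\<Sum>i<n. of_real (l' i) * U i r * cnj (U i s))" if rs: "r < n" "s < n" for r s
  proof -
    have "A r s = (\<Sum>i<n. \<Sum>j<n. w i r * B i j * cnj (w j s))"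
      unfolding B_def by (rule bil_expand[OF w rs])
    also have "\<dots> = w 0 r * e * cnj (w 0 s) + (\<Sum>i<m. \<Sum>j<m. w (Suc i) r * B (Suc i) (Suc j) * cnj (w (Suc j) s))"
      unfolding n_def sum.lessThan_Suc_shift using B0[unfolded n_def] B0' by simp
    also have "(\<Sum>i<m. \<Sum>j<m. w (Suc i) r * B (Suc i) (Suc j) * cnj (w (Suc j) s))
      = (\<Sum>i<m. \<Sum>j<m. \<Sum>x<m. w (Suc i) r * (of_real (l x) * V x i * cnj (V x j)) * cnj (w (Suc j) s))"
      by (intro sum.cong refl) (simp add: Vl sum_distrib_left sum_distrib_right)
    also have "\<dots> = (\<Sum>x<m. \<Sum>i<m. \<Sum>j<m. w (Suc i) r * (of_real (l x) * V x i * cnj (V x j)) * cnj (w (Suc j) s))"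
      by (rule sum_rotate)
    also have "\<dots> = (\<Sum>x<m. of_real (l x) * U (Suc x) r * cnj (U (Suc x) s))"
      unfolding U_def by (simp add: sum_distrib_left sum_distrib_right mult_ac)
    finally show ?thesis
      unfolding n_def sum.lessThan_Suc_shift by (simp add: l'_def U_def mult_ac e[symmetric])
  qed
  then show ?case using U n_def by blast
qed

section \<open>Positive semidefinite matrices and their eigenvalues\<close>

lemma psd_carrier: "psd n A \<Longrightarrow> A \<in> carrier_mat n n"
  by (simp add: psd_def)

lemma bil_two_points:
  assumes "r < n" "s < n" "r \<noteq> s"
  shows "bil n A (\<lambda>x. if x = r then a else if x = s then b else 0) (\<lambda>x. if x = r then a else if x = s then b else 0)
    = cnj a * A r r * a + cnj a * A r s * b + cnj b * A s r * a + cnj b * A s s * b"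
proof -
  have two: "(\<Sum>x<n. if x = r then f x else if x = s then g x else 0) = f r + (g s :: complex)" for f g
  proof -
    have "(\<Sum>x<n. if x = r then f x else if x = s then g x else 0)
        = (\<Sum>x<n. (if x = r then f x else 0) + (if x = s then g x else 0))"
      using assms by (intro sum.cong) auto
    then show ?thesis using assms by (simp add: sum.distrib)
  qed
  have *: "cnj (if x = r then a else if x = s then b else 0) * A x y * (if y = r then a else if y = s then b else 0)
     = (if y = r then (cnj (if x = r then a else if x = s then b else 0)) * A x r * a else
        if y = s then (cnj (if x = r then a else if x = s then b else 0)) * A x s * b else 0)" for x y
    by auto
  have **: "cnj (if x = r then a else if x = s then b else 0) * A x r * a + cnj (if x = r then a else if x = s then b else 0) * A x s * b
     = (if x = r then cnj a * A r r * a + cnj a * A r s * b else if x = s then cnj b * A s r * a + cnj b * A s s * b else 0)" for x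
    by auto
  show ?thesis
    unfolding bil_def * two ** by (simp add: algebra_simps)
qed

text \<open>Polarization. A real form at unit vectors makes the diagonal real; at the sum of unit
  vectors \<open>r\<close> and \<open>s\<close> it makes the imaginary parts of the two entries
  opposite; with the factor \<open>\<i>\<close> on the second vector it makes their real parts
  equal.\<close>

lemma psd_hermitian:
  assumes "psd n A" "r < n" "s < n"
  shows "A $$ (s, r) = cnj (A $$ (r, s))"
proof -
  have real: "qf n A v \<in> \<real>" for v using assms(1) by (simp add: psd_iff_qf)
  have diag: "Im (A $$ (x, x)) = 0" if "x < n" for x
  proof -
    have "qf n A (\<lambda>y. if y = x then 1 else 0) = A $$ (x,x)"
      using that by (simp add: bil_def if_distrib[of cnj] if_distrib[of "\<lambda>z. z * _"] if_distrib[of "\<lambda>z. _ * z"] cong: if_cong)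
    then show ?thesis using real[of "\<lambda>y. if y = x then 1 else 0"] complex_is_Real_iff by metis
  qed
  show ?thesis
  proof (cases "r = s")
    case True
    then show ?thesis using diag[OF assms(2)] by (simp add: complex_eq_iff)
  next
    case False
    note two = bil_two_points[OF assms(2,3) False, of "\<lambda>r s. A $$ (r,s)"]
    have "Im (A $$ (r,s)) + Im (A $$ (s,r)) = 0"
      using real[of "\<lambda>x. if x = r then 1 else if x = s then 1 else 0"] diag assms
      unfolding two complex_is_Real_iff by simp
    moreover have "Re (A $$ (r,s)) - Re (A $$ (s,r)) = 0"
      using real[of "\<lambda>x. if x = r then 1 else if x = s then \<i> else 0"] diag assms
      unfolding two complex_is_Real_iff by simp
    ultimately show ?thesis by (simp add: complex_eq_iff)
  qed
qed

lemma specD: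
  assumes "spec n A T U l"
  shows "A \<in> carrier_mat n n" "onb n T U"
    "\<And>r s. r < n \<Longrightarrow> s < n \<Longrightarrow> A $$ (r, s) = (\<Sum>i\<in>T. of_real (l i) * U i r * cnj (U i s))"
  using assms by (auto simp: spec_def)

lemma spec_bil:
  assumes "spec n A T U l"
  shows "bil n (ent A) u v = (\<Sum>i\<in>T. of_real (l i) * (ip n u (U i) * ip n (U i) v))"
proof -
  have "bil n (ent A) u v = (\<Sum>r<n. \<Sum>s<n. \<Sum>i\<in>T. cnj (u r) * (of_real (l i) * U i r * cnj (U i s)) * v s)"
    unfolding bil_def using specD[OF assms]
    by (intro sum.cong refl) (simp add: sum_distrib_left sum_distrib_right)
  also have "\<dots> = (\<Sum>i\<in>T. \<Sum>r<n. \<Sum>s<n. cnj (u r) * (of_real (l i) * U i r * cnj (U i s)) * v s)"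
    by (rule sum_rotate)
  also have "\<dots> = (\<Sum>i\<in>T. of_real (l i) * (ip n u (U i) * ip n (U i) v))"
    by (intro sum.cong refl) (simp add: ip_def sum_product sum_distrib_left mult_ac)
  finally show ?thesis .
qed

lemma spec_qf_complex:
  assumes "spec n A T U l"
  shows "qf n A v = (\<Sum>i\<in>T. of_real (l i) * (cnj (ip n (U i) v) * ip n (U i) v))"
  unfolding spec_bil[OF assms] by (simp add: ip_cnj)

lemma spec_qf:
  assumes "spec n A T U l"
  shows "qf n A v = of_real (\<Sum>i\<in>T. l i * nsq (ip n (U i) v))"
  unfolding spec_qf_complex[OF assms] of_real_sum of_real_mult complex_norm_square
  by (simp add: mult_ac)

lemma spec_imp_psd:
  assumes "spec n A T U l" "\<And>i. i \<in> T \<Longrightarrow> l i \<ge> 0"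
  shows "psd n A"
  unfolding psd_iff_qf spec_qf[OF assms(1)] using specD(1)[OF assms(1)] assms(2)
  by (auto intro!: sum_nonneg)

lemma spec_qf_self:
  assumes "spec n A T U l" "i \<in> T"
  shows "qf n A (U i) = of_real (l i)"
proof -
  note o = onbD[OF specD(2)[OF assms(1)]]
  have "qf n A (U i) = (\<Sum>j\<in>T. if j = i then of_real (l i) else 0)"
    unfolding spec_qf_complex[OF assms(1)] using o(3) assms(2) by (intro sum.cong) auto
  then show ?thesis using o assms by simp
qed

lemma psd_spec:
  assumes "psd n A"
  obtains U l where "spec n A {..<n} U l" "\<And>i. i < n \<Longrightarrow> l i \<ge> 0"
proof -
  obtain U l where "onb n {..<n} U"
    "\<forall>r<n. \<forall>s<n. A $$ (r,s) = (\<Sum>i<n. of_real (l i) * U i r * cnj (U i s))"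
    using hermitian_diagonalizable[of n "\<lambda>r s. A $$ (r,s)"] psd_hermitian[OF assms] by blast
  then have s: "spec n A {..<n} U l" using assms by (simp add: spec_def psd_def)
  moreover have "l i \<ge> 0" if "i < n" for i
    using spec_qf_self[OF s, of i] that assms unfolding psd_iff_qf by (metis Re_complex_of_real lessThan_iff)
  ultimately show ?thesis using that by blast
qed

lemma spec_trace:
  assumes "spec n A T U l"
  shows "mtrace A = of_real (\<Sum>i\<in>T. l i)"
proof -
  note o = onbD[OF specD(2)[OF assms]]
  have "mtrace A = (\<Sum>r<n. \<Sum>i\<in>T. of_real (l i) * U i r * cnj (U i r))"
    unfolding mtrace_def using specD[OF assms] by auto
  also have "\<dots> = (\<Sum>i\<in>T. of_real (l i) * ip n (U i) (U i))"
    by (subst sum.swap) (simp add: ip_def sum_distrib_left mult_ac)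
  finally show ?thesis using o(3) by simp
qed

lemma order_linear_factor: "Polynomial.order x [:- c, 1:] = (if c = x then 1 else 0)" for x c :: complex
  using order_power_n_n[of c 1] by (auto intro: order_0I)

lemma order_prod_linear:
  fixes x :: complex
  assumes "finite T"
  shows "Polynomial.order x (\<Prod>i\<in>T. [:- c i, 1:]) = card {i\<in>T. c i = x}"
  using assms
proof (induction T)
  case (insert a T)
  have "(\<Prod>i\<in>T. [:- c i, 1:]) \<noteq> 0" using insert by auto
  then have "Polynomial.order x ([:- c a, 1:] * (\<Prod>i\<in>T. [:- c i, 1:])) = Polynomial.order x [:- c a, 1:] + card {i\<in>T. c i = x}"
    by (subst order_mult) (simp_all add: insert.IH del: mult_pCons_left mult_pCons_right)
  moreover have "{i \<in> insert a T. c i = x} = (if c a = x then insert a {i\<in>T. c i = x} else {i\<in>T. c i = x})"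
    by auto
  ultimately show ?case using insert by (simp add: order_linear_factor)
qed (auto intro: order_0I)

lemma mult_mat_entry:
  assumes "M \<in> carrier_mat n n" "N \<in> carrier_mat n n" "r < n" "s < n"
  shows "(M * N) $$ (r, s) = (\<Sum>i<n. M $$ (r, i) * N $$ (i, s))"
  using assms by (simp add: scalar_prod_def atLeast0LessThan)

lemma spec_char_poly:
  assumes "spec n A T U l"
  shows "char_poly A = (\<Prod>i\<in>T. [:- of_real (l i), 1:])"
proof -
  have A: "A \<in> carrier_mat n n" using specD[OF assms] by simp
  obtain e P Q where e: "bij_betw e {..<n} T" and P_def: "P = mat n n (\<lambda>(r, i). U (e i) r)"
    and Q_def: "Q = mat n n (\<lambda>(i, r). cnj (U (e i) r))" and PQ1: "P * Q = 1\<^sub>m n" and QP: "Q * P = 1\<^sub>m n"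
    by (rule onb_matrices[OF specD(2)[OF assms]])
  define D where "D = mat n n (\<lambda>(i,j). if i = j then complex_of_real (l (e i)) else 0)"
  have PQ: "P \<in> carrier_mat n n" "Q \<in> carrier_mat n n" "D \<in> carrier_mat n n" by (auto simp: P_def Q_def D_def)
  have PD: "(P * D) $$ (r,i) = U (e i) r * of_real (l (e i))" if "r < n" "i < n" for r i
    using that by (simp add: P_def D_def scalar_prod_def atLeast0LessThan if_distrib[of "\<lambda>z. _ * z"] cong: if_cong)
  have "A = P * D * Q"
  proof (rule eq_matI)
    fix r s assume rs: "r < dim_row (P * D * Q)" "s < dim_col (P * D * Q)"
    then have rs: "r < n" "s < n" using PQ by auto
    have "A $$ (r,s) = (\<Sum>i<n. of_real (l (e i)) * U (e i) r * cnj (U (e i) s))"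
      using specD(3)[OF assms] rs
        sum.reindex_bij_betw[OF e, of "\<lambda>i. of_real (l i) * U i r * cnj (U i s)"] by simp
    also have "\<dots> = (\<Sum>i<n. (P * D) $$ (r,i) * Q $$ (i,s))"
      using rs PD by (intro sum.cong) (auto simp: Q_def mult_ac)
    also have "\<dots> = (P * D * Q) $$ (r,s)"
      using rs PQ by (intro mult_mat_entry[symmetric]) auto
    finally show "A $$ (r,s) = (P * D * Q) $$ (r,s)" .
  qed (use PQ A in auto)
  then have "similar_mat_wit A D P Q"
    using PQ1 QP A PQ by (intro similar_mat_witI[of _ _ n]) auto
  then have "char_poly A = char_poly D"
    by (intro char_poly_similar) (auto simp: similar_mat_def)
  also have "\<dots> = (\<Prod>a\<leftarrow>diag_mat D. [:- a, 1:])"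
    by (rule char_poly_upper_triangular[OF PQ(3)]) (auto simp: upper_triangular_def D_def)
  also have "diag_mat D = map (\<lambda>i. complex_of_real (l (e i))) [0..<n]"
    by (auto simp: diag_mat_def D_def)
  also have "(\<Prod>a\<leftarrow>map (\<lambda>i. complex_of_real (l (e i))) [0..<n]. [:- a, 1:]) = (\<Prod>i<n. [:- of_real (l (e i)), 1:])"
    using prod.distinct_set_conv_list[of "[0..<n]" "\<lambda>i. [:- complex_of_real (l (e i)), 1:]"]
    by (simp add: atLeast0LessThan comp_def)
  also have "\<dots> = (\<Prod>i\<in>T. [:- of_real (l i), 1:])"
    by (rule prod.reindex_bij_betw[OF e])
  finally show ?thesis .
qed

text \<open>The order of a root of a product of linear factors counts the indices with that
  eigenvalue. This links the algebraic multiplicities in \<open>vn_entropy\<close> to an arbitrary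
  orthonormal eigensystem, so every later entropy can be computed from whichever eigensystem is
  convenient.\<close>

lemma spec_vn_entropy:
  assumes "spec n A T U l"
  shows "vn_entropy A = (\<Sum>i\<in>T. eta (l i))"
proof -
  have fin: "finite T" using onbD[OF specD(2)[OF assms]] by simp
  define c where "c i = complex_of_real (l i)" for i
  have cp: "char_poly A = (\<Prod>i\<in>T. [:- c i, 1:])" using spec_char_poly[OF assms] by (simp add: c_def)
  have roots: "{x. poly (char_poly A) x = 0} = c ` T"
    unfolding cp poly_prod using fin by auto
  have "vn_entropy A = (\<Sum>x\<in>c ` T. (\<Sum>i\<in>{i\<in>T. c i = x}. eta (l i)))"
    unfolding vn_entropy_def roots unfolding cp order_prod_linear[OF fin]
  proof (rule sum.cong[OF refl])
    fix x
    have "(\<Sum>i\<in>{i\<in>T. c i = x}. eta (l i)) = (\<Sum>i\<in>{i\<in>T. c i = x}. eta (Re x))"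
      by (intro sum.cong) (auto simp: c_def)
    then show "real (card {i \<in> T. c i = x}) * eta (Re x) = (\<Sum>i\<in>{i\<in>T. c i = x}. eta (l i))"
      by simp
  qed
  also have "\<dots> = (\<Sum>i\<in>T. eta (l i))"
    by (rule sum.image_gen[OF fin, symmetric])
  finally show ?thesis .
qed

section \<open>Gibbs and Klein inequalities, entropy bounds\<close>

lemma gibbs_term:
  assumes "a \<ge> 0" "t > 0"
  shows "eta a \<le> - a * log 2 t + (t - a) / ln 2"
proof (cases "a = 0")
  case False
  then have a: "a > 0" using assms by simp
  \<comment> \<open>The linear remainder \<open>(t - a) / ln 2\<close> produced by this tangent
    bound cancels on summation whenever the \<open>a\<close> and the \<open>t\<close> have the same
    total.\<close>
  have "ln (t / a) \<le> t / a - 1" using a assms by (intro ln_le_minus_one) auto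
  then have "a * ln (t / a) \<le> a * (t / a - 1)" using a by (intro mult_left_mono) auto
  then have "a * (ln t - ln a) \<le> a * (t / a - 1)" using a assms by (simp add: ln_div)
  also have "\<dots> = t - a" using a by (simp add: right_diff_distrib)
  finally have "a * (ln t - ln a) \<le> t - a" .
  then have "a * (ln t - ln a) / ln 2 \<le> (t - a) / ln 2" by (intro divide_right_mono) auto
  moreover have "a * (ln t - ln a) / ln 2 = a * log 2 t - a * log 2 a"
    by (simp add: log_def diff_divide_distrib right_diff_distrib)
  ultimately have "a * log 2 t - a * log 2 a \<le> (t - a) / ln 2" by simp
  then show ?thesis using a by (simp add: eta_def)
qed (use assms in \<open>simp add: eta_def\<close>)

lemma eta_mult:
  assumes "c \<ge> 0" "x \<ge> 0"
  shows "eta (c * x) = c * eta x + x * eta c"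
  using assms by (cases "c = 0"; cases "x = 0") (auto simp: eta_def log_mult algebra_simps mult_le_0_iff)

lemma eta_0 [simp]: "eta 0 = 0" and eta_1 [simp]: "eta 1 = 0"
  by (auto simp: eta_def)

lemma eta_subadd:
  assumes "x \<ge> 0" "y \<ge> 0"
  shows "eta (x + y) \<le> eta x + eta y"
proof (cases "x = 0 \<or> y = 0")
  case False
  then have xy: "x > 0" "y > 0" using assms by auto
  have *: "x * log 2 x \<le> x * log 2 (x + y)" "y * log 2 y \<le> y * log 2 (x + y)"
    using xy by (intro mult_left_mono; simp)+
  show ?thesis using xy add_mono[OF *] by (simp add: eta_def algebra_simps)
qed (auto simp: eta_def)

lemma eta_sum_le:
  assumes "finite I" "\<And>i. i \<in> I \<Longrightarrow> x i \<ge> 0"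
  shows "eta (\<Sum>i\<in>I. x i) \<le> (\<Sum>i\<in>I. eta (x i))"
  using assms
proof (induction I)
  case (insert a I)
  have "eta (x a + sum x I) \<le> eta (x a) + eta (sum x I)"
    using insert by (intro eta_subadd sum_nonneg) auto
  then show ?case using insert by force
qed simp

lemma psd_trace_onb:
  assumes "psd n A" "onb n T V"
  shows "(\<Sum>j\<in>T. Re (qf n A (V j))) = Re (mtrace A)"
proof -
  obtain U a where s: "spec n A {..<n} U a" using psd_spec[OF assms(1)] by blast
  have "(\<Sum>j\<in>T. Re (qf n A (V j))) = (\<Sum>i<n. a i * (\<Sum>j\<in>T. nsq (ip n (U i) (V j))))"
    by (simp add: spec_qf[OF s] sum_distrib_left) (rule sum.swap)
  then show ?thesis
    using onb_overlap(2)[OF specD(2)[OF s] assms(2)] by (simp add: spec_trace[OF s])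
qed

text \<open>\<open>gibbs_term\<close> averaged over the squared overlaps of the eigenbasis of
  \<open>A\<close> with \<open>V\<close>. The numbers \<open>t j\<close> act as eigenvalues of a
  comparison operator diagonal in \<open>V\<close>, and the bound is the corresponding cross
  entropy.\<close>

lemma klein_inequality:
  assumes "psd n A" "onb n T V" "\<And>j. j \<in> T \<Longrightarrow> t j > 0"
  shows "vn_entropy A \<le> (\<Sum>j\<in>T. - Re (qf n A (V j)) * log 2 (t j)) + ((\<Sum>j\<in>T. t j) - Re (mtrace A)) / ln 2"
proof -
  obtain U a where s: "spec n A {..<n} U a" and a: "\<And>i. i < n \<Longrightarrow> a i \<ge> 0" using psd_spec[OF assms(1)] by blast
  define c where "c i j = nsq (ip n (U i) (V j))" for i j
  have U: "onb n {..<n} U" using specD[OF s] by simp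
  have ci: "(\<Sum>j\<in>T. c i j) = 1" if "i < n" for i
    using onb_overlap(2)[OF U assms(2), of i] that by (simp add: c_def)
  have cj: "(\<Sum>i<n. c i j) = 1" if "j \<in> T" for j
    using onb_overlap(1)[OF U assms(2) that] by (simp add: c_def)
  have q: "Re (qf n A (V j)) = (\<Sum>i<n. a i * c i j)" for j
    by (simp add: spec_qf[OF s] c_def)
  have tr: "Re (mtrace A) = (\<Sum>i<n. a i)" by (simp add: spec_trace[OF s])
  have "vn_entropy A = (\<Sum>i<n. \<Sum>j\<in>T. c i j * eta (a i))"
    unfolding spec_vn_entropy[OF s] by (simp flip: sum_distrib_right add: ci)
  also have "\<dots> \<le> (\<Sum>i<n. \<Sum>j\<in>T. c i j * (- a i * log 2 (t j) + (t j - a i) / ln 2))"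
    using a assms(3) by (intro sum_mono mult_left_mono gibbs_term) (auto simp: c_def)
  also have "\<dots> = (\<Sum>i<n. \<Sum>j\<in>T. - (a i * c i j) * log 2 (t j)) + ((\<Sum>i<n. \<Sum>j\<in>T. c i j * t j) - (\<Sum>i<n. \<Sum>j\<in>T. c i j * a i)) / ln 2"
    by (simp add: sum.distrib[symmetric] sum_divide_distrib diff_divide_distrib sum_subtractf[symmetric] algebra_simps)
  also have "(\<Sum>i<n. \<Sum>j\<in>T. c i j * a i) = Re (mtrace A)"
    by (simp flip: sum_distrib_right add: ci tr)
  also have "(\<Sum>i<n. \<Sum>j\<in>T. c i j * t j) = (\<Sum>j\<in>T. t j)"
    by (subst sum.swap) (simp flip: sum_distrib_right add: cj)
  also have "(\<Sum>i<n. \<Sum>j\<in>T. - (a i * c i j) * log 2 (t j)) = (\<Sum>j\<in>T. - Re (qf n A (V j)) * log 2 (t j))"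
    by (subst sum.swap) (simp add: q sum_distrib_right sum_negf)
  finally show ?thesis .
qed

lemma psd_trace_ge_0: "psd n A \<Longrightarrow> Re (mtrace A) \<ge> 0" and psd_trace_real: "psd n A \<Longrightarrow> mtrace A = of_real (Re (mtrace A))"
proof -
  assume A: "psd n A"
  obtain U a where s: "spec n A {..<n} U a" and a: "\<And>i. i < n \<Longrightarrow> a i \<ge> 0" using psd_spec[OF A] by blast
  show "Re (mtrace A) \<ge> 0" "mtrace A = of_real (Re (mtrace A))"
    using a by (auto simp: spec_trace[OF s] intro: sum_nonneg)
qed

text \<open>Gibbs against uniform weights, the trace divided by \<open>n\<close>; the summand
  \<open>eta\<close> of the trace accounts for the missing normalization. Trace 0 is treated apart
  because the comparison weights must be positive.\<close>

lemma vn_entropy_upper: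
  assumes "psd n A" "n \<ge> 1"
  shows "vn_entropy A \<le> eta (Re (mtrace A)) + Re (mtrace A) * log 2 (real n)"
proof -
  obtain U a where s: "spec n A {..<n} U a" and a: "\<And>i. i < n \<Longrightarrow> a i \<ge> 0" using psd_spec[OF assms(1)] by blast
  define t where "t = Re (mtrace A)"
  have t: "t = (\<Sum>i<n. a i)" by (simp add: t_def spec_trace[OF s])
  have t0: "t \<ge> 0" using a by (auto simp: t intro: sum_nonneg)
  show ?thesis
  proof (cases "t = 0")
    case True
    then have "\<forall>i<n. a i = 0" using a sum_nonneg_eq_0_iff[of "{..<n}" a] by (auto simp: t)
    then show ?thesis using True by (simp add: spec_vn_entropy[OF s] t_def[symmetric])
  next
    case False
    then have tp: "t > 0" using t0 by simp
    have "vn_entropy A \<le> (\<Sum>i<n. - a i * log 2 (t / n) + (t / n - a i) / ln 2)"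
      unfolding spec_vn_entropy[OF s] using a tp assms by (intro sum_mono gibbs_term) auto
    also have "\<dots> = - t * log 2 (t / n) + (t - t) / ln 2"
      using assms by (simp add: sum.distrib sum_subtractf diff_divide_distrib t sum_negf
        flip: sum_distrib_right sum_divide_distrib)
    finally show ?thesis using tp assms by (simp add: eta_def t_def[symmetric] log_divide algebra_simps)
  qed
qed

lemma vn_entropy_lower:
  assumes "psd n A"
  shows "eta (Re (mtrace A)) \<le> vn_entropy A"
proof -
  obtain U a where s: "spec n A {..<n} U a" and a: "\<And>i. i < n \<Longrightarrow> a i \<ge> 0" using psd_spec[OF assms(1)] by blast
  show ?thesis using a eta_sum_le[of "{..<n}" a] by (simp add: spec_trace[OF s] spec_vn_entropy[OF s])
qed

text \<open>Eigenvectors of the blocks, extended by zero, form an eigensystem of the whole matrix.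
  The map \<open>f\<close> locates coordinate \<open>r\<close> of block \<open>c\<close>, so the
  blocks may be interleaved, as happens when a classical register is the last tensor factor.\<close>

lemma vn_entropy_block:
  assumes f: "bij_betw (\<lambda>(r, c). f r c) ({..<d} \<times> C) {..<N}" and C: "finite C"
    and A: "A \<in> carrier_mat N N"
    and ent: "\<And>r s c c'. r < d \<Longrightarrow> s < d \<Longrightarrow> c \<in> C \<Longrightarrow> c' \<in> C \<Longrightarrow>
       A $$ (f r c, f s c') = (if c = c' then B c $$ (r, s) else 0)"
    and B: "\<And>c. c \<in> C \<Longrightarrow> psd d (B c)"
  shows "vn_entropy A = (\<Sum>c\<in>C. vn_entropy (B c))"
proof -
  have "\<exists>U l. spec d (B c) {..<d} U l" if "c \<in> C" for c
    using psd_spec[OF B[OF that]] by blast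
  then obtain U l where s: "\<And>c. c \<in> C \<Longrightarrow> spec d (B c) {..<d} (U c) (l c)" by metis
  define g where "g = inv_into ({..<d} \<times> C) (\<lambda>(r, c). f r c)"
  have g: "g (f r c) = (r, c)" if "r < d" "c \<in> C" for r c
    unfolding g_def using that f inv_into_f_f[of "\<lambda>(r, c). f r c" "{..<d} \<times> C" "(r,c)"]
    by (simp add: bij_betw_def)
  have reidx: "(\<Sum>m<N. h m) = (\<Sum>r<d. \<Sum>c\<in>C. h (f r c))" for h :: cvec
    by (simp add: sum.reindex_bij_betw[OF f, symmetric] sum.cartesian_product case_prod_unfold)
  define T where "T = {..<d} \<times> C"
  define V where "V = (\<lambda>(x, c) m. if snd (g m) = c then U c x (fst (g m)) else 0)"
  define L where "L = (\<lambda>(x, c). l c x)"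
  have V: "V (x, c) (f r c') = (if c' = c then U c x r else 0)" if "r < d" "c' \<in> C" for x c r c'
    using g[OF that] by (auto simp: V_def)
  have ipV: "ip N (V (x, c)) (V (y, c')) = (if x = y \<and> c = c' then 1 else 0)"
    if "x < d" "y < d" "c \<in> C" "c' \<in> C" for x y c c'
  proof -
    have "ip N (V (x, c)) (V (y, c')) = (\<Sum>r<d. \<Sum>c''\<in>C. (if c'' = c then if c = c' then cnj (U c x r) * U c y r else 0 else 0))"
      unfolding ip_def reidx by (intro sum.cong refl) (auto simp: V)
    also have "\<dots> = (if c = c' then ip d (U c x) (U c y) else 0)"
      using C that by (simp add: ip_def)
    finally show ?thesis using onbD(3)[OF specD(2)[OF s[OF that(3)]]] that by auto
  qed
  have "spec N A T V L"
    unfolding spec_def onb_def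
  proof (intro conjI ballI allI impI)
    show "card T = N" using bij_betw_same_card[OF f] by (simp add: T_def)
    fix i j assume "i \<in> T" "j \<in> T"
    then show "ip N (V i) (V j) = (if i = j then 1 else 0)"
      using ipV by (cases i; cases j) (auto simp: T_def)
  next
    have surj: "\<exists>r c. m = f r c \<and> r < d \<and> c \<in> C" if "m < N" for m
    proof -
      have "m \<in> (\<lambda>(r, c). f r c) ` ({..<d} \<times> C)" using f that by (simp add: bij_betw_def)
      then show ?thesis by auto
    qed
    fix m m' assume m: "m < N" "m' < N"
    obtain r c where rc: "m = f r c" "r < d" "c \<in> C"
      using surj[OF m(1)] by blast
    obtain s' c' where sc: "m' = f s' c'" "s' < d" "c' \<in> C"
      using surj[OF m(2)] by blast
    have "(\<Sum>i\<in>T. of_real (L i) * V i m * cnj (V i m')) = (\<Sum>x<d. \<Sum>c''\<in>C. of_real (L (x,c'')) * V (x,c'') m * cnj (V (x,c'') m'))"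
      by (simp add: T_def sum.cartesian_product case_prod_unfold)
    also have "\<dots> = (\<Sum>x<d. \<Sum>c''\<in>C. if c'' = c then (if c = c' then of_real (l c x) * U c x r * cnj (U c x s') else 0) else 0)"
      using rc sc by (intro sum.cong refl) (auto simp: V L_def)
    also have "\<dots> = (if c = c' then (\<Sum>x<d. of_real (l c x) * U c x r * cnj (U c x s')) else 0)"
      using C rc by simp
    also have "\<dots> = A $$ (m, m')"
      using ent[OF rc(2) sc(2) rc(3) sc(3)] specD(3)[OF s[OF rc(3)] rc(2) sc(2)] rc(1) sc(1) by auto
    finally show "A $$ (m, m') = (\<Sum>i\<in>T. of_real (L i) * V i m * cnj (V i m'))" by simp
  qed (use C A in \<open>auto simp: T_def\<close>)
  then have "vn_entropy A = (\<Sum>i\<in>T. eta (L i))" by (rule spec_vn_entropy)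
  also have "\<dots> = (\<Sum>c\<in>C. \<Sum>x<d. eta (l c x))"
    by (subst sum.swap) (simp add: T_def L_def sum.cartesian_product case_prod_unfold)
  also have "\<dots> = (\<Sum>c\<in>C. vn_entropy (B c))"
    by (intro sum.cong refl) (simp add: spec_vn_entropy[OF s])
  finally show ?thesis .
qed

section \<open>Data processing\<close>

lemma psd_spec_ex: "psd n A \<Longrightarrow> \<exists>U l. spec n A {..<n} U l \<and> (\<forall>i<n. l i \<ge> 0)"
  by (rule psd_spec) auto

text \<open>In matrix notation \<open>hs n W Y = tr (W\<^sup>* Y)\<close>, \<open>LN n X W = tr (W\<^sup>* X W)\<close> and \<open>RN n X W = tr (W X W\<^sup>*)\<close>.\<close>

definition hs :: "nat \<Rightarrow> cker \<Rightarrow> cker \<Rightarrow> complex" where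
  "hs n W Y = (\<Sum>r<n. \<Sum>s<n. cnj (W r s) * Y r s)"

definition LN :: "nat \<Rightarrow> complex mat \<Rightarrow> cker \<Rightarrow> real" where
  "LN n X W = (\<Sum>s<n. Re (qf n X (\<lambda>r. W r s)))"

definition RN :: "nat \<Rightarrow> complex mat \<Rightarrow> cker \<Rightarrow> real" where
  "RN n X W = (\<Sum>r<n. Re (qf n X (\<lambda>s. cnj (W r s))))"

text \<open>The kernel \<open>W\<close> is the image of \<open>Z\<close> under the adjoint of \<open>\<Phi>\<close>.\<close>

definition schwarz :: "nat \<Rightarrow> nat \<Rightarrow> (complex mat \<Rightarrow> complex mat) \<Rightarrow> bool" where
  "schwarz n m \<Phi> \<longleftrightarrow>
     (\<forall>X. psd n X \<longrightarrow> psd m (\<Phi> X) \<and> mtrace (\<Phi> X) = mtrace X) \<and>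
     (\<forall>X\<in>carrier_mat n n. \<Phi> X \<in> carrier_mat m m) \<and>
     (\<forall>Z. \<exists>W. (\<forall>X\<in>carrier_mat n n. hs n W (ent X) = hs m Z (ent (\<Phi> X))) \<and>
        (\<forall>X. psd n X \<longrightarrow> LN n X W \<le> LN m (\<Phi> X) Z \<and> RN n X W \<le> RN m (\<Phi> X) Z))"

text \<open>Rows are expanded in one basis and columns in another. With the eigenbases of
  \<open>\<rho>\<close> and \<open>\<sigma>\<close> in these roles, the forms \<open>LN\<close> of
  \<open>\<rho>\<close> and \<open>RN\<close> of \<open>\<sigma>\<close> become diagonal
  simultaneously.\<close>

lemma hs_coord:
  assumes U: "onb n T U" and V: "onb n S V"
  shows "hs n W Y = (\<Sum>i\<in>T. \<Sum>j\<in>S. cnj (bil n W (U i) (V j)) * bil n Y (U i) (V j))"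
proof -
  define w where "w W i s = cnj (ip n (U i) (\<lambda>r. W r s))" for W :: cker and i s
  have bw: "bil n W (U i) (V j) = ip n (w W i) (V j)" for W i j
    unfolding bil_def ip_def[of _ "w W i"] w_def unfolding ip_def
    by (simp add: sum_distrib_right) (rule sum.swap)
  have "hs n W Y = (\<Sum>s<n. ip n (\<lambda>r. W r s) (\<lambda>r. Y r s))"
    unfolding hs_def ip_def by (rule sum.swap)
  also have "\<dots> = (\<Sum>s<n. \<Sum>i\<in>T. cnj (w Y i s) * w W i s)"
  proof (intro sum.cong refl)
    fix s
    show "ip n (\<lambda>r. W r s) (\<lambda>r. Y r s) = (\<Sum>i\<in>T. cnj (w Y i s) * w W i s)"
      using parseval[OF U, of "\<lambda>r. W r s" "\<lambda>r. Y r s"] by (simp add: w_def mult.commute)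
  qed
  also have "\<dots> = (\<Sum>i\<in>T. ip n (w Y i) (w W i))"
    unfolding ip_def by (rule sum.swap)
  also have "\<dots> = (\<Sum>i\<in>T. \<Sum>j\<in>S. cnj (ip n (V j) (w Y i)) * ip n (V j) (w W i))"
    by (intro sum.cong refl parseval[OF V, symmetric])
  also have "\<dots> = (\<Sum>i\<in>T. \<Sum>j\<in>S. cnj (bil n W (U i) (V j)) * bil n Y (U i) (V j))"
    by (simp add: bw ip_cnj mult.commute)
  finally show ?thesis .
qed

lemma LN_coord:
  assumes X: "spec n X T U a" and V: "onb n S V"
  shows "LN n X W = (\<Sum>i\<in>T. \<Sum>j\<in>S. a i * nsq (bil n W (U i) (V j)))"
proof -
  define w where "w i s = cnj (ip n (U i) (\<lambda>r. W r s))" for i s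
  have bw: "bil n W (U i) (V j) = ip n (w i) (V j)" for i j
    unfolding bil_def ip_def[of _ "w i"] w_def unfolding ip_def
    by (simp add: sum_distrib_right) (rule sum.swap)
  have cm: "cmod (ip n (V j) (w i)) = cmod (bil n W (U i) (V j))" for i j
    unfolding bw by (metis complex_mod_cnj ip_cnj)
  have "LN n X W = (\<Sum>s<n. \<Sum>i\<in>T. a i * nsq (w i s))"
    unfolding LN_def by (simp add: spec_qf[OF X] w_def)
  also have "\<dots> = (\<Sum>i\<in>T. a i * (\<Sum>s<n. nsq (w i s)))"
    by (subst sum.swap) (simp add: sum_distrib_left)
  also have "\<dots> = (\<Sum>i\<in>T. \<Sum>j\<in>S. a i * nsq (bil n W (U i) (V j)))"
    by (simp add: parseval_norm[OF V, symmetric] cm sum_distrib_left)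
  finally show ?thesis .
qed

lemma RN_coord:
  assumes X: "spec n X S V b" and U: "onb n T U"
  shows "RN n X W = (\<Sum>i\<in>T. \<Sum>j\<in>S. b j * nsq (bil n W (U i) (V j)))"
proof -
  define g where "g j r = cnj (ip n (V j) (\<lambda>s. cnj (W r s)))" for j r
  have bw: "bil n W (U i) (V j) = ip n (U i) (g j)" for i j
    unfolding bil_ip_right g_def by (simp add: ip_def mult.commute)
  have "RN n X W = (\<Sum>r<n. \<Sum>j\<in>S. b j * nsq (g j r))"
    unfolding RN_def by (simp add: spec_qf[OF X] g_def)
  also have "\<dots> = (\<Sum>j\<in>S. b j * (\<Sum>r<n. nsq (g j r)))"
    by (subst sum.swap) (simp add: sum_distrib_left)
  also have "\<dots> = (\<Sum>j\<in>S. \<Sum>i\<in>T. b j * nsq (bil n W (U i) (V j)))"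
    by (simp add: parseval_norm[OF U, symmetric] bw sum_distrib_left)
  also have "\<dots> = (\<Sum>i\<in>T. \<Sum>j\<in>S. b j * nsq (bil n W (U i) (V j)))"
    by (rule sum.swap)
  finally show ?thesis .
qed

lemma spec_bil_left:
  assumes X: "spec n X T U a" and i: "i \<in> T"
  shows "bil n (ent X) (U i) v = of_real (a i) * ip n (U i) v"
proof -
  note o = onbD[OF specD(2)[OF X]]
  have "bil n (ent X) (U i) v = (\<Sum>k\<in>T. if k = i then of_real (a i) * ip n (U i) v else 0)"
    unfolding spec_bil[OF X] using o(3) i by (intro sum.cong) auto
  then show ?thesis using o i by simp
qed

lemma spec_bil_right:
  assumes X: "spec n X T U a" and i: "i \<in> T"
  shows "bil n (ent X) v (U i) = of_real (a i) * ip n v (U i)"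
proof -
  note o = onbD[OF specD(2)[OF X]]
  have "bil n (ent X) v (U i) = (\<Sum>k\<in>T. if k = i then of_real (a i) * ip n v (U i) else 0)"
    unfolding spec_bil[OF X] using o(3) i by (intro sum.cong) auto
  then show ?thesis using o i by simp
qed

text \<open>The difference of the two sides is \<open>nsq (of_real u * w - y)\<close> divided by
  \<open>u\<close>. In the degenerate case both sides vanish, division by zero being zero.\<close>

lemma complete_square:
  fixes w y :: complex and u :: real
  assumes "u \<ge> 0" "u = 0 \<Longrightarrow> y = 0"
  shows "2 * Re (cnj w * y) - u * (cmod w)\<^sup>2 \<le> (cmod y)\<^sup>2 / u"
proof (cases "u = 0")
  case False
  then have u: "u > 0" using assms by simp
  have "0 \<le> nsq (of_real u * w - y)" by simp
  also have "\<dots> = u\<^sup>2 * (cmod w)\<^sup>2 - 2 * u * Re (cnj w * y) + (cmod y)\<^sup>2"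
    unfolding cmod_power2 by (simp add: algebra_simps power2_eq_square)
  finally have "u * (2 * Re (cnj w * y) - u * (cmod w)\<^sup>2) \<le> (cmod y)\<^sup>2"
    by (simp add: algebra_simps power2_eq_square)
  then show ?thesis using u by (simp add: pos_le_divide_eq mult.commute)
qed (use assms in simp)

text \<open>Left multiplication by \<open>\<rho>\<close> and right multiplication by
  \<open>\<sigma>\<close> commute. In the matrix units built from the two eigenbases,
  \<open>1 - s\<close> times the latter plus \<open>s\<close> times the former is diagonal with
  eigenvalues \<open>u i j\<close>, and \<open>Q\<close> is the quadratic form of its inverse at
  \<open>\<rho> - \<sigma>\<close>. Completing the square in each coordinate exhibits
  \<open>Q\<close> as the maximum of \<open>J\<close>.\<close>

lemma quasi_entropy_variational:
  assumes r: "spec n \<rho> T U a" "\<And>i. i \<in> T \<Longrightarrow> a i \<ge> 0"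
    and q: "spec n \<sigma> S V b" "\<And>j. j \<in> S \<Longrightarrow> b j \<ge> 0"
    and s: "0 < s" "s < 1"
  defines "Q \<equiv> \<Sum>i\<in>T. \<Sum>j\<in>S. nsq (ip n (U i) (V j)) * ((a i - b j)\<^sup>2 / ((1 - s) * b j + s * a i))"
    and "J \<equiv> \<lambda>W. 2 * (Re (hs n W (ent \<rho>)) - Re (hs n W (ent \<sigma>))) - (1 - s) * RN n \<sigma> W - s * LN n \<rho> W"
  shows "J W \<le> Q" and "\<exists>W. J W = Q"
proof -
  define u where "u i j = (1 - s) * b j + s * a i" for i j
  define y where "y i j = of_real (a i - b j) * ip n (U i) (V j)" for i j
  have U: "onb n T U" and V: "onb n S V" using specD(2)[OF r(1)] specD(2)[OF q(1)] by auto
  have u: "u i j \<ge> 0" if "i \<in> T" "j \<in> S" for i j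
    using that r q s by (simp add: u_def)
  \<comment> \<open>Since \<open>0 < s < 1\<close>, a vanishing denominator forces
    \<open>a i = b j = 0\<close>, so the coordinate \<open>y i j\<close> of
    \<open>\<rho> - \<sigma>\<close> vanishes as well.\<close>
  have u0: "y i j = 0" if "i \<in> T" "j \<in> S" "u i j = 0" for i j
  proof -
    have "(1 - s) * b j \<ge> 0" "s * a i \<ge> 0" using that r q s by auto
    then have "(1 - s) * b j = 0" "s * a i = 0" using that(3) unfolding u_def by linarith+
    then show ?thesis using s by (simp add: y_def)
  qed
  have J: "J W = (\<Sum>i\<in>T. \<Sum>j\<in>S. 2 * Re (cnj (bil n W (U i) (V j)) * y i j) - u i j * nsq (bil n W (U i) (V j)))" for W
  proof -
    have "Re (hs n W (ent \<rho>)) - Re (hs n W (ent \<sigma>))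
       = (\<Sum>i\<in>T. \<Sum>j\<in>S. Re (cnj (bil n W (U i) (V j)) * y i j))"
      unfolding hs_coord[OF U V] Re_sum sum_subtractf[symmetric]
      by (intro sum.cong refl) (simp add: spec_bil_left[OF r(1)] spec_bil_right[OF q(1)] y_def algebra_simps)
    then have "J W = 2 * (\<Sum>i\<in>T. \<Sum>j\<in>S. Re (cnj (bil n W (U i) (V j)) * y i j))
        - (1 - s) * (\<Sum>i\<in>T. \<Sum>j\<in>S. b j * nsq (bil n W (U i) (V j)))
        - s * (\<Sum>i\<in>T. \<Sum>j\<in>S. a i * nsq (bil n W (U i) (V j)))"
      unfolding J_def LN_coord[OF r(1) V] RN_coord[OF q(1) U] by simp
    also have "\<dots> = (\<Sum>i\<in>T. \<Sum>j\<in>S. 2 * Re (cnj (bil n W (U i) (V j)) * y i j)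
        - (1 - s) * (b j * nsq (bil n W (U i) (V j))) - s * (a i * nsq (bil n W (U i) (V j))))"
      by (simp only: sum_distrib_left sum_subtractf)
    also have "\<dots> = (\<Sum>i\<in>T. \<Sum>j\<in>S. 2 * Re (cnj (bil n W (U i) (V j)) * y i j) - u i j * nsq (bil n W (U i) (V j)))"
      by (intro sum.cong refl) (simp add: u_def algebra_simps)
    finally show ?thesis .
  qed
  have Q: "Q = (\<Sum>i\<in>T. \<Sum>j\<in>S. nsq (y i j) / u i j)"
    unfolding Q_def y_def u_def norm_mult power_mult_distrib
    by (intro sum.cong refl) (simp add: mult_ac flip: of_real_diff)
  show "J W \<le> Q"
    unfolding J Q using u u0 by (intro sum_mono complete_square) auto
  \<comment> \<open>The maximizer in coordinates. Where \<open>u i j = 0\<close> it is 0 by the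
    convention for division, in agreement with \<open>y i j = 0\<close>.\<close>
  define z where "z i j = y i j / of_real (u i j)" for i j
  define Z where "Z r s = (\<Sum>i\<in>T. \<Sum>j\<in>S. z i j * (U i r * cnj (V j s)))" for r s
  have bz: "bil n Z (U i) (V j) = z i j" if ij: "i \<in> T" "j \<in> S" for i j
  proof -
    have "bil n Z (U i) (V j) = (\<Sum>r<n. \<Sum>s<n. \<Sum>i'\<in>T. \<Sum>j'\<in>S. z i' j' * ((cnj (U i r) * U i' r) * (cnj (V j' s) * V j s)))"
      unfolding bil_def Z_def by (simp add: sum_distrib_left sum_distrib_right mult_ac)
    also have "\<dots> = (\<Sum>r<n. \<Sum>i'\<in>T. \<Sum>j'\<in>S. \<Sum>s<n. z i' j' * ((cnj (U i r) * U i' r) * (cnj (V j' s) * V j s)))"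
      by (rule sum.cong[OF refl], subst sum.swap, rule sum.cong[OF refl], rule sum.swap)
    also have "\<dots> = (\<Sum>i'\<in>T. \<Sum>j'\<in>S. \<Sum>r<n. \<Sum>s<n. z i' j' * ((cnj (U i r) * U i' r) * (cnj (V j' s) * V j s)))"
      by (subst sum.swap, rule sum.cong[OF refl], rule sum.swap)
    also have "\<dots> = (\<Sum>i'\<in>T. \<Sum>j'\<in>S. z i' j' * (ip n (U i) (U i') * ip n (V j') (V j)))"
      by (rule sum.cong[OF refl], rule sum.cong[OF refl]) (simp only: ip_def sum_product, simp only: sum_distrib_left)
    also have "\<dots> = (\<Sum>i'\<in>T. \<Sum>j'\<in>S. if j' = j then (if i' = i then z i j else 0) else 0)"
      using onbD(3)[OF U] onbD(3)[OF V] ij by (intro sum.cong refl) auto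
    finally show ?thesis using onbD(1)[OF U] onbD(1)[OF V] ij by simp
  qed
  have "J Z = Q"
    unfolding J Q
  proof (intro sum.cong refl)
    fix i j assume ij: "i \<in> T" "j \<in> S"
    show "2 * Re (cnj (bil n Z (U i) (V j)) * y i j) - u i j * nsq (bil n Z (U i) (V j)) = nsq (y i j) / u i j"
    proof (cases "u i j = 0")
      case False
      have "cnj (z i j) * y i j = of_real (nsq (y i j) / u i j)"
        unfolding z_def by (simp only: of_real_divide complex_norm_square) (simp add: mult.commute)
      then have "Re (cnj (z i j) * y i j) = nsq (y i j) / u i j" by simp
      moreover have "nsq (z i j) = nsq (y i j) / (u i j)\<^sup>2"
        by (simp add: z_def norm_divide power_divide)
      ultimately show ?thesis using False by (simp add: bz ij power2_eq_square)
    qed (simp add: bz ij z_def)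
  qed
  then show "\<exists>W. J W = Q" by blast
qed

text \<open>An antiderivative in \<open>s\<close> of the integrand \<open>(1 - s) (a - b)\<^sup>2 / ((1 - s) b + s a)\<close>; working with it avoids
  integration.\<close>

definition relent_term :: "real \<Rightarrow> real \<Rightarrow> real \<Rightarrow> real" where
  "relent_term a b s = a * ln ((1 - s) * b + s * a) - ((1 - s) * b + s * a)"

text \<open>With \<open>u = (1 - s) * b + s * a\<close> the derivative is
  \<open>(a - b) * (a - u) / u\<close>, and \<open>a - u = (1 - s) * (a - b)\<close>.\<close>

lemma relent_term_deriv:
  assumes "a \<ge> 0" "b \<ge> 0" "0 < s" "s < 1"
  shows "(relent_term a b has_real_derivative (1 - s) * ((a - b)\<^sup>2 / ((1 - s) * b + s * a))) (at s)"
proof (cases "a = 0 \<and> b = 0")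
  case True
  then show ?thesis by (simp add: relent_term_def[abs_def])
next
  case False
  have u: "(1 - s) * b + s * a > 0"
  proof -
    have "(1 - s) * b \<ge> 0" "s * a \<ge> 0" using assms by auto
    moreover have "(1 - s) * b > 0 \<or> s * a > 0" using assms False by auto
    ultimately show ?thesis by linarith
  qed
  show ?thesis
    unfolding relent_term_def[abs_def]
    by (rule derivative_eq_intros refl u)+ (use u in \<open>simp add: field_simps power2_eq_square\<close>)
qed

text \<open>For \<open>b = 0 < a\<close> the term would diverge logarithmically at
  \<open>s = 0\<close>; the third assumption is the scalar form of the support condition of relative
  entropy.\<close>

lemma relent_term_cont:
  assumes "a \<ge> 0" "b \<ge> 0" "b = 0 \<Longrightarrow> a = 0"
  shows "continuous_on {0..1} (relent_term a b)"
proof (cases "a = 0")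
  case True
  then show ?thesis by (auto simp: relent_term_def[abs_def] intro!: continuous_intros)
next
  case False
  have u: "(1 - s) * b + s * a > 0" if "s \<in> {0..1}" for s
  proof -
    have ab: "a > 0" "b > 0" using False assms by (auto simp: order.order_iff_strict)
    have "(1 - s) * b \<ge> 0" "s * a \<ge> 0" using assms that by auto
    moreover have "(1 - s) * b > 0 \<or> s * a > 0" using ab that by (cases "s = 0") auto
    ultimately show ?thesis by linarith
  qed
  show ?thesis unfolding relent_term_def[abs_def] using u by (intro continuous_intros) force
qed

text \<open>Under the support condition, the value at 1 minus the value at 0 is the relative entropy
  of the two matrices in nats, plus the trace of the second minus the trace of the first.\<close>

definition relent :: "nat \<Rightarrow> cker \<Rightarrow> (nat \<Rightarrow> real) \<Rightarrow> cker \<Rightarrow> (nat \<Rightarrow> real) \<Rightarrow> real \<Rightarrow> real" where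
  "relent n U a V b s = (\<Sum>i<n. \<Sum>j<n. nsq (ip n (U i) (V j)) * relent_term (a i) (b j) s)"

lemma relent_deriv:
  assumes "\<And>i. i < n \<Longrightarrow> a i \<ge> 0" "\<And>j. j < n \<Longrightarrow> b j \<ge> 0" "0 < s" "s < 1"
  shows "(relent n U a V b has_real_derivative (1 - s) *
    (\<Sum>i<n. \<Sum>j<n. nsq (ip n (U i) (V j)) * ((a i - b j)\<^sup>2 / ((1 - s) * b j + s * a i)))) (at s)"
proof -
  have "(relent n U a V b has_real_derivative (\<Sum>i<n. \<Sum>j<n. nsq (ip n (U i) (V j)) *
     ((1 - s) * ((a i - b j)\<^sup>2 / ((1 - s) * b j + s * a i))))) (at s)"
    unfolding relent_def[abs_def] using assms by (intro DERIV_sum DERIV_cmult relent_term_deriv) auto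
  then show ?thesis by (simp add: sum_distrib_left mult_ac)
qed

lemma relent_cont:
  assumes "\<And>i. i < n \<Longrightarrow> a i \<ge> 0" "\<And>j. j < n \<Longrightarrow> b j \<ge> 0"
    and "\<And>i j. i < n \<Longrightarrow> j < n \<Longrightarrow> b j = 0 \<Longrightarrow> a i \<noteq> 0 \<Longrightarrow> ip n (U i) (V j) = 0"
  shows "continuous_on {0..1} (relent n U a V b)"
  unfolding relent_def[abs_def]
proof (intro continuous_on_sum)
  fix i j assume ij: "i \<in> {..<n}" "j \<in> {..<n}"
  show "continuous_on {0..1} (\<lambda>s. nsq (ip n (U i) (V j)) * relent_term (a i) (b j) s)"
  proof (cases "ip n (U i) (V j) = 0")
    case False
    then show ?thesis using assms ij by (intro continuous_on_mult continuous_on_const relent_term_cont) auto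
  qed simp
qed

text \<open>The derivative of \<^const>\<open>relent\<close> is a supremum of expressions linear in the pair of states,
  which a Schwarz map can only decrease.\<close>

lemma relent_mono:
  assumes \<Phi>: "schwarz n m \<Phi>"
    and r: "spec n \<rho> {..<n} U a" "\<And>i. i < n \<Longrightarrow> a i \<ge> 0"
    and q: "spec n \<sigma> {..<n} V b" "\<And>j. j < n \<Longrightarrow> b j \<ge> 0"
    and supp: "\<And>i j. i < n \<Longrightarrow> j < n \<Longrightarrow> b j = 0 \<Longrightarrow> a i \<noteq> 0 \<Longrightarrow> ip n (U i) (V j) = 0"
    and r': "spec m (\<Phi> \<rho>) {..<m} U' a'" "\<And>i. i < m \<Longrightarrow> a' i \<ge> 0"
    and q': "spec m (\<Phi> \<sigma>) {..<m} V' b'" "\<And>j. j < m \<Longrightarrow> b' j \<ge> 0"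
    and supp': "\<And>i j. i < m \<Longrightarrow> j < m \<Longrightarrow> b' j = 0 \<Longrightarrow> a' i \<noteq> 0 \<Longrightarrow> ip m (U' i) (V' j) = 0"
  shows "relent m U' a' V' b' 1 - relent m U' a' V' b' 0 \<le> relent n U a V b 1 - relent n U a V b 0"
proof -
  let ?F = "\<lambda>s. relent n U a V b s - relent m U' a' V' b' s"
  have "?F 0 \<le> ?F 1"
  proof (rule DERIV_nonneg_imp_increasing_open[where f = ?F and a = 0 and b = 1])
    show "continuous_on {0..1} ?F"
      using r q r' q' supp supp' by (intro continuous_on_diff relent_cont) auto
    fix s :: real assume s: "0 < s" "s < 1"
    let ?Q = "\<Sum>i<n. \<Sum>j<n. nsq (ip n (U i) (V j)) * ((a i - b j)\<^sup>2 / ((1 - s) * b j + s * a i))"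
    let ?Q' = "\<Sum>i<m. \<Sum>j<m. nsq (ip m (U' i) (V' j)) * ((a' i - b' j)\<^sup>2 / ((1 - s) * b' j + s * a' i))"
    have "?Q' \<le> ?Q"
    proof -
      \<comment> \<open>\<open>Z\<close> attains the maximum for the output states, while its
        pullback \<open>W\<close> is merely a candidate for the input states.\<close>
      obtain Z where Z: "2 * (Re (hs m Z (ent (\<Phi> \<rho>))) - Re (hs m Z (ent (\<Phi> \<sigma>)))) - (1 - s) * RN m (\<Phi> \<sigma>) Z - s * LN m (\<Phi> \<rho>) Z = ?Q'"
        using quasi_entropy_variational(2)[OF r'(1) _ q'(1) _ s] r'(2) q'(2) by auto
      obtain W where W: "\<forall>X\<in>carrier_mat n n. hs n W (ent X) = hs m Z (ent (\<Phi> X))"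
        "\<forall>X. psd n X \<longrightarrow> LN n X W \<le> LN m (\<Phi> X) Z \<and> RN n X W \<le> RN m (\<Phi> X) Z"
        using \<Phi> unfolding schwarz_def by blast
      have "psd n \<rho>" "psd n \<sigma>" using spec_imp_psd[OF r(1)] spec_imp_psd[OF q(1)] r q by auto
      then have "LN n \<rho> W \<le> LN m (\<Phi> \<rho>) Z" "RN n \<sigma> W \<le> RN m (\<Phi> \<sigma>) Z" using W by auto
      then have le: "s * LN n \<rho> W \<le> s * LN m (\<Phi> \<rho>) Z" "(1 - s) * RN n \<sigma> W \<le> (1 - s) * RN m (\<Phi> \<sigma>) Z"
        using s by (auto intro!: mult_left_mono)
      have eq: "hs n W (ent \<rho>) = hs m Z (ent (\<Phi> \<rho>))"
        "hs n W (ent \<sigma>) = hs m Z (ent (\<Phi> \<sigma>))"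
        using W(1) specD(1)[OF r(1)] specD(1)[OF q(1)] by auto
      have Q: "2 * (Re (hs n W (ent \<rho>)) - Re (hs n W (ent \<sigma>))) - (1 - s) * RN n \<sigma> W - s * LN n \<rho> W \<le> ?Q"
        using quasi_entropy_variational(1)[OF r(1) _ q(1) _ s] r(2) q(2) by auto
      have "q' \<le> q" if "x - c - e = q'" "x - c' - e' \<le> q" "e' \<le> e" "c' \<le> c" for q q' x c e c' e' :: real
        using that by linarith
      from this[OF Z Q[unfolded eq] le] show ?thesis .
    qed
    then have "(1 - s) * ?Q - (1 - s) * ?Q' \<ge> 0" using s by (simp add: mult_left_mono)
    moreover have "(?F has_real_derivative (1 - s) * ?Q - (1 - s) * ?Q') (at s)"
      using r q r' q' s by (intro DERIV_diff relent_deriv) auto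
    ultimately show "\<exists>y. (?F has_real_derivative y) (at s) \<and> y \<ge> 0" by blast
  qed simp
  then show ?thesis by simp
qed

lemma eta_ln: "x \<ge> 0 \<Longrightarrow> ln 2 * eta x = - (x * ln x)"
  by (auto simp: eta_def log_def)

lemma msum_carrier [simp]: "msum n m f K \<in> carrier_mat n m"
  by (simp add: msum_def)

lemma qf_msum: "qf n (msum n n \<omega> K) v = (\<Sum>k\<in>K. qf n (\<omega> k) v)"
proof -
  have "qf n (msum n n \<omega> K) v = (\<Sum>r<n. \<Sum>s<n. \<Sum>k\<in>K. cnj (v r) * \<omega> k $$ (r, s) * v s)"
    unfolding bil_def by (simp add: msum_def sum_distrib_left sum_distrib_right)
  also have "\<dots> = (\<Sum>k\<in>K. qf n (\<omega> k) v)"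
    unfolding bil_def by (rule sum_rotate)
  finally show ?thesis .
qed

lemma psd_msum: "(\<And>k. k \<in> K \<Longrightarrow> psd n (\<omega> k)) \<Longrightarrow> psd n (msum n n \<omega> K)"
  unfolding psd_iff_qf qf_msum by (auto intro!: sum_nonneg sum_in_Reals)

lemma mtrace_msum:
  assumes "\<And>k. k \<in> K \<Longrightarrow> \<omega> k \<in> carrier_mat n n"
  shows "mtrace (msum n n \<omega> K) = (\<Sum>k\<in>K. mtrace (\<omega> k))"
proof -
  have "mtrace (msum n n \<omega> K) = (\<Sum>r<n. \<Sum>k\<in>K. \<omega> k $$ (r, r))"
    by (simp add: mtrace_def msum_def)
  also have "\<dots> = (\<Sum>k\<in>K. \<Sum>r<n. \<omega> k $$ (r, r))" by (rule sum.swap)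
  finally show ?thesis using assms by (auto simp: mtrace_def intro!: sum.cong)
qed

text \<open>A kernel vector of a sum of positive matrices lies in the kernel of every summand. Hence
  each member of an ensemble satisfies the support condition relative to the sum.\<close>

lemma ensemble_support:
  assumes K: "finite K" "k \<in> K" and w: "\<And>k. k \<in> K \<Longrightarrow> psd n (\<omega> k)"
    and r: "spec n (\<omega> k) {..<n} U a" "\<And>i. i < n \<Longrightarrow> a i \<ge> 0"
    and q: "spec n (msum n n \<omega> K) {..<n} V b"
    and ij: "i < n" "j < n" "b j = 0" "a i \<noteq> 0"
  shows "ip n (U i) (V j) = 0"
proof -
  have "(\<Sum>k\<in>K. Re (qf n (\<omega> k) (V j))) = 0"
    using spec_qf_self[OF q, of j] ij by (simp add: qf_msum flip: Re_sum)
  then have "Re (qf n (\<omega> k) (V j)) = 0"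
    using K w by (subst (asm) sum_nonneg_eq_0_iff) (auto simp: psd_iff_qf)
  then have "(\<Sum>i<n. a i * nsq (ip n (U i) (V j))) = 0"
    by (simp add: spec_qf[OF r(1)])
  then have "a i * nsq (ip n (U i) (V j)) = 0"
    using r(2) ij by (subst (asm) sum_nonneg_eq_0_iff) auto
  then show ?thesis using ij by simp
qed

text \<open>Holevo information as the sum of the relative entropies of the members to their sum: the
  diagonals of the members in the basis \<open>V\<close> add up to \<open>b\<close>, which assembles
  the cross terms into one entropy. The trace terms stem from the missing normalization.\<close>

lemma ensemble_relent:
  assumes K: "finite K" and w: "\<And>k. k \<in> K \<Longrightarrow> psd n (\<omega> k)"
    and r: "\<And>k. k \<in> K \<Longrightarrow> spec n (\<omega> k) {..<n} (U k) (a k)" "\<And>k i. k \<in> K \<Longrightarrow> i < n \<Longrightarrow> a k i \<ge> 0"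
    and q: "spec n (msum n n \<omega> K) {..<n} V b" "\<And>j. j < n \<Longrightarrow> b j \<ge> 0"
  shows "(\<Sum>k\<in>K. relent n (U k) (a k) V b 1 - relent n (U k) (a k) V b 0)
     = ln 2 * (vn_entropy (msum n n \<omega> K) - (\<Sum>k\<in>K. vn_entropy (\<omega> k)))
       - (\<Sum>k\<in>K. Re (mtrace (\<omega> k))) + real (card K) * Re (mtrace (msum n n \<omega> K))"
proof -
  have V: "onb n {..<n} V" using specD[OF q(1)] by simp
  have one: "relent n (U k) (a k) V b 1 - relent n (U k) (a k) V b 0
     = - ln 2 * vn_entropy (\<omega> k) - (\<Sum>j<n. Re (qf n (\<omega> k) (V j)) * ln (b j)) - Re (mtrace (\<omega> k)) + Re (mtrace (msum n n \<omega> K))"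
    if k: "k \<in> K" for k
  proof -
    have U: "onb n {..<n} (U k)" using specD[OF r(1)[OF k]] by simp
    define c where "c i j = nsq (ip n (U k i) (V j))" for i j
    have ci: "(\<Sum>j<n. c i j) = 1" if "i < n" for i
      using onb_overlap(2)[OF U V, of i] that by (simp add: c_def)
    have cj: "(\<Sum>i<n. c i j) = 1" if "j < n" for j
      using onb_overlap(1)[OF U V, of j] that by (simp add: c_def)
    have "relent n (U k) (a k) V b 1 - relent n (U k) (a k) V b 0
      = (\<Sum>i<n. \<Sum>j<n. c i j * (a k i * ln (a k i)) - c i j * a k i * ln (b j) - c i j * a k i + c i j * b j)"
      unfolding relent_def c_def[symmetric] sum_subtractf[symmetric]
      by (intro sum.cong refl) (simp add: relent_term_def algebra_simps)
    also have "\<dots> = (\<Sum>i<n. \<Sum>j<n. c i j * (a k i * ln (a k i))) - (\<Sum>i<n. \<Sum>j<n. c i j * a k i * ln (b j))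
       - (\<Sum>i<n. \<Sum>j<n. c i j * a k i) + (\<Sum>i<n. \<Sum>j<n. c i j * b j)"
      by (simp only: sum.distrib sum_subtractf)
    also have "(\<Sum>i<n. \<Sum>j<n. c i j * (a k i * ln (a k i))) = - ln 2 * vn_entropy (\<omega> k)"
      using r(2)[OF k] by (simp flip: sum_distrib_right add: ci spec_vn_entropy[OF r(1)[OF k]] sum_distrib_left eta_ln sum_negf)
    also have "(\<Sum>i<n. \<Sum>j<n. c i j * a k i) = Re (mtrace (\<omega> k))"
      by (simp flip: sum_distrib_right add: ci spec_trace[OF r(1)[OF k]])
    also have "(\<Sum>i<n. \<Sum>j<n. c i j * b j) = Re (mtrace (msum n n \<omega> K))"
      by (subst sum.swap) (simp flip: sum_distrib_right add: cj spec_trace[OF q(1)])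
    also have "(\<Sum>i<n. \<Sum>j<n. c i j * a k i * ln (b j)) = (\<Sum>j<n. Re (qf n (\<omega> k) (V j)) * ln (b j))"
      by (subst sum.swap) (simp add: spec_qf[OF r(1)[OF k]] c_def sum_distrib_right sum_distrib_left mult_ac)
    finally show ?thesis .
  qed
  have "(\<Sum>k\<in>K. \<Sum>j<n. Re (qf n (\<omega> k) (V j)) * ln (b j)) = (\<Sum>j<n. (\<Sum>k\<in>K. Re (qf n (\<omega> k) (V j))) * ln (b j))"
    by (subst sum.swap) (simp add: sum_distrib_right)
  also have "\<dots> = (\<Sum>j<n. b j * ln (b j))"
    using spec_qf_self[OF q(1)] by (intro sum.cong refl) (simp add: qf_msum flip: Re_sum)
  also have "\<dots> = - ln 2 * vn_entropy (msum n n \<omega> K)"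
    using q(2) by (simp add: spec_vn_entropy[OF q(1)] sum_distrib_left eta_ln sum_negf)
  finally show ?thesis
    by (simp add: one sum.distrib sum_subtractf sum_negf sum_distrib_left algebra_simps)
qed

lemma schwarz_psd: "schwarz n m \<Phi> \<Longrightarrow> psd n X \<Longrightarrow> psd m (\<Phi> X)"
  and schwarz_trace: "schwarz n m \<Phi> \<Longrightarrow> psd n X \<Longrightarrow> mtrace (\<Phi> X) = mtrace X"
  by (auto simp: schwarz_def)

text \<open>Linearity of \<open>\<Phi>\<close> is contained in \<open>schwarz\<close> only
  implicitly: an entry of the image is a pairing with a matrix unit, and the adjoint turns it into a
  fixed linear functional of \<open>X\<close>.\<close>

lemma schwarz_entry:
  assumes "schwarz n m \<Phi>" "r < m" "s < m"
  shows "\<exists>W. \<forall>X\<in>carrier_mat n n. \<Phi> X $$ (r, s) = hs n W (ent X)"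
proof -
  have "hs m (\<lambda>r' s'. if s' = s then (if r' = r then 1 else 0) else 0) Y = Y r s" for Y
  proof -
    have "hs m (\<lambda>r' s'. if s' = s then (if r' = r then 1 else 0) else 0) Y
       = (\<Sum>r'<m. \<Sum>s'<m. if s' = s then (if r' = r then Y r s else 0) else 0)"
      unfolding hs_def by (intro sum.cong refl) auto
    then show ?thesis using assms by simp
  qed
  then show ?thesis using assms(1) unfolding schwarz_def by metis
qed

lemma schwarz_msum:
  assumes "schwarz n m \<Phi>" "\<And>k. k \<in> K \<Longrightarrow> \<omega> k \<in> carrier_mat n n"
  shows "\<Phi> (msum n n \<omega> K) = msum m m (\<lambda>k. \<Phi> (\<omega> k)) K"
proof -
  have "\<Phi> (msum n n \<omega> K) \<in> carrier_mat m m" using assms(1) by (auto simp: schwarz_def)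
  then show ?thesis
  proof (intro eq_matI, goal_cases)
    case (1 r s)
    then have rs: "r < m" "s < m" by (auto simp: msum_def)
    obtain W where W: "\<And>X. X \<in> carrier_mat n n \<Longrightarrow> \<Phi> X $$ (r, s) = hs n W (ent X)"
      using schwarz_entry[OF assms(1) rs] by blast
    have "\<Phi> (msum n n \<omega> K) $$ (r, s) = (\<Sum>x<n. \<Sum>y<n. \<Sum>k\<in>K. cnj (W x y) * \<omega> k $$ (x, y))"
      unfolding W[OF msum_carrier] hs_def by (simp add: msum_def sum_distrib_left)
    also have "\<dots> = (\<Sum>k\<in>K. hs n W (\<lambda>x y. \<omega> k $$ (x, y)))"
      unfolding hs_def by (rule sum_rotate)
    also have "\<dots> = (\<Sum>k\<in>K. \<Phi> (\<omega> k) $$ (r, s))"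
      using W assms(2) by simp
    finally show ?case using rs by (simp add: msum_def)
  qed (auto simp: msum_def)
qed

text \<open>The relative entropy of each member to the common sum decreases. The trace terms of
  \<open>ensemble_relent\<close> agree on both sides because traces are preserved.\<close>

theorem data_processing:
  assumes \<Phi>: "schwarz n m \<Phi>" and K: "finite K" and w: "\<And>k. k \<in> K \<Longrightarrow> psd n (\<omega> k)"
  shows "vn_entropy (\<Phi> (msum n n \<omega> K)) - (\<Sum>k\<in>K. vn_entropy (\<Phi> (\<omega> k)))
     \<le> vn_entropy (msum n n \<omega> K) - (\<Sum>k\<in>K. vn_entropy (\<omega> k))"
proof -
  let ?s = "msum n n \<omega> K"
  have w': "psd m (\<Phi> (\<omega> k))" if "k \<in> K" for k by (rule schwarz_psd[OF \<Phi> w[OF that]])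
  have sum': "\<Phi> ?s = msum m m (\<lambda>k. \<Phi> (\<omega> k)) K"
    by (rule schwarz_msum[OF \<Phi> psd_carrier[OF w]])
  have s: "psd n ?s" by (rule psd_msum[OF w])
  then have s': "psd m (\<Phi> ?s)" by (rule schwarz_psd[OF \<Phi>])
  obtain V b where q: "spec n ?s {..<n} V b" "\<And>j. j < n \<Longrightarrow> b j \<ge> 0" using psd_spec[OF s] by blast
  obtain V' b' where q': "spec m (\<Phi> ?s) {..<m} V' b'" "\<And>j. j < m \<Longrightarrow> b' j \<ge> 0" using psd_spec[OF s'] by blast
  have "\<forall>k\<in>K. \<exists>U a. spec n (\<omega> k) {..<n} U a \<and> (\<forall>i<n. a i \<ge> 0)"
    using psd_spec_ex[OF w] by auto
  then obtain U a where r: "\<And>k. k \<in> K \<Longrightarrow> spec n (\<omega> k) {..<n} (U k) (a k)" "\<And>k i. k \<in> K \<Longrightarrow> i < n \<Longrightarrow> a k i \<ge> 0"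
    by metis
  have "\<forall>k\<in>K. \<exists>U a. spec m (\<Phi> (\<omega> k)) {..<m} U a \<and> (\<forall>i<m. a i \<ge> 0)"
    using psd_spec_ex[OF w'] by auto
  then obtain U' a' where r': "\<And>k. k \<in> K \<Longrightarrow> spec m (\<Phi> (\<omega> k)) {..<m} (U' k) (a' k)" "\<And>k i. k \<in> K \<Longrightarrow> i < m \<Longrightarrow> a' k i \<ge> 0"
    by metis
  have "(\<Sum>k\<in>K. relent m (U' k) (a' k) V' b' 1 - relent m (U' k) (a' k) V' b' 0)
      \<le> (\<Sum>k\<in>K. relent n (U k) (a k) V b 1 - relent n (U k) (a k) V b 0)"
  proof (intro sum_mono relent_mono[OF \<Phi>])
    fix k i j assume k: "k \<in> K"
    show "ip n (U k i) (V j) = 0" if "i < n" "j < n" "b j = 0" "a k i \<noteq> 0"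
      using ensemble_support[OF K k w r(1)[OF k] r(2)[OF k] q(1) that] .
    show "ip m (U' k i) (V' j) = 0" if "i < m" "j < m" "b' j = 0" "a' k i \<noteq> 0"
      using ensemble_support[OF K k w' r'(1)[OF k] r'(2)[OF k] q'(1)[unfolded sum'] that] .
  qed (use r r' q q' in auto)
  also have "\<dots> = ln 2 * (vn_entropy ?s - (\<Sum>k\<in>K. vn_entropy (\<omega> k)))
       - (\<Sum>k\<in>K. Re (mtrace (\<omega> k))) + real (card K) * Re (mtrace ?s)"
    by (rule ensemble_relent[OF K w r q])
  also have "(\<Sum>k\<in>K. relent m (U' k) (a' k) V' b' 1 - relent m (U' k) (a' k) V' b' 0)
     = ln 2 * (vn_entropy (\<Phi> ?s) - (\<Sum>k\<in>K. vn_entropy (\<Phi> (\<omega> k))))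
       - (\<Sum>k\<in>K. Re (mtrace (\<Phi> (\<omega> k)))) + real (card K) * Re (mtrace (\<Phi> ?s))"
    unfolding sum' by (rule ensemble_relent[OF K w' r' q'[unfolded sum']])
  finally show ?thesis
    using schwarz_trace[OF \<Phi>] w s by simp
qed

section \<open>Channels\<close>

text \<open>Two-positivity and trace preservation, the form in which a channel yields the Schwarz
  inequality; it serves as a common interface for the decoder and for maps given by Kraus
  operators.\<close>

definition qmap :: "nat \<Rightarrow> nat \<Rightarrow> (complex mat \<Rightarrow> complex mat) \<Rightarrow> bool" where
  "qmap n m \<Phi> \<longleftrightarrow> lin_map n m \<Phi> \<and> (\<forall>X\<in>carrier_mat n n. mtrace (\<Phi> X) = mtrace X) \<and>
     (\<forall>Y. psd (2 * n) Y \<longrightarrow> psd (2 * m) (id_tensor 2 n m \<Phi> Y))"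

lemma cptp_imp_qmap: "cptp n m \<Phi> \<Longrightarrow> qmap n m \<Phi>"
  by (simp add: cptp_def qmap_def)

lemma sum_lessThan_double: "(\<Sum>r<2 * n. f r) = (\<Sum>r<n. f r) + (\<Sum>r<n. f (n + r))" for f :: "nat \<Rightarrow> 'a::comm_monoid_add"
proof -
  have "{..<2 * n} = {..<n} \<union> {n..<n + n}" by auto
  then have "(\<Sum>r<2 * n. f r) = (\<Sum>r<n. f r) + (\<Sum>r\<in>{n..<n+n}. f r)"
    by (simp add: sum.union_disjoint ivl_disj_int)
  also have "(\<Sum>r\<in>{n..<n+n}. f r) = (\<Sum>r<n. f (n + r))"
    using sum.shift_bounds_nat_ivl[of f 0 n n] by (simp add: atLeast0LessThan add.commute)
  finally show ?thesis .
qed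

lemma bil_four_block:
  assumes "A \<in> carrier_mat n n" "B \<in> carrier_mat n n" "C \<in> carrier_mat n n" "D \<in> carrier_mat n n"
  shows "qf (2 * n) (four_block_mat A B C D) v =
     bil n (ent A) v v + bil n (ent B) v (\<lambda>r. v (n + r))
   + bil n (ent C) (\<lambda>r. v (n + r)) v + bil n (ent D) (\<lambda>r. v (n + r)) (\<lambda>r. v (n + r))"
proof -
  let ?Y = "four_block_mat A B C D"
  have e: "?Y $$ (r, s) = A $$ (r, s)" "?Y $$ (r, n + s) = B $$ (r, s)"
     "?Y $$ (n + r, s) = C $$ (r, s)" "?Y $$ (n + r, n + s) = D $$ (r, s)" if "r < n" "s < n" for r s
    using assms that by auto
  show ?thesis
    unfolding bil_def sum_lessThan_double
    by (simp add: e sum.distrib add.assoc del: index_mat_four_block)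
qed

lemma four_block_of_blocks:
  assumes "Y \<in> carrier_mat (2 * n) (2 * n)"
  shows "Y = four_block_mat (mat n n (\<lambda>(r, s). Y $$ (r, s))) (mat n n (\<lambda>(r, s). Y $$ (r, n + s)))
     (mat n n (\<lambda>(r, s). Y $$ (n + r, s))) (mat n n (\<lambda>(r, s). Y $$ (n + r, n + s)))"
  using assms by (intro eq_matI) auto

lemma id_tensor_four_block:
  assumes c: "A \<in> carrier_mat n n" "B \<in> carrier_mat n n" "C \<in> carrier_mat n n" "D \<in> carrier_mat n n"
    and \<Phi>: "\<And>X. X \<in> carrier_mat n n \<Longrightarrow> \<Phi> X \<in> carrier_mat m m"
  shows "id_tensor 2 n m \<Phi> (four_block_mat A B C D) = four_block_mat (\<Phi> A) (\<Phi> B) (\<Phi> C) (\<Phi> D)"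
proof (rule eq_matI)
  let ?Y = "four_block_mat A B C D"
  note cp = \<Phi>[OF c(1)] \<Phi>[OF c(2)] \<Phi>[OF c(3)] \<Phi>[OF c(4)]
  have b: "mat n n (($$) ?Y) = A" "mat n n (\<lambda>(u, v). ?Y $$ (u, n + v)) = B"
    "mat n n (\<lambda>(u, v). ?Y $$ (n + u, v)) = C" "mat n n (\<lambda>(u, v). ?Y $$ (n + u, n + v)) = D"
    using c by (auto intro!: eq_matI)
  fix r s assume "r < dim_row (four_block_mat (\<Phi> A) (\<Phi> B) (\<Phi> C) (\<Phi> D))" "s < dim_col (four_block_mat (\<Phi> A) (\<Phi> B) (\<Phi> C) (\<Phi> D))"
  then have rs: "r < m + m" "s < m + m" using cp by auto
  have div: "x div m = (if x < m then 0 else 1) \<and> x mod m = (if x < m then x else x - m)" if "x < m + m" for x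
    using that by (auto simp: div_if mod_if)
  note dr = div[OF rs(1)] and ds = div[OF rs(2)]
  show "id_tensor 2 n m \<Phi> ?Y $$ (r, s) = four_block_mat (\<Phi> A) (\<Phi> B) (\<Phi> C) (\<Phi> D) $$ (r, s)"
    using rs cp dr ds by (cases "r < m"; cases "s < m") (simp_all add: id_tensor_def b del: index_mat_four_block(1), simp_all)
qed (use \<Phi>[OF c(1)] \<Phi>[OF c(4)] in \<open>auto simp: id_tensor_def\<close>)

text \<open>In matrix notation \<open>X G\<close>, \<open>G\<^sup>* X\<close> and \<open>G\<^sup>* X G\<close>. Together with \<open>X\<close> they form the positive block matrix
  to which two-positivity is applied.\<close>

definition lmul :: "nat \<Rightarrow> complex mat \<Rightarrow> cker \<Rightarrow> complex mat" where
  "lmul n X G = mat n n (\<lambda>(r, s). \<Sum>t<n. X $$ (r, t) * G t s)"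

definition rmul :: "nat \<Rightarrow> complex mat \<Rightarrow> cker \<Rightarrow> complex mat" where
  "rmul n X G = mat n n (\<lambda>(r, s). \<Sum>t<n. cnj (G t r) * X $$ (t, s))"

definition cmul :: "nat \<Rightarrow> complex mat \<Rightarrow> cker \<Rightarrow> complex mat" where
  "cmul n X G = mat n n (\<lambda>(r, s). bil n (ent X) (\<lambda>t. G t r) (\<lambda>t. G t s))"

lemma mul_carrier [simp]:
  "lmul n X G \<in> carrier_mat n n" "rmul n X G \<in> carrier_mat n n" "cmul n X G \<in> carrier_mat n n"
  by (auto simp: lmul_def rmul_def cmul_def)

lemma bil_sum_right: "bil n X u (\<lambda>r. \<Sum>i\<in>I. c i * w i r) = (\<Sum>i\<in>I. c i * bil n X u (w i))"
proof -
  have "bil n X u (\<lambda>r. \<Sum>i\<in>I. c i * w i r) = (\<Sum>r<n. \<Sum>s<n. \<Sum>i\<in>I. c i * (cnj (u r) * X r s * w i s))"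
    by (simp add: bil_def sum_distrib_left mult_ac)
  also have "\<dots> = (\<Sum>i\<in>I. \<Sum>r<n. \<Sum>s<n. c i * (cnj (u r) * X r s * w i s))"
    by (rule sum_rotate)
  finally show ?thesis by (simp add: bil_def sum_distrib_left)
qed

lemma bil_sum_left: "bil n X (\<lambda>r. \<Sum>i\<in>I. c i * w i r) v = (\<Sum>i\<in>I. cnj (c i) * bil n X (w i) v)"
proof -
  have "bil n X (\<lambda>r. \<Sum>i\<in>I. c i * w i r) v = (\<Sum>r<n. \<Sum>s<n. \<Sum>i\<in>I. cnj (c i) * (cnj (w i r) * X r s * v s))"
    by (simp add: bil_def sum_distrib_left sum_distrib_right mult_ac)
  also have "\<dots> = (\<Sum>i\<in>I. \<Sum>r<n. \<Sum>s<n. cnj (c i) * (cnj (w i r) * X r s * v s))"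
    by (rule sum_rotate)
  finally show ?thesis by (simp add: bil_def sum_distrib_left)
qed

lemma bil_add_left: "bil n X (\<lambda>r. u r + u' r) v = bil n X u v + bil n X u' v"
  and bil_add_right: "bil n X u (\<lambda>r. v r + v' r) = bil n X u v + bil n X u v'"
  by (simp_all add: bil_def sum.distrib algebra_simps)

lemma bil_lmul: "bil n (ent (lmul n X G)) u v = bil n (ent X) u (\<lambda>r. \<Sum>s<n. v s * G r s)"
proof -
  have "bil n (ent (lmul n X G)) u v = (\<Sum>r<n. \<Sum>s<n. \<Sum>t<n. cnj (u r) * X $$ (r, t) * (v s * G t s))"
    by (simp add: bil_def lmul_def sum_distrib_left sum_distrib_right mult_ac)
  also have "\<dots> = (\<Sum>r<n. \<Sum>t<n. \<Sum>s<n. cnj (u r) * X $$ (r, t) * (v s * G t s))"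
    by (rule sum.cong[OF refl], rule sum.swap)
  finally show ?thesis by (simp add: bil_def sum_distrib_left)
qed

lemma bil_rmul: "bil n (ent (rmul n X G)) u v = bil n (ent X) (\<lambda>r. \<Sum>s<n. u s * G r s) v"
proof -
  have "bil n (ent (rmul n X G)) u v = (\<Sum>r<n. \<Sum>s<n. \<Sum>t<n. cnj (u r * G t r) * X $$ (t, s) * v s)"
    by (simp add: bil_def rmul_def sum_distrib_left sum_distrib_right mult_ac)
  also have "\<dots> = (\<Sum>t<n. \<Sum>r<n. \<Sum>s<n. cnj (u r * G t r) * X $$ (t, s) * v s)"
    by (rule sum_rotate)
  also have "\<dots> = (\<Sum>t<n. \<Sum>s<n. \<Sum>r<n. cnj (u r * G t r) * X $$ (t, s) * v s)"
    by (rule sum.cong[OF refl], rule sum.swap)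
  finally show ?thesis by (simp add: bil_def sum_distrib_left sum_distrib_right)
qed

lemma bil_cmul: "bil n (ent (cmul n X G)) u v
   = bil n (ent X) (\<lambda>r. \<Sum>s<n. u s * G r s) (\<lambda>r. \<Sum>s<n. v s * G r s)"
proof -
  have "bil n (ent (cmul n X G)) u v
    = (\<Sum>r<n. \<Sum>s<n. cnj (u r) * bil n (ent X) (\<lambda>t. G t r) (\<lambda>t. G t s) * v s)"
    unfolding bil_def[of n "\<lambda>r s. cmul n X G $$ (r, s)"] by (simp add: cmul_def)
  then show ?thesis
    unfolding bil_sum_left bil_sum_right by (simp add: sum_distrib_left mult_ac)
qed

text \<open>The form of the block matrix at a pair of vectors \<open>(v, v')\<close> is the form of
  \<open>X\<close> at \<open>v + G v'\<close>.\<close>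

lemma psd_schur_block:
  assumes "psd n X"
  shows "psd (2 * n) (four_block_mat X (lmul n X G) (rmul n X G) (cmul n X G))"
  unfolding psd_iff_qf
proof (intro conjI allI)
  have X: "X \<in> carrier_mat n n" using assms by (rule psd_carrier)
  show "four_block_mat X (lmul n X G) (rmul n X G) (cmul n X G) \<in> carrier_mat (2 * n) (2 * n)"
    using X by (simp add: mult_2)
  fix v
  let ?w = "\<lambda>r. v r + (\<Sum>s<n. v (n + s) * G r s)"
  have "qf (2 * n) (four_block_mat X (lmul n X G) (rmul n X G) (cmul n X G)) v = qf n X ?w"
    unfolding bil_four_block[OF X mul_carrier] bil_lmul bil_rmul bil_cmul bil_add_left bil_add_right by simp
  then show "qf (2 * n) (four_block_mat X (lmul n X G) (rmul n X G) (cmul n X G)) v \<in> \<real>"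
    "0 \<le> Re (qf (2 * n) (four_block_mat X (lmul n X G) (rmul n X G) (cmul n X G)) v)"
    using assms by (auto simp: psd_iff_qf)
qed

lemma qmap_carrier: "qmap n m \<Phi> \<Longrightarrow> X \<in> carrier_mat n n \<Longrightarrow> \<Phi> X \<in> carrier_mat m m"
  by (auto simp: qmap_def lin_map_def)

abbreviation schur_block :: "nat \<Rightarrow> (complex mat \<Rightarrow> complex mat) \<Rightarrow> complex mat \<Rightarrow> cker \<Rightarrow> complex mat" where
  "schur_block n \<Phi> X G \<equiv> four_block_mat (\<Phi> X) (\<Phi> (lmul n X G)) (\<Phi> (rmul n X G)) (\<Phi> (cmul n X G))"

lemma qmap_schur_block:
  assumes "qmap n m \<Phi>" "psd n X"
  shows "psd (2 * m) (schur_block n \<Phi> X G)"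
proof -
  have "psd (2 * m) (id_tensor 2 n m \<Phi> (four_block_mat X (lmul n X G) (rmul n X G) (cmul n X G)))"
    using assms psd_schur_block by (auto simp: qmap_def)
  then show ?thesis
    by (subst (asm) id_tensor_four_block) (use qmap_carrier[OF assms(1)] psd_carrier[OF assms(2)] in auto)
qed

lemma qmap_adjoint_block:
  assumes "qmap n m \<Phi>" "psd n X" "r < m" "s < m"
  shows "\<Phi> (rmul n X G) $$ (s, r) = cnj (\<Phi> (lmul n X G) $$ (r, s))"
proof -
  note c = qmap_carrier[OF assms(1)]
  have "schur_block n \<Phi> X G $$ (m + s, r)
     = cnj (schur_block n \<Phi> X G $$ (r, m + s))"
    by (rule psd_hermitian[OF qmap_schur_block[OF assms(1,2)]]) (use assms in auto)
  then show ?thesis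
    using assms c[OF psd_carrier[OF assms(2)]] c[OF mul_carrier(1), of X G] c[OF mul_carrier(2), of X G] c[OF mul_carrier(3), of X G]
    by simp
qed

lemma qmap_psd:
  assumes "qmap n m \<Phi>" "psd n X"
  shows "psd m (\<Phi> X)"
  unfolding psd_iff_qf
proof (intro conjI allI)
  note c = qmap_carrier[OF assms(1)]
  note X = psd_carrier[OF assms(2)]
  show "\<Phi> X \<in> carrier_mat m m" using c X .
  fix v :: cvec
  let ?G = "\<lambda>r s. 0 :: complex"
  let ?v = "\<lambda>r. if r < m then v r else 0"
  have e: "qf (2 * m) (schur_block n \<Phi> X ?G) ?v = qf m (\<Phi> X) v"
    unfolding bil_four_block[OF c[OF X] c[OF mul_carrier(1)] c[OF mul_carrier(2)] c[OF mul_carrier(3)]]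
    by (simp add: bil_def)
  note p = qmap_schur_block[OF assms, unfolded psd_iff_qf, THEN conjunct2, rule_format, of ?G ?v, unfolded e]
  show "qf m (\<Phi> X) v \<in> \<real>" "Re (qf m (\<Phi> X) v) \<ge> 0"
    using p by auto
qed

text \<open>The image of the block matrix is tested on vectors with upper half \<open>z s\<close>
  and lower half minus the unit vector \<open>s\<close>, summed over \<open>s\<close>. The lower
  right block then contributes its trace, which \<open>\<Phi>\<close> preserves and which equals
  \<open>LN n X G\<close>.\<close>

lemma qmap_block_ineq:
  assumes "qmap n m \<Phi>" "psd n X"
  shows "2 * Re (\<Sum>s<m. \<Sum>r<m. cnj (z s r) * \<Phi> (lmul n X G) $$ (r, s))
     \<le> (\<Sum>s<m. Re (qf m (\<Phi> X) (z s))) + LN n X G"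
proof -
  note c = qmap_carrier[OF assms(1)]
  note X = psd_carrier[OF assms(2)]
  let ?F = "schur_block n \<Phi> X G"
  define v where "v s r = (if r < m then z s r else if r = m + s then - 1 else 0)" for s r
  have q: "qf (2 * m) ?F (v s) = qf m (\<Phi> X) (z s) - (\<Sum>r<m. cnj (z s r) * \<Phi> (lmul n X G) $$ (r, s))
      - cnj (\<Sum>r<m. cnj (z s r) * \<Phi> (lmul n X G) $$ (r, s)) + \<Phi> (cmul n X G) $$ (s, s)" if s: "s < m" for s
  proof -
    have d: "(\<Sum>x<m. f x * (if x = s then - 1 else 0)) = - (f s :: complex)" for f
      using s by (simp add: if_distrib[of "\<lambda>z. _ * z"] cong: if_cong)
    have d': "(\<Sum>x<m. (if x = s then - 1 else 0) * f x) = - (f s :: complex)" for f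
      using s by (simp add: if_distrib[of "\<lambda>z. z * _"] cong: if_cong)
    have 1: "bil m (ent (\<Phi> X)) (v s) (v s) = qf m (\<Phi> X) (z s)"
      by (simp add: bil_def v_def)
    have 2: "bil m (ent B) (v s) (\<lambda>r. v s (m + r)) = - (\<Sum>r<m. cnj (z s r) * B $$ (r, s))" for B
      by (simp add: bil_def v_def d sum_negf)
    have 3: "bil m (ent B) (\<lambda>r. v s (m + r)) (v s) = - (\<Sum>r<m. B $$ (s, r) * z s r)" for B
      by (simp add: bil_def v_def if_distrib[of cnj] mult.assoc sum_distrib_left[symmetric] d' cong: if_cong)
    have 4: "bil m (ent B) (\<lambda>r. v s (m + r)) (\<lambda>r. v s (m + r)) = B $$ (s, s)" for B
      by (simp add: bil_def v_def if_distrib[of cnj] d mult.assoc d' sum_negf sum_distrib_left[symmetric] cong: if_cong)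
    have 5: "(\<Sum>r<m. \<Phi> (rmul n X G) $$ (s, r) * z s r) = cnj (\<Sum>r<m. cnj (z s r) * \<Phi> (lmul n X G) $$ (r, s))"
      unfolding cnj_sum using qmap_adjoint_block[OF assms] s by (intro sum.cong) auto
    show ?thesis
      unfolding bil_four_block[OF c[OF X] c[OF mul_carrier(1)] c[OF mul_carrier(2)] c[OF mul_carrier(3)]] 1 2 3 4 5 by simp
  qed
  have qR: "Re (qf (2 * m) ?F (v s)) = Re (qf m (\<Phi> X) (z s))
      - 2 * Re (\<Sum>r<m. cnj (z s r) * \<Phi> (lmul n X G) $$ (r, s)) + Re (\<Phi> (cmul n X G) $$ (s, s))" if "s < m" for s
    unfolding q[OF that] by (simp only: minus_complex.sel plus_complex.sel cnj.sel)
  have "0 \<le> (\<Sum>s<m. Re (qf (2 * m) ?F (v s)))"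
    using qmap_schur_block[OF assms] by (intro sum_nonneg) (auto simp: psd_iff_qf)
  also have "\<dots> = (\<Sum>s<m. Re (qf m (\<Phi> X) (z s))) - 2 * Re (\<Sum>s<m. \<Sum>r<m. cnj (z s r) * \<Phi> (lmul n X G) $$ (r, s))
      + Re (\<Sum>s<m. \<Phi> (cmul n X G) $$ (s, s))"
    unfolding Re_sum[of _ "{..<m}", symmetric] by (simp add: qR sum.distrib sum_subtractf flip: sum_distrib_left)
  also have "(\<Sum>s<m. \<Phi> (cmul n X G) $$ (s, s)) = mtrace (\<Phi> (cmul n X G))"
    using c[OF mul_carrier(3), of X G] by (simp add: mtrace_def)
  also have "mtrace (\<Phi> (cmul n X G)) = mtrace (cmul n X G)"
    using assms(1) by (auto simp: qmap_def)
  also have "Re (mtrace (cmul n X G)) = LN n X G"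
    by (simp add: mtrace_def cmul_def LN_def)
  finally show ?thesis by simp
qed

text \<open>Expansion in matrix units. \<open>lin_map\<close> combines two matrices at a time, hence
  the induction over the set of entries already filled in.\<close>

lemma qmap_functional_linear:
  assumes "lin_map n m \<Phi>" "X \<in> carrier_mat n n"
  shows "hs m Z (ent (\<Phi> X)) =
    (\<Sum>u<n. \<Sum>v<n. X $$ (u, v) * hs m Z (\<lambda>r s. \<Phi> (mat n n (\<lambda>(x, y). if x = u \<and> y = v then 1 else 0)) $$ (r, s)))"
proof -
  define L where "L X = hs m Z (ent (\<Phi> X))" for X
  have L: "L (a \<cdot>\<^sub>m X + b \<cdot>\<^sub>m Y) = a * L X + b * L Y" if "X \<in> carrier_mat n n" "Y \<in> carrier_mat n n" for X Y a b
  proof -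
    have c: "\<Phi> X \<in> carrier_mat m m" "\<Phi> Y \<in> carrier_mat m m"
      and e: "\<Phi> (a \<cdot>\<^sub>m X + b \<cdot>\<^sub>m Y) = a \<cdot>\<^sub>m \<Phi> X + b \<cdot>\<^sub>m \<Phi> Y"
      using assms that by (auto simp: lin_map_def)
    have "L (a \<cdot>\<^sub>m X + b \<cdot>\<^sub>m Y) = hs m Z (\<lambda>r s. a * \<Phi> X $$ (r, s) + b * \<Phi> Y $$ (r, s))"
      unfolding L_def e hs_def using c by (intro sum.cong refl) auto
    then show ?thesis by (simp add: L_def hs_def sum.distrib sum_distrib_left algebra_simps)
  qed
  define E where "E u v = (mat n n (\<lambda>(x, y). if x = u \<and> y = v then 1 else 0) :: complex mat)" for u v
  define P where "P S = mat n n (\<lambda>(x, y). if (x, y) \<in> S then X $$ (x, y) else 0)" for S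
  have P: "L (P S) = (\<Sum>(u, v)\<in>S. X $$ (u, v) * L (E u v))" if "finite S" "S \<subseteq> {..<n} \<times> {..<n}" for S
    using that
  proof (induction S)
    case empty
    have "P {} = 0 \<cdot>\<^sub>m P {} + 0 \<cdot>\<^sub>m P {}" by (intro eq_matI) (auto simp: P_def)
    then show ?case using L[of "P {}" "P {}" 0 0] by (simp add: P_def)
  next
    case (insert p S)
    obtain u v where p: "p = (u, v)" by (cases p)
    have "P (insert p S) = 1 \<cdot>\<^sub>m P S + X $$ (u, v) \<cdot>\<^sub>m E u v"
      using insert by (intro eq_matI) (auto simp: P_def E_def p)
    then have "L (P (insert p S)) = 1 * L (P S) + X $$ (u, v) * L (E u v)"
      using L[of "P S" "E u v" 1 "X $$ (u, v)"] by (simp add: P_def E_def)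
    then show ?case using insert by (simp add: p add.commute)
  qed
  have "P ({..<n} \<times> {..<n}) = X" using assms by (intro eq_matI) (auto simp: P_def)
  then have "L X = (\<Sum>(u, v)\<in>{..<n} \<times> {..<n}. X $$ (u, v) * L (E u v))"
    using P[of "{..<n} \<times> {..<n}"] by simp
  then show ?thesis by (simp add: L_def E_def sum.cartesian_product)
qed

lemma hs_cong: "(\<And>r s. r < n \<Longrightarrow> s < n \<Longrightarrow> Y r s = Y' r s) \<Longrightarrow> hs n W Y = hs n W Y'"
  unfolding hs_def by (intro sum.cong) auto

text \<open>\<open>W\<close> is the adjoint image of \<open>Z\<close>. With \<open>G = W\<close> in
  \<open>qmap_block_ineq\<close>, duality turns the cross term into \<open>LN n X W\<close>, so
  twice this number is at most \<open>LN m (\<Phi> X) Z + LN n X W\<close>. The bound on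
  \<open>RN\<close> arises likewise from the adjoint kernel of \<open>W\<close>.\<close>

lemma qmap_imp_schwarz:
  assumes \<Phi>: "qmap n m \<Phi>"
  shows "schwarz n m \<Phi>"
  unfolding schwarz_def
proof (intro conjI allI impI ballI)
  fix X :: "complex mat" assume X: "psd n X"
  show "psd m (\<Phi> X)" using qmap_psd[OF \<Phi> X] .
  show "mtrace (\<Phi> X) = mtrace X" using \<Phi> psd_carrier[OF X] by (auto simp: qmap_def)
next
  fix X :: "complex mat" assume "X \<in> carrier_mat n n"
  then show "\<Phi> X \<in> carrier_mat m m" by (rule qmap_carrier[OF \<Phi>])
next
  fix Z
  define W where "W u v = cnj (hs m Z (\<lambda>r s. \<Phi> (mat n n (\<lambda>(x, y). if x = u \<and> y = v then 1 else 0)) $$ (r, s)))" for u v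
  have W: "hs n W (ent X) = hs m Z (ent (\<Phi> X))" if "X \<in> carrier_mat n n" for X
  proof -
    have "lin_map n m \<Phi>" using \<Phi> by (simp add: qmap_def)
    from qmap_functional_linear[OF this that] show ?thesis
      by (simp add: hs_def[of n] W_def mult.commute)
  qed
  have L: "LN n X W \<le> LN m (\<Phi> X) Z" if X: "psd n X" for X
  proof -
    have "(\<Sum>s<m. \<Sum>r<m. cnj (Z r s) * \<Phi> (lmul n X W) $$ (r, s)) = hs m Z (ent (\<Phi> (lmul n X W)))"
      unfolding hs_def by (rule sum.swap)
    also have "\<dots> = hs n W (ent (lmul n X W))"
      by (rule W[symmetric]) simp
    also have "\<dots> = (\<Sum>s<n. qf n X (\<lambda>r. W r s))"
      unfolding hs_def bil_def by (subst sum.swap) (simp add: lmul_def sum_distrib_left mult_ac)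
    finally show ?thesis
      using qmap_block_ineq[OF \<Phi> X, of "\<lambda>s r. Z r s" W] by (simp add: LN_def)
  qed
  have R: "RN n X W \<le> RN m (\<Phi> X) Z" if X: "psd n X" for X
  proof -
    let ?G = "\<lambda>s r. cnj (W r s)"
    have "(\<Sum>s<m. \<Sum>r<m. cnj (cnj (Z s r)) * \<Phi> (lmul n X ?G) $$ (r, s)) = cnj (hs m Z (ent (\<Phi> (rmul n X ?G))))"
      unfolding hs_def cnj_sum by (intro sum.cong refl) (use qmap_adjoint_block[OF \<Phi> X] in auto)
    also have "hs m Z (ent (\<Phi> (rmul n X ?G))) = hs n W (ent (rmul n X ?G))"
      by (rule W[symmetric]) simp
    also have "\<dots> = (\<Sum>r<n. \<Sum>s<n. \<Sum>t<n. cnj (W r s) * (W r t * X $$ (t, s)))"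
      by (simp add: hs_def rmul_def sum_distrib_left)
    also have "\<dots> = (\<Sum>r<n. \<Sum>t<n. \<Sum>s<n. cnj (W r s) * (W r t * X $$ (t, s)))"
      by (rule sum.cong[OF refl], rule sum.swap)
    also have "\<dots> = (\<Sum>r<n. qf n X (\<lambda>s. cnj (W r s)))"
      by (simp add: bil_def mult_ac)
    finally show ?thesis
      using qmap_block_ineq[OF \<Phi> X, of "\<lambda>s r. cnj (Z s r)" ?G] by (simp add: LN_def RN_def)
  qed
  show "\<exists>W. (\<forall>X\<in>carrier_mat n n. hs n W (ent X) = hs m Z (ent (\<Phi> X))) \<and>
        (\<forall>X. psd n X \<longrightarrow> LN n X W \<le> LN m (\<Phi> X) Z \<and> RN n X W \<le> RN m (\<Phi> X) Z)"
    using W L R by blast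
qed

lemma schwarz_comp:
  assumes "schwarz n m \<Phi>" "schwarz m l \<Psi>"
  shows "schwarz n l (\<lambda>X. \<Psi> (\<Phi> X))"
  unfolding schwarz_def
proof (intro conjI allI impI ballI)
  fix X :: "complex mat" assume X: "psd n X"
  show "psd l (\<Psi> (\<Phi> X))" "mtrace (\<Psi> (\<Phi> X)) = mtrace X"
    using assms X by (simp_all add: schwarz_psd schwarz_trace)
next
  fix X :: "complex mat" assume "X \<in> carrier_mat n n"
  then show "\<Psi> (\<Phi> X) \<in> carrier_mat l l" using assms by (simp add: schwarz_def)
next
  fix Z
  obtain V where V: "\<forall>X\<in>carrier_mat m m. hs m V (ent X) = hs l Z (\<lambda>r s. \<Psi> X $$ (r, s))"
        "\<forall>X. psd m X \<longrightarrow> LN m X V \<le> LN l (\<Psi> X) Z \<and> RN m X V \<le> RN l (\<Psi> X) Z"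
    using assms(2) unfolding schwarz_def by blast
  obtain W where W: "\<forall>X\<in>carrier_mat n n. hs n W (ent X) = hs m V (ent (\<Phi> X))"
        "\<forall>X. psd n X \<longrightarrow> LN n X W \<le> LN m (\<Phi> X) V \<and> RN n X W \<le> RN m (\<Phi> X) V"
    using assms(1) unfolding schwarz_def by blast
  show "\<exists>W. (\<forall>X\<in>carrier_mat n n. hs n W (ent X) = hs l Z (\<lambda>r s. \<Psi> (\<Phi> X) $$ (r, s))) \<and>
        (\<forall>X. psd n X \<longrightarrow> LN n X W \<le> LN l (\<Psi> (\<Phi> X)) Z \<and> RN n X W \<le> RN l (\<Psi> (\<Phi> X)) Z)"
  proof (intro exI[of _ W] conjI allI impI ballI)
    fix X :: "complex mat" assume "X \<in> carrier_mat n n"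
    moreover from this have "\<Phi> X \<in> carrier_mat m m" using assms(1) by (simp add: schwarz_def)
    ultimately show "hs n W (ent X) = hs l Z (\<lambda>r s. \<Psi> (\<Phi> X) $$ (r, s))"
      using V(1) W(1) by simp
  next
    fix X :: "complex mat" assume X: "psd n X"
    have "psd m (\<Phi> X)" using schwarz_psd[OF assms(1) X] .
    then show "LN n X W \<le> LN l (\<Psi> (\<Phi> X)) Z" "RN n X W \<le> RN l (\<Psi> (\<Phi> X)) Z"
      using V(2) W(2) X order_trans by blast+
  qed
qed

section \<open>Maps given by Kraus operators\<close>

definition kraus :: "nat \<Rightarrow> nat \<Rightarrow> 'a set \<Rightarrow> ('a \<Rightarrow> nat \<Rightarrow> nat \<Rightarrow> complex) \<Rightarrow> complex mat \<Rightarrow> complex mat" where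
  "kraus n m A K X = mat m m (\<lambda>(r, s). \<Sum>a\<in>A. bil n (ent X) (\<lambda>u. cnj (K a r u)) (\<lambda>v. cnj (K a s v)))"

lemma bil_kraus: "bil m (ent (kraus n m A K X)) x y
   = (\<Sum>a\<in>A. bil n (ent X) (\<lambda>u. \<Sum>r<m. x r * cnj (K a r u)) (\<lambda>u. \<Sum>r<m. y r * cnj (K a r u)))"
proof -
  let ?b = "\<lambda>a r s. bil n (ent X) (\<lambda>u. cnj (K a r u)) (\<lambda>v. cnj (K a s v))"
  have "bil m (ent (kraus n m A K X)) x y = (\<Sum>r<m. \<Sum>s<m. \<Sum>a\<in>A. cnj (x r) * ?b a r s * y s)"
    by (simp add: bil_def[of m] kraus_def sum_distrib_left sum_distrib_right)
  also have "\<dots> = (\<Sum>a\<in>A. \<Sum>r<m. \<Sum>s<m. cnj (x r) * ?b a r s * y s)"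
    by (rule sum_rotate)
  finally show ?thesis
    unfolding bil_sum_left bil_sum_right by (simp add: sum_distrib_left mult_ac)
qed

text \<open>The assumption, unitality of the adjoint, is trace preservation of the map. For
  two-positivity, the form of the image at \<open>w\<close> is a sum of forms of \<open>Y\<close> at
  vectors obtained by pulling back the two halves of \<open>w\<close> separately.\<close>

lemma kraus_schwarz:
  assumes unital: "\<And>u v. u < n \<Longrightarrow> v < n \<Longrightarrow> (\<Sum>a\<in>A. \<Sum>r<m. cnj (K a r u) * K a r v) = (if u = v then 1 else 0)"
  shows "schwarz n m (kraus n m A K)"
proof (rule qmap_imp_schwarz, unfold qmap_def, intro conjI ballI allI impI)
  have c: "kraus n m A K X \<in> carrier_mat m m" for X by (simp add: kraus_def)
  have lin: "bil n (\<lambda>u v. (a \<cdot>\<^sub>m X + b \<cdot>\<^sub>m Y) $$ (u, v)) x y = a * bil n (ent X) x y + b * bil n (ent Y) x y"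
    if "X \<in> carrier_mat n n" "Y \<in> carrier_mat n n" for a b X Y x y
  proof -
    have "bil n (\<lambda>u v. (a \<cdot>\<^sub>m X + b \<cdot>\<^sub>m Y) $$ (u, v)) x y = (\<Sum>u<n. \<Sum>v<n. cnj (x u) * (a * X $$ (u, v) + b * Y $$ (u, v)) * y v)"
      unfolding bil_def using that by (intro sum.cong refl) auto
    then show ?thesis by (simp add: bil_def sum.distrib sum_distrib_left algebra_simps)
  qed
  show "lin_map n m (kraus n m A K)"
    unfolding lin_map_def
  proof (intro conjI ballI allI)
    fix X Y :: "complex mat" and a b assume XY: "X \<in> carrier_mat n n" "Y \<in> carrier_mat n n"
    show "kraus n m A K (a \<cdot>\<^sub>m X + b \<cdot>\<^sub>m Y) = a \<cdot>\<^sub>m kraus n m A K X + b \<cdot>\<^sub>m kraus n m A K Y"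
      unfolding kraus_def by (intro eq_matI) (simp_all add: lin[OF XY] sum.distrib sum_distrib_left)
  qed (rule c)
  show "mtrace (kraus n m A K X) = mtrace X" if X: "X \<in> carrier_mat n n" for X
  proof -
    let ?t = "\<lambda>a r u v. X $$ (u, v) * (cnj (K a r v) * K a r u)"
    have "mtrace (kraus n m A K X) = (\<Sum>r<m. \<Sum>a\<in>A. \<Sum>u<n. \<Sum>v<n. ?t a r u v)"
      by (simp add: mtrace_def kraus_def bil_def mult_ac)
    also have "\<dots> = (\<Sum>a\<in>A. \<Sum>r<m. \<Sum>u<n. \<Sum>v<n. ?t a r u v)"
      by (rule sum.swap)
    also have "\<dots> = (\<Sum>a\<in>A. \<Sum>u<n. \<Sum>v<n. \<Sum>r<m. ?t a r u v)"
      by (rule sum.cong[OF refl], subst sum.swap, rule sum.cong[OF refl], rule sum.swap)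
    also have "\<dots> = (\<Sum>u<n. \<Sum>v<n. \<Sum>a\<in>A. \<Sum>r<m. ?t a r u v)"
      by (subst sum.swap, rule sum.cong[OF refl], rule sum.swap)
    also have "\<dots> = (\<Sum>u<n. \<Sum>v<n. X $$ (u, v) * (if v = u then 1 else 0))"
      by (intro sum.cong refl) (simp add: unital flip: sum_distrib_left)
    also have "\<dots> = mtrace X"
      using X by (simp add: mtrace_def if_distrib[of "\<lambda>z. _ * z"] cong: if_cong)
    finally show ?thesis .
  qed
  fix Y assume Y: "psd (2 * n) Y"
  define B1 where "B1 = mat n n (\<lambda>(r, s). Y $$ (r, s))"
  define B2 where "B2 = mat n n (\<lambda>(r, s). Y $$ (r, n + s))"
  define B3 where "B3 = mat n n (\<lambda>(r, s). Y $$ (n + r, s))"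
  define B4 where "B4 = mat n n (\<lambda>(r, s). Y $$ (n + r, n + s))"
  have cB: "B1 \<in> carrier_mat n n" "B2 \<in> carrier_mat n n" "B3 \<in> carrier_mat n n" "B4 \<in> carrier_mat n n"
    by (auto simp: B1_def B2_def B3_def B4_def)
  have YB: "Y = four_block_mat B1 B2 B3 B4"
    unfolding B1_def B2_def B3_def B4_def using four_block_of_blocks[OF psd_carrier[OF Y]] .
  show "psd (2 * m) (id_tensor 2 n m (kraus n m A K) Y)"
    unfolding psd_iff_qf
  proof (intro conjI allI)
    show "id_tensor 2 n m (kraus n m A K) Y \<in> carrier_mat (2 * m) (2 * m)" by (simp add: id_tensor_def)
    fix w
    let ?x = "\<lambda>a u. \<Sum>r<m. w r * cnj (K a r u)"
    let ?y = "\<lambda>a u. \<Sum>r<m. w (m + r) * cnj (K a r u)"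
    let ?v = "\<lambda>a x. if x < n then ?x a x else ?y a (x - n)"
    have "qf (2 * m) (id_tensor 2 n m (kraus n m A K) Y) w = (\<Sum>a\<in>A. qf (2 * n) Y (?v a))"
    proof -
      have v: "bil n B (?v a) (?v a) = bil n B (?x a) (?x a)"
        "bil n B (?v a) (\<lambda>r. ?v a (n + r)) = bil n B (?x a) (?y a)"
        "bil n B (\<lambda>r. ?v a (n + r)) (?v a) = bil n B (?y a) (?x a)"
        "bil n B (\<lambda>r. ?v a (n + r)) (\<lambda>r. ?v a (n + r)) = bil n B (?y a) (?y a)" for B a
        by (simp_all add: bil_def)
      show ?thesis
        unfolding YB id_tensor_four_block[OF cB c] bil_four_block[OF c c c c] bil_four_block[OF cB] bil_kraus v
        by (simp add: sum.distrib)
    qed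
    then show "qf (2 * m) (id_tensor 2 n m (kraus n m A K) Y) w \<in> \<real>"
      "0 \<le> Re (qf (2 * m) (id_tensor 2 n m (kraus n m A K) Y) w)"
      using Y by (auto simp: psd_iff_qf intro!: sum_nonneg sum_in_Reals)
  qed
qed

section \<open>Continuity of the entropy\<close>

lemma log_less_0I: "0 < x \<Longrightarrow> x \<le> 1 \<Longrightarrow> log 2 x \<le> 0"
  by simp

lemma cmod_onb_le_1:
  assumes "onb n T V" "j \<in> T" "r < n"
  shows "cmod (V j r) \<le> 1"
proof -
  have "(\<Sum>r<n. nsq (V j r)) = 1" using onb_unit[OF assms(1,2)] .
  moreover have "nsq (V j r) \<le> (\<Sum>r<n. nsq (V j r))"
    using assms(3) by (intro member_le_sum) auto
  ultimately show ?thesis by (simp add: power_le_one_iff abs_le_square_iff[of _ 1, simplified])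
qed

text \<open>The components of a unit vector have modulus at most 1. The crude entrywise distance is
  good enough because the constants may depend on the dimension.\<close>

lemma qf_diff_le:
  assumes "onb n T V" "j \<in> T"
  shows "\<bar>Re (qf n A (V j)) - Re (qf n B (V j))\<bar> \<le> (\<Sum>r<n. \<Sum>s<n. cmod (A $$ (r, s) - B $$ (r, s)))"
proof -
  have "Re (qf n A (V j)) - Re (qf n B (V j)) = Re (\<Sum>r<n. \<Sum>s<n. cnj (V j r) * (A $$ (r, s) - B $$ (r, s)) * V j s)"
    by (simp add: bil_def sum_subtractf algebra_simps)
  also have "\<bar>\<dots>\<bar> \<le> cmod (\<Sum>r<n. \<Sum>s<n. cnj (V j r) * (A $$ (r, s) - B $$ (r, s)) * V j s)"
    by (rule abs_Re_le_cmod)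
  also have "\<dots> \<le> (\<Sum>r<n. \<Sum>s<n. cmod (cnj (V j r) * (A $$ (r, s) - B $$ (r, s)) * V j s))"
    by (rule order_trans[OF norm_sum sum_mono], rule norm_sum)
  also have "\<dots> \<le> (\<Sum>r<n. \<Sum>s<n. cmod (A $$ (r, s) - B $$ (r, s)))"
  proof (intro sum_mono)
    fix r s assume rs: "r \<in> {..<n}" "s \<in> {..<n}"
    have "cmod (V j r) * cmod (V j s) \<le> 1"
      using cmod_onb_le_1[OF assms] rs by (intro mult_le_one) auto
    then have "cmod (A $$ (r, s) - B $$ (r, s)) * (cmod (V j r) * cmod (V j s)) \<le> cmod (A $$ (r, s) - B $$ (r, s))"
      by (intro mult_left_le) auto
    then show "cmod (cnj (V j r) * (A $$ (r, s) - B $$ (r, s)) * V j s) \<le> cmod (A $$ (r, s) - B $$ (r, s))"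
      by (simp add: norm_mult mult_ac)
  qed
  finally show ?thesis .
qed

text \<open>Klein's inequality against \<open>\<sigma>\<close> mixed with a small multiple of the
  identity. The admixture costs \<open>\<delta>\<close> per unit of trace; in return the logarithms,
  relative to the trace, are bounded by \<open>L\<close>, and what remains is linear in the
  distance.\<close>

lemma entropy_continuity:
  assumes d: "d \<ge> 1" and \<delta>: "\<delta> > 0"
  shows "\<exists>K\<ge>0. \<forall>\<rho> \<sigma>. psd d \<rho> \<longrightarrow> psd d \<sigma> \<longrightarrow> mtrace \<rho> = mtrace \<sigma> \<longrightarrow>
    vn_entropy \<rho> \<le> vn_entropy \<sigma> + \<delta> * Re (mtrace \<sigma>) + K * (\<Sum>r<d. \<Sum>s<d. cmod (\<rho> $$ (r, s) - \<sigma> $$ (r, s)))"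
proof -
  \<comment> \<open>Chosen so that \<open>- log 2 (1 - \<mu>) = \<delta>\<close>: the admixture
    lowers an eigenvalue of \<open>\<sigma>\<close> by the factor \<open>1 - \<mu>\<close> at
    most.\<close>
  define \<mu> :: real where "\<mu> = 1 - 2 powr (- \<delta>)"
  have "2 powr (- \<delta>) < 2 powr 0" using \<delta> by (subst powr_less_cancel_iff) auto
  then have \<mu>: "0 < \<mu>" "\<mu> < 1" by (auto simp: \<mu>_def)
  have log\<mu>: "log 2 (1 - \<mu>) = - \<delta>" by (simp add: \<mu>_def log_powr)
  define L where "L = log 2 (d / \<mu>)"
  have "d / \<mu> \<ge> 1" using d \<mu> by (simp add: pos_le_divide_eq)
  then have L0: "L \<ge> 0" by (simp add: L_def)
  show ?thesis
  proof (intro exI[of _ "real d * L"] conjI allI impI)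
    show "real d * L \<ge> 0" using L0 by simp
    fix \<rho> \<sigma> assume \<rho>: "psd d \<rho>" and \<sigma>: "psd d \<sigma>" and tr: "mtrace \<rho> = mtrace \<sigma>"
    define W where "W = Re (mtrace \<sigma>)"
    define l1 where "l1 = (\<Sum>r<d. \<Sum>s<d. cmod (\<rho> $$ (r, s) - \<sigma> $$ (r, s)))"
    have l1: "l1 \<ge> 0" by (auto simp: l1_def intro!: sum_nonneg)
    have W0: "W \<ge> 0" using psd_trace_ge_0[OF \<sigma>] by (simp add: W_def)
    have "vn_entropy \<rho> \<le> vn_entropy \<sigma> + \<delta> * W + real d * L * l1"
    proof (cases "W = 0")
      case True
      moreover have "real d * L * l1 \<ge> 0" using L0 l1 by simp
      ultimately show ?thesis
        using vn_entropy_upper[OF \<rho> d] vn_entropy_lower[OF \<sigma>] by (simp add: tr W_def)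
    next
      case False
      then have Wp: "W > 0" using W0 by simp
      obtain V s where q: "spec d \<sigma> {..<d} V s" and s: "\<And>j. j < d \<Longrightarrow> s j \<ge> 0" using psd_spec[OF \<sigma>] by blast
      have V: "onb d {..<d} V" using specD[OF q] by simp
      have Ws: "W = (\<Sum>j<d. s j)" by (simp add: W_def spec_trace[OF q])
      \<comment> \<open>The admixture has trace \<open>\<mu> * W\<close>, so the total stays
        \<open>W\<close> and the linear remainder in Klein's inequality vanishes.\<close>
      define t where "t j = (1 - \<mu>) * s j + \<mu> * W / d" for j
      have c: "\<mu> * W / d > 0" using \<mu> Wp d by simp
      have t: "t j > 0" if "j < d" for j
        using c s[OF that] \<mu> unfolding t_def by (intro add_nonneg_pos) auto
      have sW: "s j \<le> W" if "j < d" for j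
        unfolding Ws using that s by (intro member_le_sum) auto
      have tW: "t j \<le> W" if "j < d" for j
      proof -
        have "(1 - \<mu>) * s j \<le> (1 - \<mu>) * W" using sW[OF that] \<mu> by (intro mult_left_mono) auto
        moreover have "\<mu> * W / d \<le> \<mu> * W" using divide_left_mono[of 1 "real d" "\<mu> * W"] \<mu> Wp d by simp
        ultimately show ?thesis by (simp add: t_def algebra_simps)
      qed
      define R where "R j = Re (qf d \<rho> (V j))" for j
      have "vn_entropy \<rho> \<le> (\<Sum>j<d. - R j * log 2 (t j)) + ((\<Sum>j<d. t j) - Re (mtrace \<rho>)) / ln 2"
        unfolding R_def using klein_inequality[OF \<rho> V] t by auto
      also have "(\<Sum>j<d. t j) = W"
        using d by (simp add: t_def sum.distrib Ws flip: sum_distrib_left) (simp add: algebra_simps)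
      also have "(W - Re (mtrace \<rho>)) / ln 2 = 0" by (simp add: tr W_def)
      also have "(\<Sum>j<d. - R j * log 2 (t j)) + 0 \<le> (\<Sum>j<d. eta (s j) + s j * \<delta> + (s j - R j) * log 2 W + l1 * L)"
        unfolding add_0_right
      proof (intro sum_mono)
        fix j assume "j \<in> {..<d}"
        then have j: "j < d" by simp
        \<comment> \<open>Splitting off \<open>log 2 W\<close> leaves the ratio
          \<open>t j / W\<close>, which lies between \<open>\<mu> / d\<close> and 1. The split-off
          part vanishes in the sum because both diagonals have total \<open>W\<close>.\<close>
        have e: "- R j * log 2 (t j) = - (s j * log 2 (t j)) + (s j - R j) * log 2 W + (s j - R j) * log 2 (t j / W)"
          using t[OF j] Wp by (simp add: log_divide algebra_simps)
        have 1: "- (s j * log 2 (t j)) \<le> eta (s j) + s j * \<delta>"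
        proof (cases "s j = 0")
          case False
          then have sp: "s j > 0" using s[OF j] by simp
          have "log 2 ((1 - \<mu>) * s j) \<le> log 2 (t j)"
            using sp \<mu> c by (intro log_mono) (auto simp: t_def)
          then have "s j * (- \<delta> + log 2 (s j)) \<le> s j * log 2 (t j)"
            using sp \<mu> by (intro mult_left_mono) (auto simp: log_mult log\<mu>)
          then show ?thesis using sp by (simp add: eta_def algebra_simps)
        qed simp
        have "t j / W \<ge> \<mu> / d"
        proof -
          have "\<mu> * W / d \<le> t j" using s[OF j] \<mu> by (simp add: t_def)
          then show ?thesis using Wp by (simp add: pos_le_divide_eq)
        qed
        then have "log 2 (\<mu> / d) \<le> log 2 (t j / W)" using \<mu> d t[OF j] Wp by (intro log_mono) auto
        then have "- L \<le> log 2 (t j / W)" using \<mu> d by (simp add: L_def log_divide)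
        moreover have "log 2 (t j / W) \<le> 0" using tW[OF j] t[OF j] Wp by (intro log_less_0I) auto
        ultimately have lg: "\<bar>log 2 (t j / W)\<bar> \<le> L" by simp
        have "\<bar>s j - R j\<bar> \<le> l1"
        proof -
          have "\<bar>R j - Re (qf d \<sigma> (V j))\<bar> \<le> l1"
            unfolding R_def l1_def using j by (intro qf_diff_le[OF V]) auto
          then show ?thesis using spec_qf_self[OF q, of j] j by simp
        qed
        then have "\<bar>(s j - R j) * log 2 (t j / W)\<bar> \<le> l1 * L"
          unfolding abs_mult using lg l1 by (intro mult_mono) auto
        then show "- R j * log 2 (t j) \<le> eta (s j) + s j * \<delta> + (s j - R j) * log 2 W + l1 * L"
          unfolding e using 1 by linarith
      qed
      also have "\<dots> = vn_entropy \<sigma> + W * \<delta> + ((\<Sum>j<d. s j) - (\<Sum>j<d. R j)) * log 2 W + real d * (l1 * L)"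
        by (simp add: sum.distrib spec_vn_entropy[OF q] Ws sum_subtractf flip: sum_distrib_right)
      also have "(\<Sum>j<d. R j) = W"
        using psd_trace_onb[OF \<rho> V] by (simp add: R_def tr W_def)
      finally show ?thesis by (simp add: Ws mult_ac)
    qed
    then show "vn_entropy \<rho> \<le> vn_entropy \<sigma> + \<delta> * Re (mtrace \<sigma>) + real d * L * (\<Sum>r<d. \<Sum>s<d. cmod (\<rho> $$ (r, s) - \<sigma> $$ (r, s)))"
      by (simp add: W_def l1_def)
  qed
qed

section \<open>Pure states and the distance to them\<close>

definition unit_vec_d :: "nat \<Rightarrow> complex vec \<Rightarrow> bool" where
  "unit_vec_d d v \<longleftrightarrow> v \<in> carrier_vec d \<and> (\<Sum>r<d. nsq (v $ r)) = 1"

lemma proj_entry: "v \<in> carrier_vec d \<Longrightarrow> r < d \<Longrightarrow> s < d \<Longrightarrow> proj v $$ (r, s) = v $ r * cnj (v $ s)"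
  by (auto simp: proj_def)

lemma smult_proj_entry:
  "v \<in> carrier_vec d \<Longrightarrow> r < d \<Longrightarrow> s < d \<Longrightarrow> (c \<cdot>\<^sub>m proj v) $$ (r, s) = c * (v $ r * cnj (v $ s))"
  by (auto simp: proj_def)

lemma psd_smult_proj:
  assumes v: "v \<in> carrier_vec d" and c: "c \<ge> 0"
  shows "psd d (of_real c \<cdot>\<^sub>m proj v)"
  unfolding psd_iff_qf
proof (intro conjI allI)
  show "of_real c \<cdot>\<^sub>m proj v \<in> carrier_mat d d" using v by (auto simp: proj_def)
  fix x
  have "qf d (of_real c \<cdot>\<^sub>m proj v) x = of_real c * (\<Sum>r<d. \<Sum>s<d. (cnj (x r) * v $ r) * (cnj (v $ s) * x s))"
    unfolding bil_def using v by (simp add: smult_proj_entry sum_distrib_left mult_ac)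
  also have "\<dots> = of_real c * (ip d x (\<lambda>r. v $ r) * ip d (\<lambda>r. v $ r) x)"
    by (simp add: ip_def sum_product)
  also have "\<dots> = of_real (c * nsq (ip d x (\<lambda>r. v $ r)))"
    by (simp only: of_real_mult complex_norm_square ip_cnj)
  finally have e: "qf d (of_real c \<cdot>\<^sub>m proj v) x = of_real (c * nsq (ip d x (\<lambda>r. v $ r)))" .
  show "qf d (of_real c \<cdot>\<^sub>m proj v) x \<in> \<real>" "0 \<le> Re (qf d (of_real c \<cdot>\<^sub>m proj v) x)"
    unfolding e using c by auto
qed

lemma mtrace_smult_proj:
  assumes "unit_vec_d d v"
  shows "mtrace (of_real c \<cdot>\<^sub>m proj v) = of_real c"
proof -
  have v: "v \<in> carrier_vec d" using assms by (simp add: unit_vec_d_def)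
  have "mtrace (of_real c \<cdot>\<^sub>m proj v) = of_real c * (\<Sum>r<d. v $ r * cnj (v $ r))"
    using v by (simp add: mtrace_def sum_distrib_left proj_def)
  also have "(\<Sum>r<d. v $ r * cnj (v $ r)) = of_real (\<Sum>r<d. nsq (v $ r))"
    by (simp only: of_real_sum complex_norm_square)
  also have "(\<Sum>r<d. nsq (v $ r)) = 1" using assms by (simp add: unit_vec_d_def)
  finally show ?thesis by simp
qed

lemma spec_frobenius:
  assumes "spec n A T U a"
  shows "(\<Sum>r<n. \<Sum>s<n. nsq (A $$ (r, s))) = (\<Sum>i\<in>T. (a i)\<^sup>2)"
proof -
  note o = onbD[OF specD(2)[OF assms]]
  have "complex_of_real (\<Sum>r<n. \<Sum>s<n. nsq (A $$ (r, s))) = hs n (ent A) (ent A)"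
    unfolding hs_def of_real_sum complex_norm_square by (simp add: mult.commute)
  also have "\<dots> = (\<Sum>i\<in>T. \<Sum>j\<in>T. if j = i then of_real ((a i)\<^sup>2) else 0)"
    unfolding hs_coord[OF specD(2)[OF assms] specD(2)[OF assms]]
    by (intro sum.cong refl) (auto simp: spec_bil_left[OF assms] o(3) power2_eq_square)
  also have "\<dots> = of_real (\<Sum>i\<in>T. (a i)\<^sup>2)"
    using o(1) by simp
  finally show ?thesis by (simp only: of_real_eq_iff)
qed

lemma psd_frobenius_le:
  assumes "psd n A"
  shows "(\<Sum>r<n. \<Sum>s<n. nsq (A $$ (r, s))) \<le> (Re (mtrace A))\<^sup>2"
proof -
  obtain U a where s: "spec n A {..<n} U a" and a: "\<And>i. i < n \<Longrightarrow> a i \<ge> 0" using psd_spec[OF assms] by blast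
  have "(\<Sum>i<n. (a i)\<^sup>2) \<le> (\<Sum>i<n. a i * (\<Sum>j<n. a j))"
    unfolding power2_eq_square using a by (intro sum_mono mult_left_mono member_le_sum) auto
  also have "\<dots> = (\<Sum>i<n. a i)\<^sup>2" by (simp add: power2_eq_square flip: sum_distrib_right)
  finally show ?thesis by (simp add: spec_frobenius[OF s] spec_trace[OF s])
qed

text \<open>No eigenbasis through \<open>v\<close> is constructed. The eigenvalues are nonnegative
  with sum \<open>c\<close> and sum of squares \<open>c\<^sup>2\<close>, the latter from the
  Hilbert-Schmidt norm, so each of them is 0 or \<open>c\<close>.\<close>

lemma vn_entropy_smult_proj:
  assumes v: "unit_vec_d d v" and c: "c \<ge> 0"
  shows "vn_entropy (of_real c \<cdot>\<^sub>m proj v) = eta c"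
proof -
  have vc: "v \<in> carrier_vec d" using v by (simp add: unit_vec_d_def)
  obtain U a where s: "spec d (of_real c \<cdot>\<^sub>m proj v) {..<d} U a" and a: "\<And>i. i < d \<Longrightarrow> a i \<ge> 0"
    using psd_spec[OF psd_smult_proj[OF vc c]] by blast
  have sum_a: "(\<Sum>i<d. a i) = c"
    using mtrace_smult_proj[OF v, of c] unfolding spec_trace[OF s] of_real_eq_iff .
  have "(\<Sum>i<d. (a i)\<^sup>2) = (\<Sum>r<d. \<Sum>s<d. (c * (cmod (v $ r) * cmod (v $ s)))\<^sup>2)"
    unfolding spec_frobenius[OF s, symmetric] using vc c by (simp add: smult_proj_entry norm_mult)
  also have "\<dots> = c\<^sup>2 * ((\<Sum>r<d. nsq (v $ r)) * (\<Sum>s<d. nsq (v $ s)))"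
    unfolding sum_product by (simp add: power_mult_distrib sum_distrib_left)
  finally have sq: "(\<Sum>i<d. (a i)\<^sup>2) = c\<^sup>2" using v by (simp add: unit_vec_d_def)
  have "(\<Sum>i<d. a i * (c - a i)) = 0"
    using sq sum_a by (simp add: right_diff_distrib sum_subtractf power2_eq_square flip: sum_distrib_right)
  moreover have "a i \<le> c" if "i < d" for i
    unfolding sum_a[symmetric] using that a by (intro member_le_sum) auto
  ultimately have "a i * (c - a i) = 0" if "i < d" for i
    using that a by (subst (asm) sum_nonneg_eq_0_iff) auto
  then have dich: "a i = 0 \<or> a i = c" if "i < d" for i using that by fastforce
  show ?thesis
  proof (cases "c = 0")
    case True
    then show ?thesis unfolding spec_vn_entropy[OF s] using dich by simp
  next
    case False
    \<comment> \<open>Weighting by the eigenvalue itself makes it unnecessary to count how often the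
      value \<open>c\<close> occurs.\<close>
    have "c * eta (a i) = a i * eta c" if "i < d" for i using dich[OF that] by auto
    then have "c * (\<Sum>i<d. eta (a i)) = (\<Sum>i<d. a i) * eta c"
      by (simp add: sum_distrib_left sum_distrib_right)
    then show ?thesis using False by (simp add: spec_vn_entropy[OF s] sum_a)
  qed
qed

text \<open>The squared Hilbert-Schmidt distance is at most \<open>2 * w * (w - F)\<close>. Its
  square root is linearized by the arithmetic-geometric mean inequality with free parameter
  \<open>\<theta>\<close>, which makes the error linear in the weight and in the loss of fidelity.
  The factor \<open>(real d)\<^sup>2\<close> comes from bounding every entry by the norm.\<close>

lemma pure_state_distance:
  assumes \<sigma>: "psd d \<sigma>" and v: "unit_vec_d d v" and \<theta>: "\<theta> > 0"
  defines "w \<equiv> Re (mtrace \<sigma>)" and "F \<equiv> Re (qform \<sigma> v)"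
  shows "F \<le> w"
    and "(\<Sum>r<d. \<Sum>s<d. cmod (\<sigma> $$ (r, s) - (of_real w \<cdot>\<^sub>m proj v) $$ (r, s))) \<le> (real d)\<^sup>2 * (\<theta> * w + (w - F) / (2 * \<theta>))"
proof -
  have vc: "v \<in> carrier_vec d" using v by (simp add: unit_vec_d_def)
  have w0: "w \<ge> 0" using psd_trace_ge_0[OF \<sigma>] by (simp add: w_def)
  obtain U a where s: "spec d \<sigma> {..<d} U a" and a: "\<And>i. i < d \<Longrightarrow> a i \<ge> 0" using psd_spec[OF \<sigma>] by blast
  have "F = (\<Sum>i<d. a i * nsq (ip d (U i) (\<lambda>r. v $ r)))"
    unfolding F_def qform_eq_qf[OF vc] spec_qf[OF s] by simp
  also have "\<dots> \<le> (\<Sum>i<d. a i * 1)"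
  proof (intro sum_mono mult_left_mono)
    fix i assume i: "i \<in> {..<d}"
    have "nsq (ip d (U i) (\<lambda>r. v $ r)) \<le> (\<Sum>i<d. nsq (ip d (U i) (\<lambda>r. v $ r)))"
      using i by (intro member_le_sum) auto
    then show "nsq (ip d (U i) (\<lambda>r. v $ r)) \<le> 1"
      using parseval_norm[OF specD(2)[OF s], of "\<lambda>r. v $ r"] v by (simp add: unit_vec_d_def)
  qed (use a in auto)
  finally show Fw: "F \<le> w" by (simp add: w_def spec_trace[OF s])
  let ?D = "\<lambda>r s. \<sigma> $$ (r, s) - (of_real w \<cdot>\<^sub>m proj v) $$ (r, s)"
  have F: "(\<Sum>r<d. \<Sum>s<d. Re (cnj (v $ r) * \<sigma> $$ (r, s) * v $ s)) = F"
    unfolding F_def qform_eq_qf[OF vc] bil_def by simp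
  have "(\<Sum>r<d. \<Sum>s<d. nsq (?D r s)) = (\<Sum>r<d. \<Sum>s<d. nsq (\<sigma> $$ (r, s))
      - 2 * w * Re (cnj (v $ r) * \<sigma> $$ (r, s) * v $ s) + w\<^sup>2 * (nsq (v $ r) * nsq (v $ s)))"
  proof (intro sum.cong refl)
    fix r s assume rs: "r \<in> {..<d}" "s \<in> {..<d}"
    have "nsq (x - of_real w * (y * cnj z)) = (cmod x)\<^sup>2 - 2 * w * Re (cnj y * x * z) + w\<^sup>2 * ((cmod y)\<^sup>2 * (cmod z)\<^sup>2)" for x y z
      unfolding cmod_power2 by (simp add: algebra_simps power2_eq_square)
    then show "nsq (?D r s) = nsq (\<sigma> $$ (r, s))
      - 2 * w * Re (cnj (v $ r) * \<sigma> $$ (r, s) * v $ s) + w\<^sup>2 * (nsq (v $ r) * nsq (v $ s))"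
      using rs vc by (simp add: smult_proj_entry)
  qed
  also have "\<dots> = (\<Sum>r<d. \<Sum>s<d. nsq (\<sigma> $$ (r, s))) - 2 * w * (\<Sum>r<d. \<Sum>s<d. Re (cnj (v $ r) * \<sigma> $$ (r, s) * v $ s))
     + w\<^sup>2 * ((\<Sum>r<d. nsq (v $ r)) * (\<Sum>s<d. nsq (v $ s)))"
    by (simp only: sum.distrib sum_subtractf sum_product, simp only: sum_distrib_left)
  also have "\<dots> \<le> w\<^sup>2 - 2 * w * F + w\<^sup>2"
    unfolding F using psd_frobenius_le[OF \<sigma>] v by (simp add: w_def unit_vec_d_def)
  finally have frob: "(\<Sum>r<d. \<Sum>s<d. nsq (?D r s)) \<le> 2 * w * (w - F)"
    by (simp add: power2_eq_square algebra_simps)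
  define e where "e = \<theta> * w + (w - F) / (2 * \<theta>)"
  have e0: "e \<ge> 0" using w0 Fw \<theta> by (simp add: e_def)
  have "2 * w * (w - F) \<le> e\<^sup>2"
  proof -
    have "e\<^sup>2 - 2 * w * (w - F) = (\<theta> * w - (w - F) / (2 * \<theta>))\<^sup>2"
      using \<theta> by (simp add: e_def power2_eq_square field_simps)
    then show ?thesis using zero_le_power2[of "\<theta> * w - (w - F) / (2 * \<theta>)"] by linarith
  qed
  then have ent: "cmod (?D r s) \<le> e" if "r < d" "s < d" for r s
  proof -
    have "nsq (?D r s) \<le> (\<Sum>s<d. nsq (?D r s))"
      using that by (intro member_le_sum) auto
    also have "\<dots> \<le> (\<Sum>r<d. \<Sum>s<d. nsq (?D r s))"
      using that by (intro member_le_sum[of r "{..<d}" "\<lambda>r. \<Sum>s<d. nsq (?D r s)"]) (auto intro: sum_nonneg)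
    finally have "nsq (?D r s) \<le> e\<^sup>2" using frob \<open>2 * w * (w - F) \<le> e\<^sup>2\<close> by linarith
    then show ?thesis using e0 by (rule power2_le_imp_le)
  qed
  have "(\<Sum>r<d. \<Sum>s<d. cmod (?D r s)) \<le> (\<Sum>r<d. \<Sum>s<d. e)"
    using ent by (intro sum_mono) auto
  then show "(\<Sum>r<d. \<Sum>s<d. cmod (?D r s)) \<le> (real d)\<^sup>2 * (\<theta> * w + (w - F) / (2 * \<theta>))"
    by (simp add: e_def power2_eq_square mult.assoc)
qed

text \<open>Each \<open>eta\<close> on the left is the entropy of a scaled pure state, so two Holevo
  informations are compared: that of the ideal letters, weighted by the traces of the
  \<open>\<sigma> i\<close>, and that of the \<open>\<sigma> i\<close> themselves.
  \<open>\<delta>\<close> and \<open>K\<close> are uniform in the size and the weights of the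
  ensemble.\<close>

definition holevo_slack :: "nat \<Rightarrow> real \<Rightarrow> real \<Rightarrow> bool" where
  "holevo_slack d \<delta> K \<longleftrightarrow> (\<forall>(k::nat) \<sigma> \<phi>. (\<forall>i<k. psd d (\<sigma> i) \<and> unit_vec_d d (\<phi> i)) \<longrightarrow>
     vn_entropy (msum d d (\<lambda>i. of_real (Re (mtrace (\<sigma> i))) \<cdot>\<^sub>m proj (\<phi> i)) {..<k}) - (\<Sum>i<k. eta (Re (mtrace (\<sigma> i))))
     \<le> vn_entropy (msum d d \<sigma> {..<k}) - (\<Sum>i<k. vn_entropy (\<sigma> i))
       + \<delta> * (\<Sum>i<k. Re (mtrace (\<sigma> i))) + K * (\<Sum>i<k. Re (mtrace (\<sigma> i)) - Re (qform (\<sigma> i) (\<phi> i))))"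

lemma holevo_pure_continuity:
  assumes d: "d \<ge> 1" and \<delta>: "\<delta> > 0"
  shows "\<exists>K\<ge>0. holevo_slack d \<delta> K"
proof -
  obtain K where K: "K \<ge> 0" and cont: "\<And>\<rho> \<sigma>. psd d \<rho> \<Longrightarrow> psd d \<sigma> \<Longrightarrow> mtrace \<rho> = mtrace \<sigma> \<Longrightarrow>
    vn_entropy \<rho> \<le> vn_entropy \<sigma> + \<delta> / 4 * Re (mtrace \<sigma>) + K * (\<Sum>r<d. \<Sum>s<d. cmod (\<rho> $$ (r, s) - \<sigma> $$ (r, s)))"
    using entropy_continuity[OF d, of "\<delta> / 4"] \<delta> by auto
  define C where "C = K * (real d)\<^sup>2"
  have C: "C \<ge> 0" using K by (simp add: C_def)
  \<comment> \<open>Continuity is invoked for the average and for the members, at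
    \<open>\<delta> / 4\<close> each, and the distances enter both times, at
    \<open>C * \<theta> \<le> \<delta> / 4\<close> each; together this is \<open>\<delta>\<close>.
    The infidelity parts of the distances add up to the slope \<open>C / \<theta>\<close>.\<close>
  define \<theta> where "\<theta> = \<delta> / (4 * (C + 1))"
  have \<theta>: "\<theta> > 0" using \<delta> C by (simp add: \<theta>_def)
  have C\<theta>: "C * \<theta> \<le> \<delta> / 4"
  proof -
    have "C * \<theta> \<le> (C + 1) * \<theta>" using \<theta> by (simp add: algebra_simps)
    also have "\<dots> = \<delta> / 4" using C by (simp add: \<theta>_def field_simps add_nonneg_eq_0_iff)
    finally show ?thesis .
  qed
  show ?thesis
    unfolding holevo_slack_def
  proof (intro exI[of _ "C / \<theta>"] conjI allI impI)
    show "C / \<theta> \<ge> 0" using C \<theta> by simp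
    fix k and \<sigma> :: "nat \<Rightarrow> complex mat" and \<phi> :: "nat \<Rightarrow> complex vec"
    assume a: "\<forall>i<k. psd d (\<sigma> i) \<and> unit_vec_d d (\<phi> i)"
    define w where "w i = Re (mtrace (\<sigma> i))" for i
    define F where "F i = Re (qform (\<sigma> i) (\<phi> i))" for i
    define \<tau> where "\<tau> i = of_real (w i) \<cdot>\<^sub>m proj (\<phi> i)" for i
    define l where "l i = (\<Sum>r<d. \<Sum>s<d. cmod (\<sigma> i $$ (r, s) - \<tau> i $$ (r, s)))" for i
    have w0: "w i \<ge> 0" if "i < k" for i using a that psd_trace_ge_0 unfolding w_def by blast
    have \<tau>: "psd d (\<tau> i)" "mtrace (\<tau> i) = mtrace (\<sigma> i)" "vn_entropy (\<tau> i) = eta (w i)" if "i < k" for i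
    proof -
      have u: "unit_vec_d d (\<phi> i)" and c: "\<phi> i \<in> carrier_vec d" using a that by (auto simp: unit_vec_d_def)
      show "psd d (\<tau> i)" unfolding \<tau>_def by (rule psd_smult_proj[OF c w0[OF that]])
      show "mtrace (\<tau> i) = mtrace (\<sigma> i)"
        unfolding \<tau>_def mtrace_smult_proj[OF u] w_def using psd_trace_real a that by metis
      show "vn_entropy (\<tau> i) = eta (w i)" unfolding \<tau>_def by (rule vn_entropy_smult_proj[OF u w0[OF that]])
    qed
    have l: "l i \<le> (real d)\<^sup>2 * (\<theta> * w i + (w i - F i) / (2 * \<theta>))" if "i < k" for i
      unfolding l_def \<tau>_def w_def F_def using a that \<theta> by (intro pure_state_distance) auto
    have 1: "vn_entropy (\<sigma> i) \<le> eta (w i) + \<delta> / 4 * w i + K * l i" if "i < k" for i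
      using cont[of "\<sigma> i" "\<tau> i"] \<tau>[OF that] a that by (simp add: l_def w_def)
    let ?S = "msum d d \<sigma> {..<k}" and ?T = "msum d d \<tau> {..<k}"
    have S: "psd d ?S" and T: "psd d ?T" using psd_msum[of "{..<k}" d] a \<tau> by auto
    have trS: "mtrace ?S = (\<Sum>i<k. mtrace (\<sigma> i))" using a psd_carrier by (intro mtrace_msum) auto
    have trT: "mtrace ?T = (\<Sum>i<k. mtrace (\<tau> i))" using \<tau> psd_carrier by (intro mtrace_msum) auto
    have "vn_entropy ?T \<le> vn_entropy ?S + \<delta> / 4 * Re (mtrace ?S) + K * (\<Sum>r<d. \<Sum>s<d. cmod (?T $$ (r, s) - ?S $$ (r, s)))"
      using \<tau> by (intro cont S T) (simp add: trS trT)
    also have "(\<Sum>r<d. \<Sum>s<d. cmod (?T $$ (r, s) - ?S $$ (r, s))) \<le> (\<Sum>r<d. \<Sum>s<d. \<Sum>i<k. cmod (\<sigma> i $$ (r, s) - \<tau> i $$ (r, s)))"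
    proof (intro sum_mono)
      fix r s assume "r \<in> {..<d}" "s \<in> {..<d}"
      then have "?T $$ (r, s) - ?S $$ (r, s) = (\<Sum>i<k. \<tau> i $$ (r, s) - \<sigma> i $$ (r, s))"
        by (simp add: msum_def sum_subtractf)
      then show "cmod (?T $$ (r, s) - ?S $$ (r, s)) \<le> (\<Sum>i<k. cmod (\<sigma> i $$ (r, s) - \<tau> i $$ (r, s)))"
        using norm_sum[of "\<lambda>i. \<tau> i $$ (r, s) - \<sigma> i $$ (r, s)" "{..<k}"] by (simp add: norm_minus_commute)
    qed
    also have "(\<Sum>r<d. \<Sum>s<d. \<Sum>i<k. cmod (\<sigma> i $$ (r, s) - \<tau> i $$ (r, s))) = (\<Sum>i<k. l i)"
      unfolding l_def by (rule sum_rotate)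
    finally have 2: "vn_entropy ?T \<le> vn_entropy ?S + \<delta> / 4 * (\<Sum>i<k. w i) + K * (\<Sum>i<k. l i)"
      using K by (simp add: trS w_def mult_left_mono)
    have "(\<Sum>i<k. vn_entropy (\<sigma> i)) \<le> (\<Sum>i<k. eta (w i) + \<delta> / 4 * w i + K * l i)"
      using 1 by (intro sum_mono) auto
    then have 3: "(\<Sum>i<k. vn_entropy (\<sigma> i)) \<le> (\<Sum>i<k. eta (w i)) + \<delta> / 4 * (\<Sum>i<k. w i) + K * (\<Sum>i<k. l i)"
      by (simp add: sum.distrib sum_distrib_left)
    have W0: "(\<Sum>i<k. w i) \<ge> 0" using w0 by (intro sum_nonneg) auto
    have "(\<Sum>i<k. l i) \<le> (\<Sum>i<k. (real d)\<^sup>2 * (\<theta> * w i + (w i - F i) / (2 * \<theta>)))"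
      using l by (intro sum_mono) auto
    also have "\<dots> = (real d)\<^sup>2 * (\<theta> * (\<Sum>i<k. w i) + (\<Sum>i<k. w i - F i) / (2 * \<theta>))"
      by (simp add: sum.distrib sum_distrib_left[symmetric] sum_divide_distrib[symmetric])
    finally have "2 * (K * (\<Sum>i<k. l i)) \<le> 2 * (K * ((real d)\<^sup>2 * (\<theta> * (\<Sum>i<k. w i) + (\<Sum>i<k. w i - F i) / (2 * \<theta>))))"
      using K by (intro mult_left_mono) auto
    also have "\<dots> = 2 * ((C * \<theta>) * (\<Sum>i<k. w i)) + C / \<theta> * (\<Sum>i<k. w i - F i)"
      using \<theta> by (simp add: C_def field_simps)
    also have "(C * \<theta>) * (\<Sum>i<k. w i) \<le> \<delta> / 4 * (\<Sum>i<k. w i)"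
      using C\<theta> W0 by (rule mult_right_mono)
    finally have "2 * (K * (\<Sum>i<k. l i)) \<le> 2 * (\<delta> / 4 * (\<Sum>i<k. w i)) + C / \<theta> * (\<Sum>i<k. w i - F i)" by simp
    then have "vn_entropy ?T - (\<Sum>i<k. eta (w i)) \<le> vn_entropy ?S - (\<Sum>i<k. vn_entropy (\<sigma> i))
        + \<delta> * (\<Sum>i<k. w i) + C / \<theta> * (\<Sum>i<k. w i - F i)"
      using 2 3 by (simp add: algebra_simps)
    then show "vn_entropy (msum d d (\<lambda>i. of_real (Re (mtrace (\<sigma> i))) \<cdot>\<^sub>m proj (\<phi> i)) {..<k}) - (\<Sum>i<k. eta (Re (mtrace (\<sigma> i))))
     \<le> vn_entropy (msum d d \<sigma> {..<k}) - (\<Sum>i<k. vn_entropy (\<sigma> i))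
       + \<delta> * (\<Sum>i<k. Re (mtrace (\<sigma> i))) + C / \<theta> * (\<Sum>i<k. Re (mtrace (\<sigma> i)) - Re (qform (\<sigma> i) (\<phi> i)))"
      by (simp add: \<tau>_def[abs_def] w_def F_def)
  qed
qed

section \<open>The trade-off function for unnormalized joint distributions\<close>

definition mix :: "nat \<Rightarrow> nat \<Rightarrow> (nat \<Rightarrow> complex vec) \<Rightarrow> (nat \<Rightarrow> real) \<Rightarrow> complex mat" where
  "mix d k \<phi> w = msum d d (\<lambda>i. of_real (w i) \<cdot>\<^sub>m proj (\<phi> i)) {..<k}"

text \<open>Mutual information of letter and label, \<open>w c i\<close> being the joint probability
  of label \<open>c\<close> and letter \<open>i\<close>, with marginal \<open>p\<close>.\<close>

definition minfo :: "nat \<Rightarrow> (nat \<Rightarrow> real) \<Rightarrow> 'c set \<Rightarrow> ('c \<Rightarrow> nat \<Rightarrow> real) \<Rightarrow> real" where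
  "minfo k p S w = (\<Sum>i<k. eta (p i)) + (\<Sum>c\<in>S. eta (\<Sum>i<k. w c i)) - (\<Sum>c\<in>S. \<Sum>i<k. eta (w c i))"

text \<open>For pure letters S(ABC) = S(AC), so S(A:B|C) is the average entropy of B given the
  label. Subtracting \<open>eta\<close> of the weight turns the entropy of the unnormalized state
  into weight times entropy of the normalized one.\<close>

definition cinfo :: "nat \<Rightarrow> nat \<Rightarrow> (nat \<Rightarrow> complex vec) \<Rightarrow> 'c set \<Rightarrow> ('c \<Rightarrow> nat \<Rightarrow> real) \<Rightarrow> real" where
  "cinfo d k \<phi> S w = (\<Sum>c\<in>S. vn_entropy (mix d k \<phi> (w c)) - eta (\<Sum>i<k. w c i))"

lemma ensembleD:
  assumes "ensemble d k p \<phi>"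
  shows "d \<ge> 1" "\<And>i. i < k \<Longrightarrow> p i \<ge> 0" "(\<Sum>i<k. p i) = 1" "\<And>i. i < k \<Longrightarrow> unit_vec_d d (\<phi> i)"
  using assms by (auto simp: ensemble_def unit_vec_d_def)

lemma unit_vec_d_complex: "unit_vec_d d v \<Longrightarrow> (\<Sum>r<d. v $ r * cnj (v $ r)) = 1"
proof -
  assume v: "unit_vec_d d v"
  have "(\<Sum>r<d. v $ r * cnj (v $ r)) = of_real (\<Sum>r<d. nsq (v $ r))"
    by (simp only: of_real_sum complex_norm_square)
  also have "(\<Sum>r<d. nsq (v $ r)) = 1" using v by (simp add: unit_vec_d_def)
  finally show ?thesis by simp
qed

lemma unit_vec_d_carrier: "unit_vec_d d v \<Longrightarrow> v \<in> carrier_vec d"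
  by (simp add: unit_vec_d_def)

lemma mix_entry:
  assumes "\<And>i. i < k \<Longrightarrow> unit_vec_d d (\<phi> i)" "r < d" "s < d"
  shows "mix d k \<phi> w $$ (r, s) = (\<Sum>i<k. of_real (w i) * (\<phi> i $ r * cnj (\<phi> i $ s)))"
  using assms smult_proj_entry[OF unit_vec_d_carrier[OF assms(1)]] by (simp add: mix_def msum_def)

lemma mix_psd:
  assumes "\<And>i. i < k \<Longrightarrow> unit_vec_d d (\<phi> i)" "\<And>i. i < k \<Longrightarrow> w i \<ge> 0"
  shows "psd d (mix d k \<phi> w)"
  unfolding mix_def using psd_smult_proj[OF unit_vec_d_carrier[OF assms(1)] assms(2)]
  by (intro psd_msum) simp

lemma mix_trace:
  assumes "\<And>i. i < k \<Longrightarrow> unit_vec_d d (\<phi> i)"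
  shows "mtrace (mix d k \<phi> w) = of_real (\<Sum>i<k. w i)"
proof -
  have "mtrace (mix d k \<phi> w) = (\<Sum>i<k. mtrace (of_real (w i) \<cdot>\<^sub>m proj (\<phi> i)))"
    unfolding mix_def using unit_vec_d_carrier[OF assms] by (intro mtrace_msum) (auto simp: proj_def)
  then show ?thesis using mtrace_smult_proj[OF assms] by simp
qed

lemma diag_spec:
  assumes g: "bij_betw g C {..<N}" and C: "finite C" and A: "A \<in> carrier_mat N N"
    and ent: "\<And>c c'. c \<in> C \<Longrightarrow> c' \<in> C \<Longrightarrow> A $$ (g c, g c') = (if c = c' then of_real (x c) else 0)"
  shows "spec N A C (\<lambda>c r. if r = g c then 1 else 0) x"
  unfolding spec_def onb_def
proof (intro conjI ballI allI impI)
  show "card C = N" using bij_betw_same_card[OF g] by simp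
  fix c c' assume c: "c \<in> C" "c' \<in> C"
  then have gc: "g c < N" "g c' < N" "g c = g c' \<longleftrightarrow> c = c'"
    using g by (auto simp: bij_betw_def inj_on_def)
  have "ip N (\<lambda>r. if r = g c then 1 else 0) (\<lambda>r. if r = g c' then 1 else 0) = (\<Sum>r<N. if r = g c then (if c = c' then 1 else 0) else 0)"
    unfolding ip_def using gc by (intro sum.cong) auto
  then show "ip N (\<lambda>r. if r = g c then 1 else 0) (\<lambda>r. if r = g c' then 1 else 0) = (if c = c' then 1 else 0)"
    using gc by simp
next
  fix r s assume rs: "r < N" "s < N"
  have "r \<in> g ` C" "s \<in> g ` C" using g rs by (auto simp: bij_betw_def)
  then obtain c c' where c: "c \<in> C" "c' \<in> C" "r = g c" "s = g c'" by blast
  have inj: "g y = g z \<longleftrightarrow> y = z" if "y \<in> C" "z \<in> C" for y z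
    using g that by (auto simp: bij_betw_def inj_on_def)
  have "(\<Sum>i\<in>C. of_real (x i) * (if r = g i then 1 else 0) * cnj (if s = g i then 1 else 0)) = (\<Sum>i\<in>C. if i = c then (if c = c' then complex_of_real (x c) else 0) else 0)"
    using c inj by (intro sum.cong refl) auto
  also have "\<dots> = A $$ (r, s)" using C c ent by simp
  finally show "A $$ (r, s) = (\<Sum>i\<in>C. of_real (x i) * (if r = g i then 1 else 0) * cnj (if s = g i then 1 else 0))" by simp
qed (use A C in auto)

lemma bij_betw_div_mod: "bij_betw (\<lambda>(a, c). a * m + c) ({..<k} \<times> {..<m}) {..<k * m}" for k m :: nat
proof (rule bij_betw_byWitness[where f' = "\<lambda>r. (r div m, r mod m)"])
  show "(\<lambda>(a, c). a * m + c) ` ({..<k} \<times> {..<m}) \<subseteq> {..<k * m}"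
  proof safe
    fix a c assume ac: "a < k" "c < m"
    have "a * m + c < Suc a * m" using ac by simp
    also have "\<dots> \<le> k * m" using ac by (intro mult_le_mono) auto
    finally show "a * m + c < k * m" .
  qed
  show "(\<lambda>r. (r div m, r mod m)) ` {..<k * m} \<subseteq> {..<k} \<times> {..<m}"
    by (auto simp: less_mult_imp_div_less) (metis mod_less_divisor mult_0_right not_less_zero gr0I)
qed auto

lemma mkron_entry:
  assumes "A \<in> carrier_mat n n" "B \<in> carrier_mat m m" "a < n" "a' < n" "b < m" "b' < m"
  shows "mkron A B $$ (a * m + b, a' * m + b') = A $$ (a, a') * B $$ (b, b')"
proof -
  have "x * m + y < n * m" if "x < n" "y < m" for x y
    using bij_betw_div_mod[of m n] that by (auto simp: bij_betw_def)
  then show ?thesis using assms by (simp add: mkron_def)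
qed

lemma mkron_carrier: "A \<in> carrier_mat n n \<Longrightarrow> B \<in> carrier_mat m m \<Longrightarrow> mkron A B \<in> carrier_mat (n * m) (n * m)"
  by (auto simp: mkron_def)

lemma pair_less: "a < k \<Longrightarrow> c < m \<Longrightarrow> a * m + c < k * m" for a c k m :: nat
  using bij_betw_div_mod[of m k] by (auto simp: bij_betw_def)

lemma rhoABC_entry:
  assumes u: "\<And>i. i < k \<Longrightarrow> unit_vec_d d (\<phi> i)"
    and "a < k" "a' < k" "b < d" "b' < d" "c < m" "c' < m"
  shows "rhoABC d k p \<phi> m q $$ ((a * d + b) * m + c, (a' * d + b') * m + c')
    = (if a = a' \<and> c = c' then of_real (p a * q a c) * (\<phi> a $ b * cnj (\<phi> a $ b')) else 0)"
proof -
  let ?M = "\<lambda>i. msum m m (\<lambda>j. of_real (q i j) \<cdot>\<^sub>m ketbra m j) {..<m}"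
  have M: "?M i $$ (c, c') = (if c = c' then of_real (q i c) else 0)" for i
  proof -
    have "?M i $$ (c, c') = (\<Sum>j<m. (of_real (q i j) \<cdot>\<^sub>m ketbra m j) $$ (c, c'))"
      using assms by (simp add: msum_def)
    also have "\<dots> = (\<Sum>j<m. if j = c then (if c = c' then of_real (q i c) else 0) else 0)"
      by (intro sum.cong refl) (use assms in \<open>auto simp: ketbra_def\<close>)
    finally show ?thesis using assms by simp
  qed
  have kc: "ketbra k i \<in> carrier_mat k k" for i by (simp add: ketbra_def)
  have pc: "proj (\<phi> i) \<in> carrier_mat d d" if "i < k" for i
    using unit_vec_d_carrier[OF u[OF that]] by (simp add: proj_def)
  have lt: "a * d + b < k * d" "a' * d + b' < k * d" using assms by (auto intro: pair_less)
  have "rhoABC d k p \<phi> m q $$ ((a * d + b) * m + c, (a' * d + b') * m + c')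
     = (\<Sum>i<k. (of_real (p i) \<cdot>\<^sub>m mkron (mkron (ketbra k i) (proj (\<phi> i))) (?M i)) $$ ((a * d + b) * m + c, (a' * d + b') * m + c'))"
    using pair_less[OF lt(1) assms(6)] pair_less[OF lt(2) assms(7)] by (simp add: rhoABC_def msum_def[of "k * d * m"])
  also have "\<dots> = (\<Sum>i<k. if i = a then (if a = a' \<and> c = c' then of_real (p a * q a c) * (\<phi> a $ b * cnj (\<phi> a $ b')) else 0) else 0)"
  proof (intro sum.cong refl)
    fix i assume "i \<in> {..<k}"
    then have i: "i < k" by simp
    note c1 = mkron_carrier[OF kc[of i] pc[OF i]]
    note c2 = mkron_carrier[OF c1 msum_carrier[of m m "\<lambda>j. of_real (q i j) \<cdot>\<^sub>m ketbra m j" "{..<m}"]]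
    have "(of_real (p i) \<cdot>\<^sub>m mkron (mkron (ketbra k i) (proj (\<phi> i))) (?M i)) $$ ((a * d + b) * m + c, (a' * d + b') * m + c')
      = of_real (p i) * (mkron (mkron (ketbra k i) (proj (\<phi> i))) (?M i) $$ ((a * d + b) * m + c, (a' * d + b') * m + c'))"
      using c2 pair_less[OF lt(1) assms(6)] pair_less[OF lt(2) assms(7)] by (intro index_smult_mat) auto
    also have "\<dots> = of_real (p i) * (ketbra k i $$ (a, a') * proj (\<phi> i) $$ (b, b') * ?M i $$ (c, c'))"
      by (simp only: mkron_entry[OF c1 msum_carrier lt assms(6,7)] mkron_entry[OF kc pc[OF i] assms(2,3,4,5)])
    also have "\<dots> = (if i = a then (if a = a' \<and> c = c' then of_real (p a * q a c) * (\<phi> a $ b * cnj (\<phi> a $ b')) else 0) else 0)"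
      unfolding M proj_entry[OF unit_vec_d_carrier[OF u[OF i]] assms(4,5)] using assms by (auto simp: ketbra_def)
    finally show "(of_real (p i) \<cdot>\<^sub>m mkron (mkron (ketbra k i) (proj (\<phi> i))) (?M i)) $$ ((a * d + b) * m + c, (a' * d + b') * m + c')
      = (if i = a then (if a = a' \<and> c = c' then of_real (p a * q a c) * (\<phi> a $ b * cnj (\<phi> a $ b')) else 0) else 0)" .
  qed
  finally show ?thesis using assms by simp
qed

lemma ptrace3_entries:
  fixes p :: "nat \<Rightarrow> real" and q :: "nat \<Rightarrow> nat \<Rightarrow> real"
  assumes u: "\<And>i. i < k \<Longrightarrow> unit_vec_d d (\<phi> i)"
    and "a < k" "a' < k" "b < d" "b' < d" "c < m" "c' < m"
  defines "\<rho> \<equiv> rhoABC d k p \<phi> m q"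
  shows "ptrace3 k d m True False False \<rho> $$ (a, a') = (if a = a' then of_real (p a * (\<Sum>c<m. q a c)) else 0)"
    and "ptrace3 k d m False False True \<rho> $$ (c, c') = (if c = c' then of_real (\<Sum>a<k. p a * q a c) else 0)"
    and "ptrace3 k d m True False True \<rho> $$ (a * m + c, a' * m + c') = (if a = a' \<and> c = c' then of_real (p a * q a c) else 0)"
    and "ptrace3 k d m False True True \<rho> $$ (b * m + c, b' * m + c') = (if c = c' then mix d k \<phi> (\<lambda>i. p i * q i c) $$ (b, b') else 0)"
proof -
  note e = rhoABC_entry[OF u]
  have tr: "(\<Sum>b<d. of_real x * (\<phi> a $ b * cnj (\<phi> a $ b))) = of_real x" if "a < k" for x a
    using unit_vec_d_complex[OF u[OF that]] by (simp flip: sum_distrib_left)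
  have si: "(\<Sum>b<d. if P then f b else 0) = (if P then (\<Sum>b<d. f b) else (0 :: complex))" for P and f :: cvec
    by simp
  have "ptrace3 k d m True False False \<rho> $$ (a, a') = (\<Sum>b<d. \<Sum>c<m. \<rho> $$ ((a * d + b) * m + c, (a' * d + b) * m + c))"
    using assms by (simp add: ptrace3_def Let_def)
  also have "\<dots> = (\<Sum>c<m. \<Sum>b<d. \<rho> $$ ((a * d + b) * m + c, (a' * d + b) * m + c))" by (rule sum.swap)
  also have "\<dots> = (\<Sum>c<m. if a = a' then of_real (p a * q a c) else 0)"
    unfolding \<rho>_def by (intro sum.cong refl) (use assms in \<open>simp add: e si tr flip: of_real_mult\<close>)
  finally show "ptrace3 k d m True False False \<rho> $$ (a, a') = (if a = a' then of_real (p a * (\<Sum>c<m. q a c)) else 0)"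
    by (simp add: sum_distrib_left)
  have "ptrace3 k d m False False True \<rho> $$ (c, c') = (\<Sum>a<k. \<Sum>b<d. \<rho> $$ ((a * d + b) * m + c, (a * d + b) * m + c'))"
    using assms by (simp add: ptrace3_def Let_def)
  also have "\<dots> = (\<Sum>a<k. if c = c' then of_real (p a * q a c) else 0)"
    unfolding \<rho>_def by (intro sum.cong refl) (use assms in \<open>simp add: e si tr flip: of_real_mult\<close>)
  finally show "ptrace3 k d m False False True \<rho> $$ (c, c') = (if c = c' then of_real (\<Sum>a<k. p a * q a c) else 0)"
    by simp
  have "ptrace3 k d m True False True \<rho> $$ (a * m + c, a' * m + c') = (\<Sum>b<d. \<rho> $$ ((a * d + b) * m + c, (a' * d + b) * m + c'))"
    using assms pair_less[of a k c m] pair_less[of a' k c' m] by (simp add: ptrace3_def Let_def)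
  also have "\<dots> = (if a = a' \<and> c = c' then of_real (p a * q a c) else 0)"
    unfolding \<rho>_def using assms by (simp add: e si tr flip: of_real_mult)
  finally show "ptrace3 k d m True False True \<rho> $$ (a * m + c, a' * m + c') = (if a = a' \<and> c = c' then of_real (p a * q a c) else 0)" .
  have "ptrace3 k d m False True True \<rho> $$ (b * m + c, b' * m + c') = (\<Sum>a<k. \<rho> $$ ((a * d + b) * m + c, (a * d + b') * m + c'))"
    using assms pair_less[of b d c m] pair_less[of b' d c' m] by (simp add: ptrace3_def Let_def)
  also have "\<dots> = (if c = c' then mix d k \<phi> (\<lambda>i. p i * q i c) $$ (b, b') else 0)"
    unfolding \<rho>_def using assms by (simp add: e mix_entry[OF u])
  finally show "ptrace3 k d m False True True \<rho> $$ (b * m + c, b' * m + c') = (if c = c' then mix d k \<phi> (\<lambda>i. p i * q i c) $$ (b, b') else 0)" .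
qed

lemma bij_betw_triple: "bij_betw (\<lambda>(b, ac). (fst ac * d + b) * m + snd ac) ({..<d} \<times> ({..<k} \<times> {..<m})) {..<k * d * m}" for k d m :: nat
proof (rule bij_betw_byWitness[where f' = "\<lambda>r. ((r div m) mod d, (r div m) div d, r mod m)"])
  show "(\<lambda>(b, ac). (fst ac * d + b) * m + snd ac) ` ({..<d} \<times> ({..<k} \<times> {..<m})) \<subseteq> {..<k * d * m}"
    by (auto intro!: pair_less)
  show "(\<lambda>r. ((r div m) mod d, (r div m) div d, r mod m)) ` {..<k * d * m} \<subseteq> {..<d} \<times> ({..<k} \<times> {..<m})"
  proof safe
    fix r assume r: "r < k * d * m"
    then have md: "m > 0" "d > 0" by (auto intro!: gr0I)
    show "(r div m) mod d < d" "r mod m < m" using md by auto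
    have "r div m < k * d" using r by (rule less_mult_imp_div_less)
    then show "r div m div d < k" by (rule less_mult_imp_div_less)
  qed
qed auto

text \<open>All marginals are block diagonal in the classical registers they keep. A, C and AC are
  diagonal, BC has the blocks \<open>mix\<close>, and ABC has rank-one blocks, so that its entropy
  equals that of AC and cancels it.\<close>

lemma mutual_AC_eq:
  assumes ens: "ensemble d k p \<phi>" and q: "cond_dist k m q"
  shows "mutual_AC d k p \<phi> m q = minfo k p {..<m} (\<lambda>j i. p i * q i j)"
    and "cond_mutual_AB_C d k p \<phi> m q = cinfo d k \<phi> {..<m} (\<lambda>j i. p i * q i j)"
proof -
  note u = ensembleD(4)[OF ens]
  have d: "0 < d" using ensembleD(1)[OF ens] by simp
  have q0: "\<And>i j. i < k \<Longrightarrow> j < m \<Longrightarrow> q i j \<ge> 0" "\<And>i. i < k \<Longrightarrow> (\<Sum>j<m. q i j) = 1" using q by (auto simp: cond_dist_def)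
  have pq: "p i * q i j \<ge> 0" if "i < k" "j < m" for i j using ensembleD(2)[OF ens] q0 that by simp
  let ?\<rho> = "rhoABC d k p \<phi> m q"
  note pe = ptrace3_entries[OF u]
  have k0: "0 < k" using ensembleD(3)[OF ens] by (cases k) auto
  have m0: "0 < m" using q0(2)[OF k0] by (cases m) auto
  have A: "vn_entropy (ptrace3 k d m True False False ?\<rho>) = (\<Sum>a<k. eta (p a))"
    by (rule spec_vn_entropy[OF diag_spec[where g = "\<lambda>a. a"]])
      (use q0 in \<open>auto simp: pe(1)[OF _ _ _ d d m0 m0] bij_betw_def, auto simp: ptrace3_def Let_def\<close>)
  have C: "vn_entropy (ptrace3 k d m False False True ?\<rho>) = (\<Sum>c<m. eta (\<Sum>a<k. p a * q a c))"
    by (rule spec_vn_entropy[OF diag_spec[where g = "\<lambda>a. a"]])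
      (auto simp: pe(2)[OF _ k0 k0 d d] bij_betw_def, auto simp: ptrace3_def Let_def)
  have AC: "vn_entropy (ptrace3 k d m True False True ?\<rho>) = (\<Sum>(a, c)\<in>{..<k} \<times> {..<m}. eta (p a * q a c))"
  proof -
    have "vn_entropy (ptrace3 k d m True False True ?\<rho>) = (\<Sum>ac\<in>{..<k} \<times> {..<m}. eta (p (fst ac) * q (fst ac) (snd ac)))"
      by (rule spec_vn_entropy[OF diag_spec[OF bij_betw_div_mod]])
        (auto simp: pe(3)[OF _ _ _ d d] split: if_splits, auto simp: ptrace3_def Let_def)
    then show ?thesis by (simp add: case_prod_unfold)
  qed
  have BC: "vn_entropy (ptrace3 k d m False True True ?\<rho>) = (\<Sum>c<m. vn_entropy (mix d k \<phi> (\<lambda>i. p i * q i c)))"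
  proof (rule vn_entropy_block[where d = d and N = "d * m" and f = "\<lambda>b c. b * m + c", OF bij_betw_div_mod])
    show "psd d (mix d k \<phi> (\<lambda>i. p i * q i c))" if "c \<in> {..<m}" for c
      using that by (intro mix_psd u pq) auto
    show "ptrace3 k d m False True True ?\<rho> $$ (r * m + c, s * m + c') = (if c = c' then mix d k \<phi> (\<lambda>i. p i * q i c) $$ (r, s) else 0)"
      if "r < d" "s < d" "c \<in> {..<m}" "c' \<in> {..<m}" for r s c c'
      using that by (intro pe(4)[OF _ k0 k0]) auto
  qed (auto simp: ptrace3_def Let_def)
  have ABC: "vn_entropy ?\<rho> = (\<Sum>(a, c)\<in>{..<k} \<times> {..<m}. eta (p a * q a c))"
  proof -
    have "vn_entropy ?\<rho> = (\<Sum>ac\<in>{..<k} \<times> {..<m}. vn_entropy (of_real (p (fst ac) * q (fst ac) (snd ac)) \<cdot>\<^sub>m proj (\<phi> (fst ac))))"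
    proof (rule vn_entropy_block[OF bij_betw_triple])
      fix r s ac ac' assume "r < d" "s < d" "ac \<in> {..<k} \<times> {..<m}" "ac' \<in> {..<k} \<times> {..<m}"
      then show "?\<rho> $$ ((fst ac * d + r) * m + snd ac, (fst ac' * d + s) * m + snd ac')
        = (if ac = ac' then (of_real (p (fst ac) * q (fst ac) (snd ac)) \<cdot>\<^sub>m proj (\<phi> (fst ac))) $$ (r, s) else 0)"
        by (cases ac; cases ac') (simp add: rhoABC_entry[OF u] smult_proj_entry[OF unit_vec_d_carrier[OF u]])
    next
      fix ac assume "ac \<in> {..<k} \<times> {..<m}"
      then show "psd d (of_real (p (fst ac) * q (fst ac) (snd ac)) \<cdot>\<^sub>m proj (\<phi> (fst ac)))"
        by (intro psd_smult_proj unit_vec_d_carrier[OF u] pq) auto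
    qed (auto simp: rhoABC_def)
    also have "\<dots> = (\<Sum>ac\<in>{..<k} \<times> {..<m}. eta (p (fst ac) * q (fst ac) (snd ac)))"
      by (intro sum.cong refl vn_entropy_smult_proj[where d = d] u pq) auto
    finally show ?thesis by (simp add: case_prod_unfold)
  qed
  have sw: "(\<Sum>(a, c)\<in>{..<k} \<times> {..<m}. eta (p a * q a c)) = (\<Sum>c<m. \<Sum>a<k. eta (p a * q a c))"
    by (subst sum.swap) (simp add: sum.cartesian_product)
  show "mutual_AC d k p \<phi> m q = minfo k p {..<m} (\<lambda>j i. p i * q i j)"
    unfolding mutual_AC_def Let_def A C AC sw minfo_def by simp
  show "cond_mutual_AB_C d k p \<phi> m q = cinfo d k \<phi> {..<m} (\<lambda>j i. p i * q i j)"
    unfolding cond_mutual_AB_C_def Let_def AC BC C ABC cinfo_def by (simp add: sum_subtractf)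
qed

text \<open>Joint weights become a conditional distribution on division by \<open>p i\<close>. A
  real \<open>Inf\<close> is below its elements only once the set is known to be bounded below; here
  0 is a bound, since a positive matrix has at least the entropy \<open>eta\<close> of its
  trace.\<close>

lemma M_fun_le:
  assumes ens: "ensemble d k p \<phi>" and S: "finite S"
    and w: "\<And>c i. c \<in> S \<Longrightarrow> i < k \<Longrightarrow> w c i \<ge> 0" "\<And>i. i < k \<Longrightarrow> (\<Sum>c\<in>S. w c i) = p i"
    and R: "minfo k p S w \<le> R"
  shows "M_fun d k p \<phi> R \<le> cinfo d k \<phi> S w"
proof -
  note u = ensembleD(4)[OF ens]
  have k0: "0 < k" using ensembleD(3)[OF ens] by (cases k) auto
  have "S \<noteq> {}"
  proof
    assume "S = {}"
    then have "p i = 0" if "i < k" for i using w(2)[OF that] by simp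
    then show False using ensembleD(3)[OF ens] by simp
  qed
  then have m0: "0 < card S" using S by (simp add: card_gt_0_iff)
  define m where "m = card S"
  obtain e where e: "bij_betw e {..<m} S" using ex_bij_betw_nat_finite[OF S] by (auto simp: m_def atLeast0LessThan)
  \<comment> \<open>A letter of probability 0 gets the point mass at label 0, which exists because
    \<open>S\<close> is nonempty; multiplied by \<open>p i\<close> it disappears from the joint
    weights.\<close>
  define q where "q i j = (if p i = 0 then (if j = 0 then 1 else 0) else w (e j) i / p i)" for i j
  have eS: "e j \<in> S" if "j < m" for j using e that by (auto simp: bij_betw_def)
  have q: "cond_dist k m q"
    unfolding cond_dist_def
  proof (intro conjI allI impI)
    fix i j assume "i < k" "j < m"
    then show "q i j \<ge> 0" using w(1)[OF eS] ensembleD(2)[OF ens] by (simp add: q_def)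
  next
    fix i assume i: "i < k"
    show "(\<Sum>j<m. q i j) = 1"
    proof (cases "p i = 0")
      case True
      then show ?thesis using m0 by (simp add: q_def m_def)
    next
      case False
      have "(\<Sum>j<m. q i j) = (\<Sum>j<m. w (e j) i) / p i"
        using False by (simp add: q_def sum_divide_distrib)
      also have "(\<Sum>j<m. w (e j) i) = p i" using sum.reindex_bij_betw[OF e, of "\<lambda>c. w c i"] w(2)[OF i] by simp
      finally show ?thesis using False by simp
    qed
  qed
  have pq: "p i * q i j = w (e j) i" if "i < k" "j < m" for i j
  proof (cases "p i = 0")
    case True
    then have "\<forall>c\<in>S. w c i = 0"
      using w(2)[OF that(1)] sum_nonneg_eq_0_iff[OF S, of "\<lambda>c. w c i"] w(1) that by auto
    then show ?thesis using True eS[OF that(2)] by simp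
  qed (simp add: q_def)
  have mixeq: "mix d k \<phi> (\<lambda>i. p i * q i j) = mix d k \<phi> (w (e j))" if "j < m" for j
    using that pq by (simp add: mix_def msum_def del: of_real_mult)
  have e1: "mutual_AC d k p \<phi> m q = minfo k p S w"
    unfolding mutual_AC_eq(1)[OF ens q] minfo_def
    by (simp add: pq flip: sum.reindex_bij_betw[OF e])
  have e2: "cond_mutual_AB_C d k p \<phi> m q = cinfo d k \<phi> S w"
    unfolding mutual_AC_eq(2)[OF ens q] cinfo_def
    by (simp add: pq mixeq flip: sum.reindex_bij_betw[OF e])
  have bdd: "bdd_below {cond_mutual_AB_C d k p \<phi> m q | m q. cond_dist k m q \<and> mutual_AC d k p \<phi> m q \<le> R}"
  proof (rule bdd_belowI[of _ 0])
    fix x assume "x \<in> {cond_mutual_AB_C d k p \<phi> m q | m q. cond_dist k m q \<and> mutual_AC d k p \<phi> m q \<le> R}"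
    then obtain m q where q: "cond_dist k m q" and x: "x = cond_mutual_AB_C d k p \<phi> m q" by blast
    have pq: "p i * q i j \<ge> 0" if "i < k" "j < m" for i j
      using ensembleD(2)[OF ens] q that by (auto simp: cond_dist_def)
    have "0 \<le> cinfo d k \<phi> {..<m} (\<lambda>j i. p i * q i j)"
      unfolding cinfo_def
    proof (intro sum_nonneg)
      fix j assume "j \<in> {..<m}"
      then have "psd d (mix d k \<phi> (\<lambda>i. p i * q i j))" using pq by (intro mix_psd u) auto
      from vn_entropy_lower[OF this]
      show "0 \<le> vn_entropy (mix d k \<phi> (\<lambda>i. p i * q i j)) - eta (\<Sum>i<k. p i * q i j)"
        by (simp add: mix_trace[OF u])
    qed
    then show "0 \<le> x" unfolding x mutual_AC_eq(2)[OF ens q] .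
  qed
  have "cinfo d k \<phi> S w \<in> {cond_mutual_AB_C d k p \<phi> m q | m q. cond_dist k m q \<and> mutual_AC d k p \<phi> m q \<le> R}"
    by (rule CollectI, rule exI[of _ m], rule exI[of _ q]) (use e1 e2 q R in simp)
  then show ?thesis
    unfolding M_fun_def using bdd by (rule cInf_lower)
qed

section \<open>Scaling of entropies and time sharing\<close>

lemma vn_entropy_scale:
  assumes A: "psd n A" and B: "B \<in> carrier_mat n n" "\<And>r s. r < n \<Longrightarrow> s < n \<Longrightarrow> B $$ (r, s) = of_real c * A $$ (r, s)"
    and c: "c \<ge> 0"
  shows "vn_entropy B = c * vn_entropy A + Re (mtrace A) * eta c"
proof -
  obtain U a where s: "spec n A {..<n} U a" and a: "\<And>i. i < n \<Longrightarrow> a i \<ge> 0" using psd_spec[OF A] by blast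
  have "spec n B {..<n} U (\<lambda>i. c * a i)"
    unfolding spec_def using B specD[OF s] by (auto simp: sum_distrib_left mult_ac)
  then have "vn_entropy B = (\<Sum>i<n. eta (c * a i))" by (rule spec_vn_entropy)
  also have "\<dots> = (\<Sum>i<n. c * eta (a i) + a i * eta c)" using a c by (simp add: eta_mult)
  finally show ?thesis by (simp add: sum.distrib sum_distrib_left sum_distrib_right spec_vn_entropy[OF s] spec_trace[OF s])
qed

lemma vn_entropy_mix_scale:
  assumes u: "\<And>i. i < k \<Longrightarrow> unit_vec_d d (\<phi> i)" and w: "\<And>i. i < k \<Longrightarrow> w i \<ge> 0" and c: "c \<ge> 0"
  shows "vn_entropy (mix d k \<phi> (\<lambda>i. c * w i)) = c * vn_entropy (mix d k \<phi> w) + (\<Sum>i<k. w i) * eta c"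
proof -
  have "vn_entropy (mix d k \<phi> (\<lambda>i. c * w i)) = c * vn_entropy (mix d k \<phi> w) + Re (mtrace (mix d k \<phi> w)) * eta c"
    by (rule vn_entropy_scale[OF mix_psd[OF u w] _ _ c]) (auto simp: mix_entry[OF u] sum_distrib_left mult_ac, simp add: mix_def)
  then show ?thesis by (simp add: mix_trace[OF u])
qed

text \<open>Sending a letter to its pure state is a channel, so the label tells about B at most what
  it tells about the letter. With diagonal matrices as classical states this is
  \<open>data_processing\<close> for the ensemble \<open>D (w c)\<close>.\<close>

lemma cinfo_minfo:
  assumes ens: "ensemble d k p \<phi>" and S: "finite S"
    and w: "\<And>c i. c \<in> S \<Longrightarrow> i < k \<Longrightarrow> w c i \<ge> 0" "\<And>i. i < k \<Longrightarrow> (\<Sum>c\<in>S. w c i) = p i"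
  shows "vn_entropy (mix d k \<phi> p) \<le> cinfo d k \<phi> S w + minfo k p S w"
proof -
  note u = ensembleD(4)[OF ens]
  \<comment> \<open>As a Kraus operator, \<open>K i\<close> maps the basis vector \<open>i\<close>
    to \<open>\<phi> i\<close> and the other basis vectors to 0.\<close>
  define K where "K i r v = (if v = i then \<phi> i $ r else 0)" for i r v :: nat
  define \<Phi> where "\<Phi> = kraus k d {..<k} K"
  have sch: "schwarz k d \<Phi>"
    unfolding \<Phi>_def
  proof (rule kraus_schwarz)
    fix a b assume ab: "a < k" "b < k"
    have "(\<Sum>i<k. \<Sum>r<d. cnj (K i r a) * K i r b) = (\<Sum>i<k. if i = a then (if a = b then (\<Sum>r<d. \<phi> a $ r * cnj (\<phi> a $ r)) else 0) else 0)"
      by (intro sum.cong refl) (auto simp: K_def mult.commute)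
    then show "(\<Sum>i<k. \<Sum>r<d. cnj (K i r a) * K i r b) = (if a = b then 1 else 0)"
      using ab unit_vec_d_complex[OF u] by simp
  qed
  define D where "D x = mat k k (\<lambda>(r, s). if r = s then complex_of_real (x r) else 0)" for x
  have Dspec: "spec k (D x) {..<k} (\<lambda>c r. if r = c then 1 else 0) x" for x
    by (rule diag_spec) (auto simp: D_def bij_betw_def)
  have Dvn: "vn_entropy (D x) = (\<Sum>i<k. eta (x i))" for x by (rule spec_vn_entropy[OF Dspec])
  have D\<Phi>: "\<Phi> (D x) = mix d k \<phi> x" for x
  proof (rule eq_matI)
    fix r s assume "r < dim_row (mix d k \<phi> x)" "s < dim_col (mix d k \<phi> x)"
    then have rs: "r < d" "s < d" by (auto simp: mix_def msum_def)
    have "bil k (\<lambda>u v. D x $$ (u, v)) (\<lambda>u. cnj (K i r u)) (\<lambda>v. cnj (K i s v)) = of_real (x i) * (\<phi> i $ r * cnj (\<phi> i $ s))" if "i < k" for i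
    proof -
      have "bil k (\<lambda>u v. D x $$ (u, v)) (\<lambda>u. cnj (K i r u)) (\<lambda>v. cnj (K i s v))
        = (\<Sum>a<k. \<Sum>b<k. if b = i then (if a = i then of_real (x i) * (\<phi> i $ r * cnj (\<phi> i $ s)) else 0) else 0)"
        unfolding bil_def by (intro sum.cong refl) (auto simp: K_def D_def)
      then show ?thesis using that by simp
    qed
    then show "\<Phi> (D x) $$ (r, s) = mix d k \<phi> x $$ (r, s)"
      using rs by (simp add: \<Phi>_def kraus_def mix_entry[OF u])
  qed (auto simp: \<Phi>_def kraus_def mix_def msum_def)
  have Dsum: "msum k k (\<lambda>c. D (w c)) S = D p"
    using w(2) by (auto simp: msum_def D_def intro!: eq_matI) (simp flip: of_real_sum)
  have "vn_entropy (\<Phi> (msum k k (\<lambda>c. D (w c)) S)) - (\<Sum>c\<in>S. vn_entropy (\<Phi> (D (w c))))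
     \<le> vn_entropy (msum k k (\<lambda>c. D (w c)) S) - (\<Sum>c\<in>S. vn_entropy (D (w c)))"
    by (rule data_processing[OF sch S spec_imp_psd[OF Dspec]]) (use w in auto)
  then show ?thesis
    unfolding Dsum D\<Phi> Dvn cinfo_def minfo_def by (simp add: sum_subtractf)
qed

text \<open>Time sharing with the strategy whose classical register is independent of the letter lowers the
  classical rate to the prescribed value.\<close>

lemma M_fun_le_slack:
  assumes ens: "ensemble d k p \<phi>" and S: "finite S"
    and w: "\<And>c i. c \<in> S \<Longrightarrow> i < k \<Longrightarrow> w c i \<ge> 0" "\<And>i. i < k \<Longrightarrow> (\<Sum>c\<in>S. w c i) = p i"
    and R: "R \<ge> 0" "\<delta> > 0" "minfo k p S w \<le> R + \<delta>"
  shows "M_fun d k p \<phi> R \<le> cinfo d k \<phi> S w + \<delta>"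
proof -
  note u = ensembleD(4)[OF ens]
  \<comment> \<open>Chosen so that \<open>\<mu> * (R + \<delta>) = R\<close>; for
    \<open>R = 0\<close> all weight goes to the strategy that reveals nothing.\<close>
  define \<mu> where "\<mu> = R / (R + \<delta>)"
  have \<mu>: "0 \<le> \<mu>" "\<mu> \<le> 1" using R by (auto simp: \<mu>_def)
  \<comment> \<open>The label \<open>None\<close> marks the strategy that reveals nothing about the
    letter: its joint weights are proportional to \<open>p\<close>.\<close>
  define w' where "w' x i = (case x of None \<Rightarrow> (1 - \<mu>) * p i | Some c \<Rightarrow> \<mu> * w c i)" for x i
  define S' where "S' = insert None (Some ` S)"
  have sumS': "(\<Sum>x\<in>S'. f x) = f None + (\<Sum>c\<in>S. f (Some c))" for f :: "'a option \<Rightarrow> real"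
    unfolding S'_def using S by (subst sum.insert) (auto simp: sum.reindex)
  have p1: "(\<Sum>i<k. p i) = 1" using ensembleD(3)[OF ens] .
  have w1: "(\<Sum>c\<in>S. \<Sum>i<k. w c i) = 1" using w(2) p1 by (subst sum.swap) simp
  have P: "(\<Sum>i<k. w c i) \<ge> 0" if "c \<in> S" for c using w(1) that by (intro sum_nonneg) auto
  \<comment> \<open>The terms \<open>eta \<mu>\<close> and \<open>eta (1 - \<mu>)\<close> occur in
    both sums over labels and cancel, so the classical rate scales exactly.\<close>
  have 1: "minfo k p S' w' = \<mu> * minfo k p S w"
  proof -
    have "(\<Sum>i<k. eta ((1 - \<mu>) * p i)) = (\<Sum>i<k. (1 - \<mu>) * eta (p i) + p i * eta (1 - \<mu>))"
      using \<mu> ensembleD(2)[OF ens] by (simp add: eta_mult)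
    also have "\<dots> = (1 - \<mu>) * (\<Sum>i<k. eta (p i)) + eta (1 - \<mu>)"
      by (simp add: sum.distrib p1 flip: sum_distrib_left sum_distrib_right)
    finally have a: "(\<Sum>i<k. eta ((1 - \<mu>) * p i)) = (1 - \<mu>) * (\<Sum>i<k. eta (p i)) + eta (1 - \<mu>)" .
    have "(\<Sum>c\<in>S. eta (\<mu> * (\<Sum>i<k. w c i))) = (\<Sum>c\<in>S. \<mu> * eta (\<Sum>i<k. w c i) + (\<Sum>i<k. w c i) * eta \<mu>)"
      using \<mu> P by (simp add: eta_mult)
    also have "\<dots> = \<mu> * (\<Sum>c\<in>S. eta (\<Sum>i<k. w c i)) + eta \<mu>"
      by (simp add: sum.distrib w1 flip: sum_distrib_left sum_distrib_right)
    finally have b: "(\<Sum>c\<in>S. eta (\<mu> * (\<Sum>i<k. w c i))) = \<mu> * (\<Sum>c\<in>S. eta (\<Sum>i<k. w c i)) + eta \<mu>" .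
    have "(\<Sum>c\<in>S. \<Sum>i<k. eta (\<mu> * w c i)) = (\<Sum>c\<in>S. \<Sum>i<k. \<mu> * eta (w c i) + w c i * eta \<mu>)"
      using \<mu> w by (simp add: eta_mult)
    also have "\<dots> = \<mu> * (\<Sum>c\<in>S. \<Sum>i<k. eta (w c i)) + eta \<mu>"
      by (simp add: sum.distrib w1 flip: sum_distrib_left sum_distrib_right)
    finally have c: "(\<Sum>c\<in>S. \<Sum>i<k. eta (\<mu> * w c i)) = \<mu> * (\<Sum>c\<in>S. \<Sum>i<k. eta (w c i)) + eta \<mu>" .
    show ?thesis
      unfolding minfo_def sumS' w'_def option.case sum_distrib_left[symmetric] a b c p1 by (simp add: algebra_simps)
  qed
  have 2: "cinfo d k \<phi> S' w' = (1 - \<mu>) * vn_entropy (mix d k \<phi> p) + \<mu> * cinfo d k \<phi> S w"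
  proof -
    have a: "vn_entropy (mix d k \<phi> (\<lambda>i. (1 - \<mu>) * p i)) = (1 - \<mu>) * vn_entropy (mix d k \<phi> p) + eta (1 - \<mu>)"
      using vn_entropy_mix_scale[OF u ensembleD(2)[OF ens], where c = "1 - \<mu>"] \<mu> p1 by simp
    have b: "vn_entropy (mix d k \<phi> (\<lambda>i. \<mu> * w c i)) - eta (\<Sum>i<k. \<mu> * w c i) = \<mu> * (vn_entropy (mix d k \<phi> (w c)) - eta (\<Sum>i<k. w c i))" if "c \<in> S" for c
      using vn_entropy_mix_scale[OF u w(1)[OF that] \<mu>(1)] eta_mult[OF \<mu>(1) P[OF that]]
      by (simp add: algebra_simps flip: sum_distrib_left)
    have fw: "w' None = (\<lambda>i. (1 - \<mu>) * p i)" "\<And>c. w' (Some c) = (\<lambda>i. \<mu> * w c i)" by (auto simp: w'_def)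
    show ?thesis
      unfolding cinfo_def sumS' fw a
      by (simp add: b p1 sum_distrib_left[of \<mu> _ S] flip: sum_distrib_left[of "1 - \<mu>"])
  qed
  have "M_fun d k p \<phi> R \<le> cinfo d k \<phi> S' w'"
  proof (rule M_fun_le[OF ens])
    show "finite S'" using S by (simp add: S'_def)
    show "w' c i \<ge> 0" if "c \<in> S'" "i < k" for c i
      using that \<mu> w(1) ensembleD(2)[OF ens] by (auto simp: w'_def S'_def)
    show "(\<Sum>c\<in>S'. w' c i) = p i" if "i < k" for i
      unfolding sumS' using w(2)[OF that] by (simp add: w'_def algebra_simps flip: sum_distrib_left)
    have "\<mu> * minfo k p S w \<le> \<mu> * (R + \<delta>)" using R(3) \<mu>(1) by (rule mult_left_mono)
    also have "\<dots> = R" using R by (simp add: \<mu>_def)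
    finally show "minfo k p S' w' \<le> R" unfolding 1 .
  qed
  \<comment> \<open>The loss is \<open>1 - \<mu>\<close> times a difference that
    \<open>cinfo_minfo\<close> bounds by \<open>minfo\<close>, hence by
    \<open>R + \<delta>\<close>.\<close>
  also have "\<dots> = cinfo d k \<phi> S w + (1 - \<mu>) * (vn_entropy (mix d k \<phi> p) - cinfo d k \<phi> S w)"
    unfolding 2 by (simp add: algebra_simps)
  also have "\<dots> \<le> cinfo d k \<phi> S w + (1 - \<mu>) * (R + \<delta>)"
    using cinfo_minfo[OF ens S w] R(3) \<mu> by (intro add_left_mono mult_left_mono) auto
  also have "(1 - \<mu>) * (R + \<delta>) = \<delta>" using R by (simp add: \<mu>_def field_simps)
  finally show ?thesis .
qed

section \<open>Decoding a single letter\<close>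

lemma triple_eq_iff:
  fixes h r l h' r' l' d L :: nat
  assumes "r < d" "r' < d" "l < L" "l' < L"
  shows "(h * d + r) * L + l = (h' * d + r') * L + l' \<longleftrightarrow> h = h' \<and> r = r' \<and> l = l'"
proof
  assume e: "(h * d + r) * L + l = (h' * d + r') * L + l'"
  have L: "((h * d + r) * L + l) div L = h * d + r" "((h' * d + r') * L + l') div L = h' * d + r'"
    "((h * d + r) * L + l) mod L = l" "((h' * d + r') * L + l') mod L = l'"
    using assms by auto
  then have "h * d + r = h' * d + r'" "l = l'" using e by metis+
  moreover have "(h * d + r) div d = h" "(h' * d + r') div d = h'" "(h * d + r) mod d = r" "(h' * d + r') mod d = r'"
    using assms by auto
  ultimately show "h = h' \<and> r = r' \<and> l = l'" by metis
qed simp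

lemma triple_decompose:
  fixes H d L u :: nat
  assumes "u < H * d * L"
  obtains h r l where "h < H" "r < d" "l < L" "u = (h * d + r) * L + l"
proof -
  have md: "L > 0" "d > 0" using assms by (auto intro!: gr0I)
  have 1: "u div L < H * d" using assms by (rule less_mult_imp_div_less)
  then have 2: "u div L div d < H" by (rule less_mult_imp_div_less)
  show ?thesis
    by (rule that[of "u div L div d" "u div L mod d" "u mod L"]) (use 2 md in auto)
qed

text \<open>Appending a fixed classical message is an isometry, so decoding a given message is a
  channel on the quantum register alone.\<close>

definition embed :: "nat \<Rightarrow> nat \<Rightarrow> nat \<Rightarrow> complex mat \<Rightarrow> complex mat" where
  "embed dB dC j = kraus dB (dB * dC) {()} (\<lambda>_ r u. if r = u * dC + j then 1 else 0)"

lemma embed_schwarz: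
  assumes "j < dC"
  shows "schwarz dB (dB * dC) (embed dB dC j)"
  unfolding embed_def
proof (rule kraus_schwarz)
  fix u v assume uv: "u < dB" "v < dB"
  have inj: "u * dC + j = v * dC + j \<longleftrightarrow> u = v" using assms by auto
  have "(\<Sum>r<dB * dC. cnj (if r = u * dC + j then 1 else 0) * (if r = v * dC + j then 1 else 0))
      = (\<Sum>r<dB * dC. if r = u * dC + j then (if u = v then 1 else 0 :: complex) else 0)"
    using inj by (intro sum.cong refl) auto
  then show "(\<Sum>a\<in>{()}. \<Sum>r<dB * dC. cnj (if r = u * dC + j then 1 else 0) * (if r = v * dC + j then 1 else 0)) = (if u = v then 1 else 0 :: complex)"
    using pair_less[OF uv(1) assms] by simp
qed

lemma embed_eq_mkron:
  assumes X: "X \<in> carrier_mat dB dB" and j: "j < dC"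
  shows "embed dB dC j X = mkron X (ketbra dC j)"
proof (rule eq_matI)
  fix r s assume "r < dim_row (mkron X (ketbra dC j))" "s < dim_col (mkron X (ketbra dC j))"
  then have rs: "r < dB * dC" "s < dB * dC" using X by (auto simp: mkron_def ketbra_def)
  have "r \<in> (\<lambda>(a, c). a * dC + c) ` ({..<dB} \<times> {..<dC})" "s \<in> (\<lambda>(a, c). a * dC + c) ` ({..<dB} \<times> {..<dC})"
    using rs bij_betw_div_mod[of dC dB] by (auto simp: bij_betw_def)
  then obtain a c a' c' where ac: "r = a * dC + c" "s = a' * dC + c'" "a < dB" "c < dC" "a' < dB" "c' < dC" by auto
  have eq: "x * dC + y = x' * dC + j \<longleftrightarrow> x' = x \<and> y = j" if "y < dC" for x y x'
    using triple_eq_iff[of 0 1 0 y dC j x x'] that j by auto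
  have "bil dB (ent X) (\<lambda>u. cnj (if r = u * dC + j then 1 else 0)) (\<lambda>v. cnj (if s = v * dC + j then 1 else 0))
     = (\<Sum>u<dB. \<Sum>v<dB. if v = a' then (if u = a then (if c = j \<and> c' = j then X $$ (a, a') else 0) else 0) else 0)"
    unfolding bil_def ac eq[OF ac(4)] eq[OF ac(6)] by (intro sum.cong refl) auto
  also have "\<dots> = mkron X (ketbra dC j) $$ (r, s)"
    unfolding ac by (subst mkron_entry[OF X]) (use ac in \<open>auto simp: ketbra_def\<close>)
  finally show "embed dB dC j X $$ (r, s) = mkron X (ketbra dC j) $$ (r, s)"
    using rs by (simp add: embed_def kraus_def)
qed (use X in \<open>auto simp: embed_def kraus_def mkron_def ketbra_def\<close>)

text \<open>The partial trace over the outer factors of \<open>\<complex>\<^sup>H \<otimes> \<complex>\<^sup>d \<otimes> \<complex>\<^sup>L\<close>.\<close>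

definition letter :: "nat \<Rightarrow> nat \<Rightarrow> nat \<Rightarrow> complex mat \<Rightarrow> complex mat" where
  "letter H d L = kraus (H * d * L) d ({..<H} \<times> {..<L}) (\<lambda>(h, l) r u. if u = (h * d + r) * L + l then 1 else 0)"

lemma sum_Times: "(\<Sum>a\<in>A \<times> B. g a) = (\<Sum>h\<in>A. \<Sum>l\<in>B. g (h, l))"
  by (simp add: sum.cartesian_product)

lemma letter_schwarz: "schwarz (H * d * L) d (letter H d L)"
  unfolding letter_def
proof (rule kraus_schwarz)
  fix u v assume uv: "u < H * d * L" "v < H * d * L"
  obtain h r l where u: "h < H" "r < d" "l < L" "u = (h * d + r) * L + l" using triple_decompose[OF uv(1)] .
  let ?K = "\<lambda>(h, l) r u. if u = (h * d + r) * L + l then (1 :: complex) else 0"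
  have "(\<Sum>a\<in>{..<H} \<times> {..<L}. \<Sum>r'<d. cnj (?K a r' u) * ?K a r' v)
     = (\<Sum>h'<H. \<Sum>l'<L. \<Sum>r'<d. cnj (?K (h', l') r' u) * ?K (h', l') r' v)"
    by (simp only: sum_Times)
  also have "\<dots> = (\<Sum>h'<H. \<Sum>l'<L. \<Sum>r'<d. if r' = r then (if l' = l then (if h' = h then (if u = v then 1 else 0) else 0) else 0) else 0)"
  proof (intro sum.cong refl)
    fix h' l' r' assume a: "h' \<in> {..<H}" "l' \<in> {..<L}" "r' \<in> {..<d}"
    then have "u = (h' * d + r') * L + l' \<longleftrightarrow> h = h' \<and> r = r' \<and> l = l'"
      unfolding u(4) using u by (intro triple_eq_iff) auto
    then show "cnj (?K (h', l') r' u) * ?K (h', l') r' v = (if r' = r then (if l' = l then (if h' = h then (if u = v then 1 else 0) else 0) else 0) else 0)"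
      using u(4) by auto
  qed
  also have "\<dots> = (if u = v then 1 else 0)" using u by simp
  finally show "(\<Sum>a\<in>{..<H} \<times> {..<L}. \<Sum>r'<d. cnj (?K a r' u) * ?K a r' v) = (if u = v then 1 else 0)" .
qed

text \<open>Cauchy-Schwarz, from the squared distance of \<open>z\<close> to its projection onto the
  conjugate of \<open>c\<close>.\<close>

lemma bessel_unit:
  fixes c z :: "'a \<Rightarrow> complex"
  assumes "(\<Sum>a\<in>A. nsq (c a)) = 1"
  shows "nsq (\<Sum>a\<in>A. c a * z a) \<le> (\<Sum>a\<in>A. nsq (z a))"
proof -
  define s where "s = (\<Sum>a\<in>A. c a * z a)"
  have sq: "nsq (x - s * cnj y) = (cmod x)\<^sup>2 - 2 * Re (cnj s * (y * x)) + (cmod s)\<^sup>2 * (cmod y)\<^sup>2" for x y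
    unfolding cmod_power2 by (simp add: algebra_simps power2_eq_square)
  have "0 \<le> (\<Sum>a\<in>A. nsq (z a - s * cnj (c a)))" by (intro sum_nonneg) auto
  also have "\<dots> = (\<Sum>a\<in>A. nsq (z a)) - 2 * Re (\<Sum>a\<in>A. cnj s * (c a * z a)) + (cmod s)\<^sup>2 * (\<Sum>a\<in>A. nsq (c a))"
    unfolding sq sum.distrib sum_subtractf Re_sum sum_distrib_left by simp
  also have "Re (\<Sum>a\<in>A. cnj s * (c a * z a)) = (cmod s)\<^sup>2"
    unfolding sum_distrib_left[symmetric] s_def[symmetric] cmod_power2 by (simp add: power2_eq_square)
  finally show ?thesis using assms by (simp add: s_def)
qed

lemma qf_superposition_le:
  assumes X: "psd n X" and c: "(\<Sum>a\<in>A. nsq (c a)) = 1"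
  shows "Re (qf n X (\<lambda>u. \<Sum>a\<in>A. c a * e a u)) \<le> (\<Sum>a\<in>A. Re (qf n X (e a)))"
proof -
  obtain U l where s: "spec n X {..<n} U l" and l: "\<And>i. i < n \<Longrightarrow> l i \<ge> 0" using psd_spec[OF X] by blast
  have "Re (qf n X (\<lambda>u. \<Sum>a\<in>A. c a * e a u)) = (\<Sum>i<n. l i * nsq (\<Sum>a\<in>A. c a * ip n (U i) (e a)))"
    by (simp add: spec_qf[OF s] ip_sum_right)
  also have "\<dots> \<le> (\<Sum>i<n. l i * (\<Sum>a\<in>A. nsq (ip n (U i) (e a))))"
    using l c by (intro sum_mono mult_left_mono bessel_unit) auto
  also have "\<dots> = (\<Sum>a\<in>A. Re (qf n X (e a)))"
    unfolding sum_distrib_left by (subst sum.swap) (simp add: spec_qf[OF s])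
  finally show ?thesis .
qed

lemma qf_cong: "(\<And>r. r < n \<Longrightarrow> u r = v r) \<Longrightarrow> qf n X u = qf n X v"
  unfolding bil_def by (intro sum.cong) auto

text \<open>The product vector is a superposition, with coefficients \<open>x h * y l\<close> of
  total norm 1, of exactly those vectors over which the partial trace sums;
  \<open>qf_superposition_le\<close> compares the two.\<close>

lemma letter_fidelity:
  assumes X: "psd (H * d * L) X"
    and x: "(\<Sum>h<H. nsq (x h)) = 1" and y: "(\<Sum>l<L. nsq (y l)) = 1"
    and v: "\<And>h r l. h < H \<Longrightarrow> r < d \<Longrightarrow> l < L \<Longrightarrow> v ((h * d + r) * L + l) = x h * f r * y l"
  shows "Re (qf (H * d * L) X v) \<le> Re (qf d (letter H d L X) f)"
proof -
  let ?K = "\<lambda>(h, l) r u. if u = (h * d + r) * L + l then (1 :: complex) else 0"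
  let ?e = "\<lambda>a u. \<Sum>r<d. f r * cnj (?K a r u)"
  let ?c = "\<lambda>a. x (fst a) * y (snd a)"
  have c: "(\<Sum>a\<in>{..<H} \<times> {..<L}. nsq (?c a)) = 1"
  proof -
    have "(\<Sum>a\<in>{..<H} \<times> {..<L}. nsq (?c a)) = (\<Sum>h<H. \<Sum>l<L. nsq (x h) * nsq (y l))"
      by (simp add: sum.cartesian_product case_prod_unfold norm_mult power_mult_distrib)
    then show ?thesis using x y by (simp flip: sum_product)
  qed
  have e: "qf (H * d * L) X v = qf (H * d * L) X (\<lambda>u. \<Sum>a\<in>{..<H} \<times> {..<L}. ?c a * ?e a u)"
  proof (rule qf_cong)
    fix u assume "u < H * d * L"
    then obtain h r l where u: "h < H" "r < d" "l < L" "u = (h * d + r) * L + l" using triple_decompose by blast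
    have "(\<Sum>a\<in>{..<H} \<times> {..<L}. ?c a * ?e a u) = (\<Sum>h'<H. \<Sum>l'<L. \<Sum>r'<d. x h' * y l' * (f r' * cnj (?K (h', l') r' u)))"
      by (simp add: sum_Times sum_distrib_left)
    also have "\<dots> = (\<Sum>h'<H. \<Sum>l'<L. \<Sum>r'<d. if r' = r then (if l' = l then (if h' = h then x h * f r * y l else 0) else 0) else 0)"
    proof (intro sum.cong refl)
      fix h' l' r' assume a: "h' \<in> {..<H}" "l' \<in> {..<L}" "r' \<in> {..<d}"
      then have "u = (h' * d + r') * L + l' \<longleftrightarrow> h = h' \<and> r = r' \<and> l = l'"
        unfolding u(4) using u by (intro triple_eq_iff) auto
      then show "x h' * y l' * (f r' * cnj (?K (h', l') r' u)) = (if r' = r then (if l' = l then (if h' = h then x h * f r * y l else 0) else 0) else 0)"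
        by auto
    qed
    also have "\<dots> = v u" using u v by simp
    finally show "v u = (\<Sum>a\<in>{..<H} \<times> {..<L}. ?c a * ?e a u)" by simp
  qed
  have "Re (qf (H * d * L) X v) \<le> (\<Sum>a\<in>{..<H} \<times> {..<L}. Re (qf (H * d * L) X (?e a)))"
    unfolding e by (rule qf_superposition_le[where c = ?c and e = ?e, OF X c])
  also have "\<dots> = Re (qf d (letter H d L X) f)"
    by (simp add: letter_def bil_kraus)
  finally show ?thesis .
qed

section \<open>Product states of a block\<close>

lemma tens_state_dim: "(\<And>t. t < n \<Longrightarrow> dim_vec (\<phi> (I t)) = d) \<Longrightarrow> dim_vec (tens_state \<phi> I n) = d ^ n"
  by (induction n) (auto simp: vkron_def)

lemma vkron_entry:
  assumes "dim_vec v = d" "a < dim_vec u" "b < d"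
  shows "vkron u v $ (a * d + b) = u $ a * v $ b"
  using assms pair_less[of a "dim_vec u" b d] by (simp add: vkron_def)

lemma sum_pair_index: "(\<Sum>r<k * m. f r) = (\<Sum>a<k. \<Sum>c<m. f (a * m + c))" for f :: "nat \<Rightarrow> 'b::comm_monoid_add"
  by (simp add: sum.reindex_bij_betw[OF bij_betw_div_mod, symmetric] sum.cartesian_product case_prod_unfold)

lemma tens_state_unit:
  assumes "\<And>t. t < n \<Longrightarrow> unit_vec_d d (\<phi> (I t))"
  shows "(\<Sum>r<d ^ n. nsq (tens_state \<phi> I n $ r)) = 1"
  using assms
proof (induction n)
  case (Suc n)
  have dims: "dim_vec (\<phi> (I n)) = d" "dim_vec (tens_state \<phi> I n) = d ^ n"
    using Suc.prems by (auto simp: unit_vec_d_def intro!: tens_state_dim)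
  have "(\<Sum>r<d ^ Suc n. nsq (tens_state \<phi> I (Suc n) $ r))
     = (\<Sum>r<d ^ n * d. nsq (tens_state \<phi> I (Suc n) $ r))" by (simp add: mult.commute)
  also have "\<dots> = (\<Sum>a<d ^ n. \<Sum>b<d. nsq (tens_state \<phi> I n $ a) * nsq (\<phi> (I n) $ b))"
    unfolding sum_pair_index using dims by (intro sum.cong refl) (simp add: vkron_entry norm_mult power_mult_distrib)
  also have "\<dots> = 1"
    using Suc by (simp add: unit_vec_d_def flip: sum_product)
  finally show ?case .
qed simp

text \<open>Induction on the number \<open>e\<close> of letters after position \<open>t\<close>. The
  tail \<open>y\<close> is only asserted to exist, since its norm is all that the fidelity bound
  uses.\<close>

lemma tens_state_factor:
  assumes "\<And>s. s < Suc (t + e) \<Longrightarrow> unit_vec_d d (\<phi> (I s))"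
  shows "\<exists>y. (\<Sum>l<d ^ e. nsq (y l)) = 1 \<and> (\<forall>h<d ^ t. \<forall>r<d. \<forall>l<d ^ e.
    tens_state \<phi> I (Suc (t + e)) $ ((h * d + r) * d ^ e + l) = tens_state \<phi> I t $ h * \<phi> (I t) $ r * y l)"
  using assms
proof (induction e)
  case 0
  have dims: "dim_vec (\<phi> (I t)) = d" "dim_vec (tens_state \<phi> I t) = d ^ t"
    using 0 by (auto simp: unit_vec_d_def intro!: tens_state_dim)
  show ?case by (rule exI[of _ "\<lambda>_. 1"]) (simp add: vkron_entry dims)
next
  case (Suc e)
  obtain y where y: "(\<Sum>l<d ^ e. nsq (y l)) = 1"
    "\<And>h r l. h < d ^ t \<Longrightarrow> r < d \<Longrightarrow> l < d ^ e \<Longrightarrow> tens_state \<phi> I (Suc (t + e)) $ ((h * d + r) * d ^ e + l) = tens_state \<phi> I t $ h * \<phi> (I t) $ r * y l"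
    using Suc by auto
  let ?v = "\<phi> (I (Suc (t + e)))"
  have u: "unit_vec_d d ?v" using Suc.prems by simp
  have dims: "dim_vec ?v = d" "dim_vec (tens_state \<phi> I (Suc (t + e))) = d ^ Suc (t + e)"
  proof -
    show "dim_vec ?v = d" using u by (simp add: unit_vec_d_def)
    show "dim_vec (tens_state \<phi> I (Suc (t + e))) = d ^ Suc (t + e)"
      by (rule tens_state_dim) (use Suc.prems in \<open>auto simp: unit_vec_d_def\<close>)
  qed
  define y' where "y' l = y (l div d) * ?v $ (l mod d)" for l
  have "(\<Sum>l<d ^ Suc e. nsq (y' l)) = (\<Sum>l<d ^ e * d. nsq (y' l))" by (simp add: mult.commute)
  also have "\<dots> = (\<Sum>a<d ^ e. \<Sum>b<d. nsq (y a) * nsq (?v $ b))"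
    unfolding sum_pair_index by (intro sum.cong refl) (simp add: y'_def norm_mult power_mult_distrib)
  also have "\<dots> = 1" using y(1) u by (simp add: unit_vec_d_def flip: sum_product)
  finally have 1: "(\<Sum>l<d ^ Suc e. nsq (y' l)) = 1" .
  have "tens_state \<phi> I (Suc (t + Suc e)) $ ((h * d + r) * d ^ Suc e + l) = tens_state \<phi> I t $ h * \<phi> (I t) $ r * y' l"
    if h: "h < d ^ t" and r: "r < d" and l: "l < d ^ Suc e" for h r l
  proof -
    have d0: "0 < d" using r by simp
    have ld: "l div d < d ^ e" using l by (simp add: less_mult_imp_div_less mult.commute)
    have idx: "(h * d + r) * d ^ Suc e + l = ((h * d + r) * d ^ e + l div d) * d + l mod d"
      by (simp add: algebra_simps)
    have lt: "(h * d + r) * d ^ e + l div d < d ^ Suc (t + e)"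
    proof -
      have "h * d + r < d ^ t * d" using h r by (rule pair_less)
      then have "(h * d + r) * d ^ e + l div d < d ^ t * d * d ^ e" using ld by (rule pair_less)
      then show ?thesis by (simp add: power_add mult_ac)
    qed
    have "tens_state \<phi> I (Suc (t + Suc e)) $ ((h * d + r) * d ^ Suc e + l)
      = vkron (tens_state \<phi> I (Suc (t + e))) ?v $ (((h * d + r) * d ^ e + l div d) * d + l mod d)"
      unfolding idx by simp
    also have "\<dots> = tens_state \<phi> I (Suc (t + e)) $ ((h * d + r) * d ^ e + l div d) * ?v $ (l mod d)"
      by (rule vkron_entry) (use dims lt d0 in \<open>simp_all del: tens_state.simps\<close>)
    finally show ?thesis unfolding y(2)[OF h r ld] by (simp add: y'_def)
  qed
  then show ?case using 1 by blast
qed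

lemma tens_state_fidelity:
  assumes u: "\<And>s. s < n \<Longrightarrow> unit_vec_d d (\<phi> (I s))" and t: "t < n" and X: "psd (d ^ n) X"
  shows "Re (qform X (tens_state \<phi> I n)) \<le> Re (qform (letter (d ^ t) d (d ^ (n - Suc t)) X) (\<phi> (I t)))"
proof -
  define e where "e = n - Suc t"
  have n: "n = Suc (t + e)" using t by (simp add: e_def)
  have dn: "d ^ n = d ^ t * d * d ^ e" by (simp add: n power_add mult_ac)
  obtain y where y: "(\<Sum>l<d ^ e. nsq (y l)) = 1"
    "\<And>h r l. h < d ^ t \<Longrightarrow> r < d \<Longrightarrow> l < d ^ e \<Longrightarrow> tens_state \<phi> I n $ ((h * d + r) * d ^ e + l) = tens_state \<phi> I t $ h * \<phi> (I t) $ r * y l"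
    using tens_state_factor[of t e d \<phi> I] u unfolding n by blast
  have v: "tens_state \<phi> I n \<in> carrier_vec (d ^ n)"
    using u by (intro carrier_vecI tens_state_dim) (auto simp: unit_vec_d_def)
  have f: "\<phi> (I t) \<in> carrier_vec d" using u[OF t] by (simp add: unit_vec_d_def)
  show ?thesis
    unfolding qform_eq_qf[OF v] qform_eq_qf[OF f] e_def[symmetric] unfolding dn
    by (rule letter_fidelity[where x = "\<lambda>h. tens_state \<phi> I t $ h" and y = y])
      (use X y tens_state_unit[of t d \<phi> I] u t in \<open>auto simp: dn\<close>)
qed

lemma schwarz_smult:
  assumes "schwarz n m \<Phi>" "X \<in> carrier_mat n n"
  shows "\<Phi> (c \<cdot>\<^sub>m X) = c \<cdot>\<^sub>m \<Phi> X"
proof -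
  have car: "\<Phi> (c \<cdot>\<^sub>m X) \<in> carrier_mat m m" "\<Phi> X \<in> carrier_mat m m" using assms by (auto simp: schwarz_def)
  show ?thesis
  proof (rule eq_matI)
    fix r s assume "r < dim_row (c \<cdot>\<^sub>m \<Phi> X)" "s < dim_col (c \<cdot>\<^sub>m \<Phi> X)"
    then have rs: "r < m" "s < m" using car by auto
    obtain W where W: "\<And>X. X \<in> carrier_mat n n \<Longrightarrow> \<Phi> X $$ (r, s) = hs n W (ent X)"
      using schwarz_entry[OF assms(1) rs] by blast
    have "\<Phi> (c \<cdot>\<^sub>m X) $$ (r, s) = hs n W (\<lambda>x y. c * X $$ (x, y))"
      unfolding W[OF smult_carrier_mat[OF assms(2)]] using assms(2) by (intro hs_cong) auto
    also have "\<dots> = c * hs n W (ent X)"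
      by (simp add: hs_def sum_distrib_left mult_ac)
    also have "\<dots> = c * \<Phi> X $$ (r, s)" using W[OF assms(2)] by simp
    finally show "\<Phi> (c \<cdot>\<^sub>m X) $$ (r, s) = (c \<cdot>\<^sub>m \<Phi> X) $$ (r, s)"
      using rs car by simp
  qed (use car in auto)
qed

lemma qf_schwarz_combination:
  assumes \<Phi>: "schwarz n m \<Phi>" and X: "\<And>k. k \<in> K \<Longrightarrow> X k \<in> carrier_mat n n"
  shows "qf m (\<Phi> (msum n n (\<lambda>k. c k \<cdot>\<^sub>m X k) K)) v = (\<Sum>k\<in>K. c k * qf m (\<Phi> (X k)) v)"
proof -
  have 1: "\<Phi> (msum n n (\<lambda>k. c k \<cdot>\<^sub>m X k) K) = msum m m (\<lambda>k. \<Phi> (c k \<cdot>\<^sub>m X k)) K"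
    using X by (intro schwarz_msum[OF \<Phi>]) auto
  have 2: "qf m (\<Phi> (c k \<cdot>\<^sub>m X k)) v = c k * qf m (\<Phi> (X k)) v" if "k \<in> K" for k
  proof -
    have "\<Phi> (X k) \<in> carrier_mat m m" using \<Phi> X[OF that] by (auto simp: schwarz_def)
    then show ?thesis
      unfolding schwarz_smult[OF \<Phi> X[OF that]] by (simp add: bil_def sum_distrib_left mult_ac)
  qed
  show ?thesis unfolding 1 qf_msum using 2 by simp
qed

section \<open>Chain rule over the letters of a block\<close>

abbreviation fiber :: "nat \<Rightarrow> nat \<Rightarrow> nat \<Rightarrow> (nat \<Rightarrow> nat) \<Rightarrow> (nat \<Rightarrow> nat) set" where
  "fiber n k t x \<equiv> {I \<in> strings n k. restrict I {..<t} = x}"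

text \<open>Sum over the strings that begin with the prefix \<open>x\<close>. The value type is
  general because both real weights and complex matrix entries are summed this way.\<close>

definition marg :: "nat \<Rightarrow> nat \<Rightarrow> nat \<Rightarrow> (nat \<Rightarrow> nat) \<Rightarrow> ((nat \<Rightarrow> nat) \<Rightarrow> 'a::comm_monoid_add) \<Rightarrow> 'a" where
  "marg n k t x f = (\<Sum>I\<in>fiber n k t x. f I)"

lemma finite_strings [simp]: "finite (strings n k)"
  by (intro finite_PiE) auto

lemma sum_strings_Suc: "(\<Sum>y\<in>strings (Suc t) k. h y) = (\<Sum>x\<in>strings t k. \<Sum>i<k. h (x(t := i)))"
proof -
  have "strings (Suc t) k = (\<lambda>(i, x). x(t := i)) ` ({..<k} \<times> strings t k)"
    unfolding lessThan_Suc PiE_insert_eq by simp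
  moreover have "inj_on (\<lambda>(i, x). x(t := i)) ({..<k} \<times> strings t k)"
    using inj_combinator[of t "{..<t}" "\<lambda>_. {..<k}"] by simp
  ultimately have "(\<Sum>y\<in>strings (Suc t) k. h y) = (\<Sum>i<k. \<Sum>x\<in>strings t k. h (x(t := i)))"
    by (simp add: sum.reindex sum.cartesian_product case_prod_unfold)
  also have "\<dots> = (\<Sum>x\<in>strings t k. \<Sum>i<k. h (x(t := i)))" by (rule sum.swap)
  finally show ?thesis .
qed

lemma restrict_Suc_iff:
  assumes "x \<in> strings t k"
  shows "restrict I {..<Suc t} = x(t := i) \<longleftrightarrow> restrict I {..<t} = x \<and> I t = i"
proof -
  have x: "x s = undefined" if "\<not> s < t" for s using assms that by (auto simp: PiE_def extensional_def)
  show ?thesis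
  proof
    assume e: "restrict I {..<Suc t} = x(t := i)"
    have "restrict I {..<t} s = x s" for s
      using fun_cong[OF e, of s] x[of s] by (auto simp: restrict_def split: if_splits)
    then show "restrict I {..<t} = x \<and> I t = i" using fun_cong[OF e, of t] by auto
  next
    assume e: "restrict I {..<t} = x \<and> I t = i"
    have "restrict I {..<Suc t} = (restrict I {..<t})(t := I t)"
      by (auto simp: fun_eq_iff restrict_def less_Suc_eq)
    then show "restrict I {..<Suc t} = x(t := i)" using e by simp
  qed
qed

lemma marg_cong:
  assumes "\<And>I. I \<in> strings n k \<Longrightarrow> restrict I {..<t} = x \<Longrightarrow> f I = f' I"
  shows "marg n k t x f = marg n k t x f'"
  unfolding marg_def using assms by (intro sum.cong) auto

lemma marg_step:
  assumes "x \<in> strings t k" "t < n"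
  shows "marg n k t x f = (\<Sum>i<k. marg n k (Suc t) (x(t := i)) f)"
proof -
  let ?S = "fiber n k t x"
  have "marg n k t x f = (\<Sum>i<k. \<Sum>I\<in>{I \<in> ?S. I t = i}. f I)"
    unfolding marg_def by (rule sum.group[symmetric]) (use assms in auto)
  also have "\<dots> = (\<Sum>i<k. marg n k (Suc t) (x(t := i)) f)"
    unfolding marg_def restrict_Suc_iff[OF assms(1)] by (intro sum.cong) auto
  finally show ?thesis .
qed

lemma marg_total:
  assumes "t \<le> n"
  shows "(\<Sum>x\<in>strings t k. marg n k t x f) = (\<Sum>I\<in>strings n k. f I)"
proof -
  have "(\<lambda>I. restrict I {..<t}) ` strings n k \<subseteq> strings t k"
  proof (rule image_subsetI)
    fix I assume I: "I \<in> strings n k"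
    have "I s \<in> {..<k}" if "s \<in> {..<t}" for s
      by (rule PiE_mem[OF I]) (use that assms in simp)
    then show "restrict I {..<t} \<in> strings t k" unfolding restrict_PiE_iff by blast
  qed
  then show ?thesis unfolding marg_def by (rule sum.group[OF finite_strings finite_strings])
qed

lemma marg_full: "x \<in> strings n k \<Longrightarrow> marg n k n x f = f x"
proof -
  assume x: "x \<in> strings n k"
  have "I \<in> strings n k \<and> restrict I {..<n} = x \<longleftrightarrow> I = x" for I
    using x PiE_restrict[OF x] PiE_restrict[of I "{..<n}" "\<lambda>_. {..<k}"] by metis
  then have "fiber n k n x = {x}" by blast
  then show ?thesis by (simp add: marg_def)
qed

lemma sum_prod_strings:
  fixes p h :: "nat \<Rightarrow> real"
  assumes t: "t < n" and p: "(\<Sum>i<k. p i) = 1"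
  shows "(\<Sum>I\<in>strings n k. (\<Prod>s<n. p (I s)) * h (I t)) = (\<Sum>i<k. p i * h i)"
proof -
  \<comment> \<open>Every factor except that of position \<open>t\<close> sums to 1.\<close>
  define f where "f s y = p y * (if s = t then h y else 1)" for s y
  have "(\<Sum>I\<in>strings n k. (\<Prod>s<n. p (I s)) * h (I t)) = (\<Sum>I\<in>strings n k. \<Prod>s<n. f s (I s))"
    using t by (intro sum.cong refl) (simp add: f_def prod.distrib)
  also have "\<dots> = (\<Prod>s<n. \<Sum>y<k. f s y)" by (rule prod_sum_PiE[symmetric]) auto
  also have "\<dots> = (\<Prod>s<n. if s = t then (\<Sum>i<k. p i * h i) else 1)"
    by (intro prod.cong refl) (simp add: f_def p)
  finally show ?thesis using t by simp
qed

lemma sum_prod_strings_1: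
  fixes p :: "nat \<Rightarrow> real"
  assumes "(\<Sum>i<k. p i) = 1"
  shows "(\<Sum>I\<in>strings n k. (\<Prod>s<n. p (I s))) = 1"
  using prod_sum_PiE[of "{..<n}" "\<lambda>_. {..<k}" "\<lambda>_. p"] assms by simp

text \<open>The logarithm of the product is a sum whose terms involve one position each, and the
  other factors sum out. Strings of probability 0 contribute nothing on either side, whatever the
  value of \<open>log 2 0\<close>.\<close>

lemma eta_product_strings:
  fixes p :: "nat \<Rightarrow> real"
  assumes p0: "\<And>i. i < k \<Longrightarrow> p i \<ge> 0" and p1: "(\<Sum>i<k. p i) = 1"
  shows "(\<Sum>I\<in>strings n k. eta (\<Prod>s<n. p (I s))) = n * (\<Sum>i<k. eta (p i))"
proof -
  have "eta (\<Prod>s<n. p (I s)) = (\<Sum>t<n. (\<Prod>s<n. p (I s)) * (- log 2 (p (I t))))" if I: "I \<in> strings n k" for I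
  proof (cases "\<exists>s<n. p (I s) = 0")
    case True
    then have z: "(\<Prod>s<n. p (I s)) = 0" by auto
    show ?thesis unfolding z by simp
  next
    case False
    have pos: "p (I s) > 0" if "s < n" for s
    proof -
      have "I s < k" using I that by auto
      then show ?thesis using p0[of "I s"] False that by force
    qed
    then have "(\<Prod>s<n. p (I s)) > 0" by (intro prod_pos) auto
    moreover have "log 2 (\<Prod>s<n. p (I s)) = (\<Sum>s<n. log 2 (p (I s)))"
      unfolding log_def by (subst ln_prod) (use pos in \<open>force simp: sum_divide_distrib\<close>)+
    ultimately show ?thesis by (simp add: eta_def sum_distrib_left sum_negf)
  qed
  then have "(\<Sum>I\<in>strings n k. eta (\<Prod>s<n. p (I s))) = (\<Sum>I\<in>strings n k. \<Sum>t<n. (\<Prod>s<n. p (I s)) * (- log 2 (p (I t))))"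
    by (intro sum.cong) auto
  also have "\<dots> = (\<Sum>t<n. \<Sum>I\<in>strings n k. (\<Prod>s<n. p (I s)) * (- log 2 (p (I t))))" by (rule sum.swap)
  also have "\<dots> = (\<Sum>t<n. \<Sum>i<k. p i * (- log 2 (p i)))"
    by (intro sum.cong refl sum_prod_strings[OF _ p1]) auto
  also have "(\<Sum>i<k. p i * (- log 2 (p i))) = (\<Sum>i<k. eta (p i))"
  proof (intro sum.cong refl)
    fix i assume "i \<in> {..<k}"
    then have "p i \<ge> 0" using p0 by simp
    then show "p i * (- log 2 (p i)) = eta (p i)" by (cases "p i = 0") (auto simp: eta_def)
  qed
  finally show ?thesis by simp
qed

lemma psd_smult: "psd n X \<Longrightarrow> c \<ge> 0 \<Longrightarrow> psd n (of_real c \<cdot>\<^sub>m X)"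
proof -
  assume X: "psd n X" and c: "c \<ge> 0"
  have car: "X \<in> carrier_mat n n" using psd_carrier[OF X] .
  have "qf n (of_real c \<cdot>\<^sub>m X) v = of_real c * qf n X v" for v
    using car by (simp add: bil_def sum_distrib_left mult_ac)
  then show ?thesis using X c car by (simp add: psd_iff_qf)
qed

lemma mtrace_smult: "X \<in> carrier_mat n n \<Longrightarrow> mtrace (c \<cdot>\<^sub>m X) = c * mtrace X"
  by (auto simp: mtrace_def sum_distrib_left)

lemma sum_eta_le_log:
  assumes "\<And>j. j < m \<Longrightarrow> x j \<ge> 0" "(\<Sum>j<m. x j) = 1" "m \<ge> 1"
  shows "(\<Sum>j<m. eta (x j)) \<le> log 2 (real m)"
proof -
  have "(\<Sum>j<m. eta (x j)) \<le> (\<Sum>j<m. - x j * log 2 (1 / m) + (1 / m - x j) / ln 2)"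
    using assms by (intro sum_mono gibbs_term) auto
  also have "\<dots> = - log 2 (1 / m) * (\<Sum>j<m. x j) + ((\<Sum>j<m. 1 / real m) - (\<Sum>j<m. x j)) / ln 2"
    by (simp add: sum.distrib sum_subtractf sum_negf mult.commute flip: sum_distrib_right sum_divide_distrib)
  finally show ?thesis using assms by (simp add: log_divide)
qed

text \<open>\<open>\<delta>\<close> and \<open>K\<close> are parameters, so nothing here depends on
  a choice made for the block length: after averaging over positions the infidelity of the code
  enters once, not \<open>n\<close> times.\<close>

lemma code_single_letter:
  fixes n dB dC :: nat
  assumes ens: "ensemble d k p \<phi>" and code: "visible_code d k n dB dC pj \<omega> D" and n: "n \<ge> 1"
    and K: "K \<ge> 0"
    and cont: "holevo_slack d \<delta> K"
  obtains S :: "(nat \<times> nat \<times> (nat \<Rightarrow> nat)) set" and w where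
    "finite S" "\<And>c i. c \<in> S \<Longrightarrow> i < k \<Longrightarrow> w c i \<ge> 0" "\<And>i. i < k \<Longrightarrow> (\<Sum>c\<in>S. w c i) = p i"
    "minfo k p S w \<le> log 2 (real dC) / n"
    "cinfo d k \<phi> S w \<le> log 2 (real dB) / n + \<delta> + K * (1 - code_fidelity k p \<phi> n dB dC pj \<omega> D)"
proof -
  note u = ensembleD(4)[OF ens]
  note p0 = ensembleD(2)[OF ens] and p1 = ensembleD(3)[OF ens]
  have dB: "dB \<ge> 1" and dC: "dC \<ge> 1" and D: "cptp (dB * dC) (d ^ n) D"
    and pj0: "\<And>I j. I \<in> strings n k \<Longrightarrow> j < dC \<Longrightarrow> pj I j \<ge> 0"
    and dens: "\<And>I j. I \<in> strings n k \<Longrightarrow> j < dC \<Longrightarrow> density dB (\<omega> I j)"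
    and pj1: "\<And>I. I \<in> strings n k \<Longrightarrow> (\<Sum>j<dC. pj I j) = 1"
    using code by (auto simp: visible_code_def)
  have \<omega>: "psd dB (\<omega> I j)" "mtrace (\<omega> I j) = 1" if "I \<in> strings n k" "j < dC" for I j
    using dens[OF that] by (auto simp: density_def)
  have D: "schwarz (dB * dC) (d ^ n) D" by (rule qmap_imp_schwarz[OF cptp_imp_qmap[OF D]])
  define pI where "pI I = (\<Prod>s<n. p (I s))" for I
  \<comment> \<open>Joint probability of string and message.\<close>
  define g where "g j I = pI I * pj I j" for j I
  have pI0: "pI I \<ge> 0" if "I \<in> strings n k" for I
    unfolding pI_def using that p0 by (intro prod_nonneg) auto
  have g0: "g j I \<ge> 0" if "I \<in> strings n k" "j < dC" for j I
    using pI0 pj0 that by (simp add: g_def)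
  have gj: "(\<Sum>j<dC. g j I) = pI I" if "I \<in> strings n k" for I
    using pj1[OF that] by (simp add: g_def flip: sum_distrib_left)
  have g1: "(\<Sum>j<dC. \<Sum>I\<in>strings n k. g j I) = 1"
    by (subst sum.swap) (simp add: gj pI_def sum_prod_strings_1[OF p1])
  \<comment> \<open>Unnormalized state of the quantum register on the event of message
    \<open>j\<close> and prefix \<open>x\<close>; its trace \<open>P j t x\<close> is the
    probability of that event.\<close>
  define \<Omega> where "\<Omega> j t x = msum dB dB (\<lambda>I. of_real (g j I) \<cdot>\<^sub>m \<omega> I j) (fiber n k t x)" for j t x
  define P where "P j t x = marg n k t x (g j)" for j t x
  define Y where "Y j I = D (embed dB dC j (\<omega> I j))" for j I
  define f where "f j I = Re (qform (Y j I) (tens_state \<phi> I n))" for j I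
  \<comment> \<open>A prefix of length \<open>t\<close> covers the positions below \<open>t\<close>,
    so position \<open>t\<close> holds the next letter, and extending by \<open>i\<close> gives a
    prefix of length \<open>Suc t\<close>.\<close>
  define w where "w = (\<lambda>(t, j, x) i. P j (Suc t) (x(t := i)))"
  \<comment> \<open>\<open>E t\<close> is the entropy of message and prefix, and
    \<open>V t - E t\<close> the conditional entropy of the quantum register given both.\<close>
  define V where "V t = (\<Sum>j<dC. \<Sum>x\<in>strings t k. vn_entropy (\<Omega> j t x))" for t
  define E where "E t = (\<Sum>j<dC. \<Sum>x\<in>strings t k. eta (P j t x))" for t
  define fid where "fid = code_fidelity k p \<phi> n dB dC pj \<omega> D"
  have fid: "(\<Sum>j<dC. \<Sum>I\<in>strings n k. g j I * f j I) = fid"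
  proof -
    have "Re (qform (D (enc_state dB dC (pj I) (\<omega> I))) (tens_state \<phi> I n)) = (\<Sum>j<dC. pj I j * f j I)"
      if I: "I \<in> strings n k" for I
    proof -
      have v: "tens_state \<phi> I n \<in> carrier_vec (d ^ n)"
      proof (intro carrier_vecI tens_state_dim)
        fix t assume "t < n"
        then have "I t < k" using I by auto
        then show "dim_vec (\<phi> (I t)) = d" using unit_vec_d_carrier[OF u] by auto
      qed
      have "qf (d ^ n) (D (enc_state dB dC (pj I) (\<omega> I))) (\<lambda>r. tens_state \<phi> I n $ r)
         = (\<Sum>j<dC. of_real (pj I j) * qf (d ^ n) (D (mkron (\<omega> I j) (ketbra dC j))) (\<lambda>r. tens_state \<phi> I n $ r))"
        unfolding enc_state_def using \<omega>(1)[OF I]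
        by (intro qf_schwarz_combination[OF D] mkron_carrier) (auto simp: psd_carrier ketbra_def)
      also have "\<dots> = (\<Sum>j<dC. of_real (pj I j) * qform (Y j I) (tens_state \<phi> I n))"
        using embed_eq_mkron[OF psd_carrier[OF \<omega>(1)[OF I]]] by (simp add: Y_def qform_eq_qf[OF v])
      finally show ?thesis by (simp add: qform_eq_qf[OF v, symmetric] f_def)
    qed
    then have "fid = (\<Sum>I\<in>strings n k. \<Sum>j<dC. g j I * f j I)"
      unfolding fid_def code_fidelity_def by (simp add: pI_def g_def sum_distrib_left mult_ac)
    then show ?thesis by (simp add: sum.swap[of _ "strings n k"])
  qed
  have \<Omega>psd: "psd dB (\<Omega> j t x)" if "j < dC" for j t x
    unfolding \<Omega>_def using that g0 \<omega> by (intro psd_msum psd_smult) auto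
  have \<Omega>tr: "mtrace (\<Omega> j t x) = of_real (P j t x)" if "j < dC" for j t x
  proof -
    have "mtrace (\<Omega> j t x) = (\<Sum>I\<in>fiber n k t x. mtrace (of_real (g j I) \<cdot>\<^sub>m \<omega> I j))"
      unfolding \<Omega>_def using psd_carrier[OF \<omega>(1)] that by (intro mtrace_msum) auto
    also have "\<dots> = (\<Sum>I\<in>fiber n k t x. of_real (g j I))"
      using mtrace_smult[OF psd_carrier[OF \<omega>(1)]] \<omega>(2) that by (intro sum.cong) auto
    finally show ?thesis by (simp add: P_def marg_def)
  qed
  have P0: "P j t x \<ge> 0" if "j < dC" for j t x
    unfolding P_def marg_def using g0 that by (intro sum_nonneg) auto
  have Psum: "(\<Sum>j<dC. \<Sum>x\<in>strings t k. P j t x) = 1" if "t \<le> n" for t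
    unfolding P_def marg_total[OF that] by (rule g1)
  have Pstep: "P j t x = (\<Sum>i<k. P j (Suc t) (x(t := i)))" if "x \<in> strings t k" "t < n" for j t x
    unfolding P_def by (rule marg_step[OF that])
  have \<Omega>step: "\<Omega> j t x = msum dB dB (\<lambda>i. \<Omega> j (Suc t) (x(t := i))) {..<k}" if "x \<in> strings t k" "t < n" for j t x
  proof (rule eq_matI)
    fix r s assume "r < dim_row (msum dB dB (\<lambda>i. \<Omega> j (Suc t) (x(t := i))) {..<k})" "s < dim_col (msum dB dB (\<lambda>i. \<Omega> j (Suc t) (x(t := i))) {..<k})"
    then have rs: "r < dB" "s < dB" by (auto simp: msum_def)
    have "\<Omega> j t x $$ (r, s) = marg n k t x (\<lambda>I. (of_real (g j I) \<cdot>\<^sub>m \<omega> I j) $$ (r, s))" for t x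
      using rs by (simp add: \<Omega>_def msum_def marg_def)
    then show "\<Omega> j t x $$ (r, s) = msum dB dB (\<lambda>i. \<Omega> j (Suc t) (x(t := i))) {..<k} $$ (r, s)"
      using rs marg_step[OF that] by (simp add: msum_def)
  qed (auto simp: \<Omega>_def msum_def)
  have key: "vn_entropy (mix d k \<phi> (w (t, j, x))) - (\<Sum>i<k. eta (w (t, j, x) i))
      \<le> vn_entropy (\<Omega> j t x) - (\<Sum>i<k. vn_entropy (\<Omega> j (Suc t) (x(t := i)))) + \<delta> * P j t x
        + K * marg n k t x (\<lambda>I. g j I * (1 - f j I))"
    if t: "t < n" and j: "j < dC" and x: "x \<in> strings t k" for t j x
  proof -
    define \<Phi> where "\<Phi> X = letter (d ^ t) d (d ^ (n - Suc t)) (D (embed dB dC j X))" for X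
    have dn: "d ^ t * d * d ^ (n - Suc t) = d ^ n"
    proof -
      have "d ^ t * d * d ^ (n - Suc t) = d ^ (Suc t + (n - Suc t))" by (simp only: power_add power_Suc) (simp add: mult_ac)
      then show ?thesis using t by simp
    qed
    have lt: "schwarz (d ^ n) d (letter (d ^ t) d (d ^ (n - Suc t)))"
      using letter_schwarz[of "d ^ t" d "d ^ (n - Suc t)"] unfolding dn .
    have DE: "schwarz dB (d ^ n) (\<lambda>X. D (embed dB dC j X))"
      by (rule schwarz_comp[OF embed_schwarz[OF j] D])
    have sch: "schwarz dB d \<Phi>" unfolding \<Phi>_def by (rule schwarz_comp[OF DE lt])
    define \<sigma> where "\<sigma> i = \<Phi> (\<Omega> j (Suc t) (x(t := i)))" for i
    have \<sigma>tr: "Re (mtrace (\<sigma> i)) = w (t, j, x) i" for i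
      unfolding \<sigma>_def schwarz_trace[OF sch \<Omega>psd[OF j]] \<Omega>tr[OF j] by (simp add: w_def)
    have 1: "vn_entropy (mix d k \<phi> (w (t, j, x))) - (\<Sum>i<k. eta (w (t, j, x) i))
      \<le> vn_entropy (msum d d \<sigma> {..<k}) - (\<Sum>i<k. vn_entropy (\<sigma> i)) + \<delta> * (\<Sum>i<k. w (t, j, x) i)
        + K * (\<Sum>i<k. w (t, j, x) i - Re (qform (\<sigma> i) (\<phi> i)))"
      using cont[unfolded holevo_slack_def, rule_format, of k \<sigma> \<phi>] schwarz_psd[OF sch \<Omega>psd[OF j]] u
      unfolding \<sigma>tr mix_def[symmetric] by (simp add: \<sigma>_def)
    have "msum d d \<sigma> {..<k} = \<Phi> (\<Omega> j t x)"
      unfolding \<Omega>step[OF x t] \<sigma>_def by (rule schwarz_msum[OF sch psd_carrier[OF \<Omega>psd[OF j]], symmetric])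
    then have 2: "vn_entropy (msum d d \<sigma> {..<k}) - (\<Sum>i<k. vn_entropy (\<sigma> i)) \<le> vn_entropy (\<Omega> j t x) - (\<Sum>i<k. vn_entropy (\<Omega> j (Suc t) (x(t := i))))"
      using data_processing[OF sch, of "{..<k}" "\<lambda>i. \<Omega> j (Suc t) (x(t := i))"] \<Omega>psd[OF j]
      unfolding \<Omega>step[OF x t, symmetric] \<sigma>_def by simp
    \<comment> \<open>For each string compatible with the extended prefix, letter \<open>t\<close>
      has at least the fidelity of the block; linearity of the channel then averages over these
      strings.\<close>
    have 3: "w (t, j, x) i - Re (qform (\<sigma> i) (\<phi> i)) \<le> marg n k (Suc t) (x(t := i)) (\<lambda>I. g j I * (1 - f j I))" if i: "i < k" for i
    proof -
      let ?S = "fiber n k (Suc t) (x(t := i))"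
      note c = unit_vec_d_carrier[OF u[OF i]]
      have "qform (\<sigma> i) (\<phi> i) = (\<Sum>I\<in>?S. of_real (g j I) * qf d (\<Phi> (\<omega> I j)) (\<lambda>r. \<phi> i $ r))"
        unfolding \<sigma>_def \<Omega>_def qform_eq_qf[OF c] using psd_carrier[OF \<omega>(1)] j
        by (intro qf_schwarz_combination[OF sch]) auto
      then have q: "Re (qform (\<sigma> i) (\<phi> i)) = (\<Sum>I\<in>?S. g j I * Re (qform (\<Phi> (\<omega> I j)) (\<phi> i)))"
        by (simp add: qform_eq_qf[OF c])
      have "(\<Sum>I\<in>?S. g j I * f j I) \<le> (\<Sum>I\<in>?S. g j I * Re (qform (\<Phi> (\<omega> I j)) (\<phi> i)))"
      proof (intro sum_mono mult_left_mono)
        fix I assume "I \<in> ?S"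
        then have I: "I \<in> strings n k" and "restrict I {..<Suc t} = x(t := i)" by auto
        then have It: "I t = i" using restrict_Suc_iff[OF x] by blast
        have "unit_vec_d d (\<phi> (I s))" if "s < n" for s
        proof -
          have "I s < k" using I that by auto
          then show ?thesis by (rule u)
        qed
        moreover have "psd (d ^ n) (Y j I)"
          unfolding Y_def by (rule schwarz_psd[OF DE \<omega>(1)[OF I j]])
        ultimately have "f j I \<le> Re (qform (letter (d ^ t) d (d ^ (n - Suc t)) (Y j I)) (\<phi> (I t)))"
          unfolding f_def using t by (intro tens_state_fidelity) auto
        then show "f j I \<le> Re (qform (\<Phi> (\<omega> I j)) (\<phi> i))" by (simp add: It \<Phi>_def Y_def)
        show "0 \<le> g j I" using g0[OF I j] .
      qed
      then show ?thesis
        unfolding q by (simp add: w_def P_def marg_def right_diff_distrib sum_subtractf)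
    qed
    have "(\<Sum>i<k. w (t, j, x) i - Re (qform (\<sigma> i) (\<phi> i))) \<le> (\<Sum>i<k. marg n k (Suc t) (x(t := i)) (\<lambda>I. g j I * (1 - f j I)))"
      using 3 by (intro sum_mono) auto
    also have "\<dots> = marg n k t x (\<lambda>I. g j I * (1 - f j I))" by (rule marg_step[OF x t, symmetric])
    finally have "K * (\<Sum>i<k. w (t, j, x) i - Re (qform (\<sigma> i) (\<phi> i))) \<le> K * marg n k t x (\<lambda>I. g j I * (1 - f j I))"
      using K by (rule mult_left_mono)
    moreover have "(\<Sum>i<k. w (t, j, x) i) = P j t x" using Pstep[OF x t] by (simp add: w_def)
    ultimately show ?thesis using 1 2 by simp
  qed
  \<comment> \<open>Unnormalized Holevo information of the pure letters at position
    \<open>t\<close>, given message and prefix: the subtracted \<open>eta\<close> terms are the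
    entropies of the scaled pure states.\<close>
  define Q where "Q t = (\<Sum>j<dC. \<Sum>x\<in>strings t k. vn_entropy (mix d k \<phi> (w (t, j, x))) - (\<Sum>i<k. eta (w (t, j, x) i)))" for t
  have Q: "Q t \<le> V t - V (Suc t) + \<delta> + K * (1 - fid)" if t: "t < n" for t
  proof -
    have "Q t \<le> (\<Sum>j<dC. \<Sum>x\<in>strings t k. vn_entropy (\<Omega> j t x) - (\<Sum>i<k. vn_entropy (\<Omega> j (Suc t) (x(t := i)))) + \<delta> * P j t x
        + K * marg n k t x (\<lambda>I. g j I * (1 - f j I)))"
      unfolding Q_def using key[OF t] by (intro sum_mono) auto
    also have "\<dots> = V t - (\<Sum>j<dC. \<Sum>x\<in>strings t k. \<Sum>i<k. vn_entropy (\<Omega> j (Suc t) (x(t := i))))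
       + \<delta> * (\<Sum>j<dC. \<Sum>x\<in>strings t k. P j t x) + K * (\<Sum>j<dC. \<Sum>x\<in>strings t k. marg n k t x (\<lambda>I. g j I * (1 - f j I)))"
      unfolding V_def sum_distrib_left by (simp only: sum.distrib sum_subtractf)
    also have "(\<Sum>j<dC. \<Sum>x\<in>strings t k. \<Sum>i<k. vn_entropy (\<Omega> j (Suc t) (x(t := i)))) = V (Suc t)"
      unfolding V_def sum_strings_Suc ..
    also have "(\<Sum>j<dC. \<Sum>x\<in>strings t k. P j t x) = 1" using t by (intro Psum) simp
    also have "(\<Sum>j<dC. \<Sum>x\<in>strings t k. marg n k t x (\<lambda>I. g j I * (1 - f j I))) = 1 - fid"
      using t by (simp add: marg_total right_diff_distrib sum_subtractf g1 fid)
    finally show ?thesis by simp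
  qed
  have "(\<Sum>t<n. Q t) \<le> (\<Sum>t<n. (V t - V (Suc t)) + (\<delta> + K * (1 - fid)))"
    using Q by (intro sum_mono) (auto simp: add.assoc)
  also have "\<dots> = V 0 - V n + n * (\<delta> + K * (1 - fid))"
    by (simp add: sum.distrib sum_lessThan_telescope')
  finally have Qsum: "(\<Sum>t<n. Q t) \<le> V 0 - V n + n * (\<delta> + K * (1 - fid))" .
  \<comment> \<open>With the empty prefix: the conditional entropy of the register given the message
    is at most \<open>log 2 dB\<close>.\<close>
  have V0: "V 0 \<le> E 0 + log 2 dB"
  proof -
    have "V 0 \<le> (\<Sum>j<dC. \<Sum>x\<in>strings 0 k. eta (P j 0 x) + P j 0 x * log 2 dB)"
      unfolding V_def using vn_entropy_upper[OF \<Omega>psd dB] \<Omega>tr by (intro sum_mono) auto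
    also have "\<dots> = E 0 + (\<Sum>j<dC. \<Sum>x\<in>strings 0 k. P j 0 x) * log 2 dB"
      unfolding E_def sum_distrib_right by (simp only: sum.distrib)
    finally show ?thesis using Psum[of 0] by simp
  qed
  \<comment> \<open>Conditional entropy given classical data is nonnegative.\<close>
  have Vn: "E n \<le> V n"
    unfolding E_def V_def using vn_entropy_lower[OF \<Omega>psd] \<Omega>tr by (intro sum_mono) auto
  \<comment> \<open>The classical counterpart of \<open>Q\<close>, which normalization subtracts
    from it. It telescopes exactly, without error terms.\<close>
  define G where "G t = (\<Sum>j<dC. \<Sum>x\<in>strings t k. eta (P j t x) - (\<Sum>i<k. eta (w (t, j, x) i)))" for t
  have G: "G t = E t - E (Suc t)" if "t < n" for t
    unfolding G_def E_def sum_strings_Suc by (simp add: sum_subtractf w_def)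
  then have Gsum: "(\<Sum>t<n. G t) = E 0 - E n" by (simp add: sum_lessThan_telescope')
  have E0: "E 0 \<le> log 2 dC"
  proof -
    have "(\<Sum>j<dC. P j 0 (\<lambda>_. undefined)) = 1" using Psum[of 0] by simp
    then have "(\<Sum>j<dC. eta (P j 0 (\<lambda>_. undefined))) \<le> log 2 dC" using P0 dC by (intro sum_eta_le_log) auto
    then show ?thesis by (simp add: E_def)
  qed
  \<comment> \<open>String and message together have at least the entropy of the string, which is
    \<open>n\<close> times that of a letter by independence.\<close>
  have En: "n * (\<Sum>i<k. eta (p i)) \<le> E n"
  proof -
    have "n * (\<Sum>i<k. eta (p i)) = (\<Sum>I\<in>strings n k. eta (pI I))"
      unfolding pI_def by (rule eta_product_strings[OF p0 p1, symmetric])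
    also have "\<dots> \<le> (\<Sum>I\<in>strings n k. \<Sum>j<dC. eta (g j I))"
    proof (intro sum_mono)
      fix I assume I: "I \<in> strings n k"
      show "eta (pI I) \<le> (\<Sum>j<dC. eta (g j I))"
        unfolding gj[OF I, symmetric] using g0[OF I] by (intro eta_sum_le) auto
    qed
    also have "\<dots> = E n"
      unfolding E_def P_def by (subst sum.swap) (simp add: marg_full)
    finally show ?thesis .
  qed
  define S where "S = Sigma {..<n} (\<lambda>t. {..<dC} \<times> strings t k)"
  \<comment> \<open>The position belongs to the label and is uniformly distributed.\<close>
  define w' where "w' c i = w c i / n" for c i
  have sumS: "(\<Sum>c\<in>S. h c) = (\<Sum>t<n. \<Sum>j<dC. \<Sum>x\<in>strings t k. h (t, j, x))" for h :: "nat \<times> nat \<times> (nat \<Rightarrow> nat) \<Rightarrow> real"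
  proof -
    have "(\<Sum>c\<in>S. h c) = (\<Sum>t<n. \<Sum>y\<in>{..<dC} \<times> strings t k. h (t, y))"
      unfolding S_def using sum.Sigma[of "{..<n}" "\<lambda>t. {..<dC} \<times> strings t k" "\<lambda>t y. h (t, y)"] by simp
    then show ?thesis by (simp only: sum_Times)
  qed
  have n0: "real n > 0" using n by simp
  have w0: "w c i \<ge> 0" if "c \<in> S" for c i using that P0 by (auto simp: w_def S_def)
  have wP: "(\<Sum>i<k. w (t, j, x) i) = P j t x" if "t < n" "x \<in> strings t k" for t j x
    using Pstep[OF that(2,1)] by (simp add: w_def)
  show ?thesis
  proof (rule that[of S w'])
    show "finite S" unfolding S_def by (intro finite_SigmaI finite_cartesian_product) auto
    show "w' c i \<ge> 0" if "c \<in> S" "i < k" for c i using w0[OF that(1)] by (simp add: w'_def)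
    show "(\<Sum>c\<in>S. w' c i) = p i" if i: "i < k" for i
    proof -
      have "(\<Sum>j<dC. \<Sum>x\<in>strings t k. w (t, j, x) i) = p i" if t: "t < n" for t
      proof -
        have "(\<Sum>x\<in>strings t k. w (t, j, x) i) = (\<Sum>I\<in>strings n k. g j I * (if I t = i then 1 else 0))" for j
        proof -
          have "(\<Sum>I\<in>strings n k. g j I * (if I t = i then 1 else 0))
             = (\<Sum>x\<in>strings t k. \<Sum>i'<k. marg n k (Suc t) (x(t := i')) (\<lambda>I. g j I * (if I t = i then 1 else 0)))"
            using marg_total[of "Suc t" n k "\<lambda>I. g j I * (if I t = i then 1 else 0)"] t
            unfolding sum_strings_Suc by simp
          also have "\<dots> = (\<Sum>x\<in>strings t k. \<Sum>i'<k. if i' = i then P j (Suc t) (x(t := i)) else 0)"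
          proof (intro sum.cong refl)
            fix x i' assume x: "x \<in> strings t k" and i': "i' \<in> {..<k}"
            have "marg n k (Suc t) (x(t := i')) (\<lambda>I. g j I * (if I t = i then 1 else 0))
              = marg n k (Suc t) (x(t := i')) (\<lambda>I. if i' = i then g j I else 0)"
              using restrict_Suc_iff[OF x] by (intro marg_cong) auto
            then show "marg n k (Suc t) (x(t := i')) (\<lambda>I. g j I * (if I t = i then 1 else 0)) = (if i' = i then P j (Suc t) (x(t := i)) else 0)"
              by (simp add: P_def marg_def)
          qed
          also have "\<dots> = (\<Sum>x\<in>strings t k. w (t, j, x) i)" using i by (simp add: w_def)
          finally show ?thesis by simp
        qed
        then have "(\<Sum>j<dC. \<Sum>x\<in>strings t k. w (t, j, x) i) = (\<Sum>I\<in>strings n k. \<Sum>j<dC. g j I * (if I t = i then 1 else 0))"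
          by (simp add: sum.swap[of _ "strings n k"])
        also have "\<dots> = (\<Sum>I\<in>strings n k. pI I * (if I t = i then 1 else 0))"
          by (simp add: gj flip: sum_distrib_right)
        also have "\<dots> = p i"
          unfolding pI_def using i sum_prod_strings[OF t p1, of "\<lambda>y. if y = i then 1 else 0"]
          by (simp add: if_distrib[of "\<lambda>z. _ * z"] cong: if_cong)
        finally show ?thesis .
      qed
      then show ?thesis
        unfolding sumS w'_def sum_divide_distrib[symmetric] using n0 by simp
    qed
    \<comment> \<open>The correction \<open>a * eta (1 / n)\<close> is linear in \<open>a\<close>,
      so it takes the same total in the terms that are subtracted from each other below and
      cancels.\<close>
    have sc: "eta (a / n) = eta a / n + a * eta (1 / n)" if "a \<ge> 0" for a
      using eta_mult[of "1 / real n" a] that n0 by simp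
    have etaP: "eta (\<Sum>i<k. w' (t, j, x) i) = eta (P j t x) / n + P j t x * eta (1 / n)" if "t < n" "j < dC" "x \<in> strings t k" for t j x
      unfolding w'_def sum_divide_distrib[symmetric] wP[OF that(1,3)] by (rule sc[OF P0[OF that(2)]])
    have mixP: "vn_entropy (mix d k \<phi> (w' (t, j, x))) = vn_entropy (mix d k \<phi> (w (t, j, x))) / n + P j t x * eta (1 / n)"
      if "t < n" "j < dC" "x \<in> strings t k" for t j x
    proof -
      have c: "(t, j, x) \<in> S" using that by (simp add: S_def)
      have "w' (t, j, x) = (\<lambda>i. 1 / n * w (t, j, x) i)" by (simp add: w'_def fun_eq_iff)
      then show ?thesis
        using vn_entropy_mix_scale[OF u w0[OF c], where c = "1 / real n"] wP[OF that(1,3)] n0 by simp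
    qed
    have "minfo k p S w' = (\<Sum>i<k. eta (p i)) + (\<Sum>t<n. \<Sum>j<dC. \<Sum>x\<in>strings t k. eta (\<Sum>i<k. w' (t, j, x) i) - (\<Sum>i<k. eta (w' (t, j, x) i)))"
      unfolding minfo_def sumS sum_subtractf by simp
    also have "(\<Sum>t<n. \<Sum>j<dC. \<Sum>x\<in>strings t k. eta (\<Sum>i<k. w' (t, j, x) i) - (\<Sum>i<k. eta (w' (t, j, x) i)))
       = (\<Sum>t<n. \<Sum>j<dC. \<Sum>x\<in>strings t k. (eta (P j t x) - (\<Sum>i<k. eta (w (t, j, x) i))) / n)"
    proof (intro sum.cong refl)
      fix t j x assume a: "t \<in> {..<n}" "j \<in> {..<dC}" "x \<in> strings t k"
      then have c: "(t, j, x) \<in> S" by (simp add: S_def)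
      have "(\<Sum>i<k. eta (w' (t, j, x) i)) = (\<Sum>i<k. eta (w (t, j, x) i)) / n + P j t x * eta (1 / n)"
        using a wP[of t x j] by (simp add: w'_def sc[OF w0[OF c]] sum.distrib flip: sum_divide_distrib sum_distrib_right)
      then show "eta (\<Sum>i<k. w' (t, j, x) i) - (\<Sum>i<k. eta (w' (t, j, x) i)) = (eta (P j t x) - (\<Sum>i<k. eta (w (t, j, x) i))) / n"
        using etaP a by (simp add: diff_divide_distrib)
    qed
    also have "\<dots> = (\<Sum>t<n. G t) / n"
      unfolding G_def sum_divide_distrib ..
    \<comment> \<open>\<open>E n - E 0\<close> is the entropy of the string given the message, so
      the right-hand side is the mutual information of string and message per letter.\<close>
    finally have "minfo k p S w' = (\<Sum>i<k. eta (p i)) + (E 0 - E n) / n" unfolding Gsum .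
    also have "\<dots> \<le> log 2 dC / n"
    proof -
      have "(\<Sum>i<k. eta (p i)) \<le> E n / n" using En n0 by (simp add: pos_le_divide_eq mult.commute)
      moreover have "E 0 / n \<le> log 2 dC / n" using E0 n0 by (intro divide_right_mono) auto
      ultimately show ?thesis by (simp add: diff_divide_distrib)
    qed
    finally show "minfo k p S w' \<le> log 2 (real dC) / n" .
    have "cinfo d k \<phi> S w' = (\<Sum>t<n. \<Sum>j<dC. \<Sum>x\<in>strings t k. ((vn_entropy (mix d k \<phi> (w (t, j, x))) - (\<Sum>i<k. eta (w (t, j, x) i)))
         - (eta (P j t x) - (\<Sum>i<k. eta (w (t, j, x) i)))) / n)"
      unfolding cinfo_def sumS by (intro sum.cong refl) (simp add: etaP mixP diff_divide_distrib)
    also have "\<dots> = ((\<Sum>t<n. Q t) - (\<Sum>t<n. G t)) / n"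
      unfolding Q_def G_def sum_subtractf[symmetric] sum_divide_distrib ..
    \<comment> \<open>Up to the error, the sum of \<open>Q\<close> is the total drop of
      \<open>V\<close> and that of \<open>G\<close> the total drop of \<open>E\<close>. Their
      difference is the drop of the conditional entropy \<open>V - E\<close>, which starts at most
      at \<open>log 2 dB\<close> and ends at least at 0.\<close>
    also have "\<dots> \<le> (log 2 dB + n * (\<delta> + K * (1 - fid))) / n"
      unfolding Gsum using Qsum V0 Vn n0 by (intro divide_right_mono) auto
    also have "\<dots> = log 2 dB / n + \<delta> + K * (1 - fid)"
      using n0 by (simp add: add_divide_distrib)
    finally show "cinfo d k \<phi> S w' \<le> log 2 (real dB) / n + \<delta> + K * (1 - code_fidelity k p \<phi> n dB dC pj \<omega> D)"
      unfolding fid_def .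
  qed
qed

theorem theorem3p1:
  fixes d k :: nat and p :: "nat \<Rightarrow> real" and \<phi> :: "nat \<Rightarrow> complex vec" and R Q :: real
  assumes "ensemble d k p \<phi>"
    and "visibly_compressible d k p \<phi> R Q"
  shows "Q \<ge> M_fun d k p \<phi> R"
proof (rule field_le_epsilon)
  fix \<eta> :: real assume \<eta>: "\<eta> > 0"
  have d: "d \<ge> 1" using ensembleD(1)[OF assms(1)] .
  \<comment> \<open>One block length for each choice of tolerances suffices; \<open>Suc N\<close>
    also makes it positive, so that the rates are genuine quotients.\<close>
  have codes: "\<exists>n dB dC pj \<omega> D. n \<ge> 1 \<and> visible_code d k n dB dC pj \<omega> D \<and>
        code_fidelity k p \<phi> n dB dC pj \<omega> D \<ge> 1 - \<epsilon> \<and>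
        log 2 (real dC) / real n \<le> R + \<delta> \<and> log 2 (real dB) / real n \<le> Q + \<delta>" if pos: "\<epsilon> > 0" "\<delta> > 0" for \<epsilon> \<delta>
  proof -
    obtain N where "\<forall>n>N. \<exists>dB dC pj \<omega> D. visible_code d k n dB dC pj \<omega> D \<and>
        code_fidelity k p \<phi> n dB dC pj \<omega> D \<ge> 1 - \<epsilon> \<and>
        log 2 (real dC) / real n \<le> R + \<delta> \<and> log 2 (real dB) / real n \<le> Q + \<delta>"
      using assms(2)[unfolded visibly_compressible_def, rule_format, OF pos] by (elim exE)
    then obtain dB dC pj \<omega> D where "visible_code d k (Suc N) dB dC pj \<omega> D"
        "code_fidelity k p \<phi> (Suc N) dB dC pj \<omega> D \<ge> 1 - \<epsilon>"
        "log 2 (real dC) / real (Suc N) \<le> R + \<delta>" "log 2 (real dB) / real (Suc N) \<le> Q + \<delta>"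
      by (meson lessI)
    then show ?thesis by (intro exI[of _ "Suc N"] exI[of _ dB] exI[of _ dC] exI[of _ pj] exI[of _ \<omega>] exI[of _ D]) simp
  qed
  \<comment> \<open>Classical rates of codes are nonnegative and come within any
    \<open>\<delta>\<close> of \<open>R\<close> from below or lie under it. Time sharing needs this
    to have its fraction between 0 and 1.\<close>
  have R: "R \<ge> 0"
  proof (rule field_le_epsilon)
    fix \<delta> :: real assume "\<delta> > 0"
    then obtain n dB dC pj \<omega> D where "visible_code d k n dB dC pj \<omega> D" "log 2 (real dC) / real n \<le> R + \<delta>"
      using codes[of 1 \<delta>] by auto
    moreover from this(1) have "log 2 (real dC) / real n \<ge> 0" by (auto simp: visible_code_def)
    ultimately show "0 \<le> R + \<delta>" by linarith
  qed
  obtain K where K: "K \<ge> 0" and cont: "holevo_slack d (\<eta> / 4) K"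
    using holevo_pure_continuity[OF d, of "\<eta> / 4"] \<eta> by auto
  \<comment> \<open>Chosen after \<open>K\<close>, which depends on \<open>d\<close> and
    \<open>\<eta>\<close> alone; \<open>K + 1\<close> keeps the denominator positive when
    \<open>K = 0\<close>.\<close>
  define \<epsilon> where "\<epsilon> = \<eta> / (4 * (K + 1))"
  have \<epsilon>: "\<epsilon> > 0" using K \<eta> by (simp add: \<epsilon>_def)
  obtain n dB dC pj \<omega> D where n: "n \<ge> 1" and code: "visible_code d k n dB dC pj \<omega> D"
    and fid: "code_fidelity k p \<phi> n dB dC pj \<omega> D \<ge> 1 - \<epsilon>"
    and rC: "log 2 (real dC) / real n \<le> R + \<eta> / 4" and rB: "log 2 (real dB) / real n \<le> Q + \<eta> / 4"
    using codes[OF \<epsilon>, of "\<eta> / 4"] \<eta> by auto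
  obtain S :: "(nat \<times> nat \<times> (nat \<Rightarrow> nat)) set" and w where S: "finite S"
    and w: "\<And>c i. c \<in> S \<Longrightarrow> i < k \<Longrightarrow> w c i \<ge> 0" "\<And>i. i < k \<Longrightarrow> (\<Sum>c\<in>S. w c i) = p i"
    and mi: "minfo k p S w \<le> log 2 (real dC) / n"
    and ci: "cinfo d k \<phi> S w \<le> log 2 (real dB) / n + \<eta> / 4 + K * (1 - code_fidelity k p \<phi> n dB dC pj \<omega> D)"
    using code_single_letter[OF assms(1) code n K cont] by blast
  have "M_fun d k p \<phi> R \<le> cinfo d k \<phi> S w + \<eta> / 4"
    using mi rC \<eta> by (intro M_fun_le_slack[OF assms(1) S w R]) auto
  moreover have "K * (1 - code_fidelity k p \<phi> n dB dC pj \<omega> D) \<le> \<eta> / 4"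
  proof -
    have "K * (1 - code_fidelity k p \<phi> n dB dC pj \<omega> D) \<le> K * \<epsilon>" using K fid by (intro mult_left_mono) auto
    also have "\<dots> \<le> (K + 1) * \<epsilon>" using \<epsilon> by (simp add: algebra_simps)
    also have "\<dots> = \<eta> / 4" using K by (simp add: \<epsilon>_def field_simps add_nonneg_eq_0_iff)
    finally show ?thesis .
  qed
  \<comment> \<open>Four shares of \<open>\<eta> / 4\<close>: excess quantum rate, continuity,
    infidelity and time sharing.\<close>
  ultimately show "M_fun d k p \<phi> R \<le> Q + \<eta>" using ci rB by linarith
qed

end
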